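(* Let $n\ge3$ be an integer, $(\mathbb R^n,F)$ a Minkowski space, $x_0\in\mathbb R^n$, $a\in[0,1)$, and $p=\frac{2n}{n-2+2a}$. Let $\mu_F$ be the Lebesgue measure on $\mathbb R^n$ normalized so that $\mu_F(\{x: F(x)<1\})=\omega_n$. Then the sharp Caffarelli-Kohn-Nirenberg inequality $$\left(\int_{\mathbb R^n}\frac{|u(x)|^p}{F(x-x_0)^{ap}}\,d\mu_F(x)\right)^{1/p}\le K_a\left(\int_{\mathbb R^n}|Du|(x)^2\,d\mu_F(x)\right)^{1/2}\quad\text{for all }u\in\mathrm{Lip}_0(\mathbb R^n)$$ holds, with $K_a$ the explicit constant given in the context. Moreover, the constant $K_a$ is optimal (the inequality fails with $K_a$ replaced by any smaller constant), and a family of extremals (functions for which equality holds in the inequality) is given by $$u_\lambda(x)=\left(\lambda+F(x-x_0)^{2-ap}\right)^{\frac{2-n}{2-ap}},\quad\lambda>0.$$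
   Context: $\omega_n=\pi^{n/2}/\Gamma(n/2+1)$ is the volume of the Euclidean unit ball in $\mathbb R^n$, and $$K_a:=\left(\frac{1}{(n-2)(n-ap)}\right)^{\frac12}\left(\frac{(2-ap)\,\Gamma\!\left(\frac{2n-2ap}{2-ap}\right)}{n\omega_n\,\Gamma\!\left(\frac{n-ap}{2-ap}\right)^2}\right)^{\frac{2-ap}{2n-2ap}}.$$ A Minkowski space $(\mathbb R^n,F)$ is $\mathbb R^n$ with a Minkowski norm $F:\mathbb R^n\to[0,\infty)$: $F$ is continuous, $C^\infty$ on $\mathbb R^n\setminus\{0\}$, satisfies $F(tv)=|t|F(v)$ for all $t\in\mathbb R$, and the matrix $\frac12\frac{\partial^2(F^2)}{\partial v^i\partial v^j}(v)$ is positive definite for all $v\ne0$. Its distance function is $d_F(x_1,x_2)=F(x_2-x_1)$. $\mathrm{Lip}_0(\mathbb R^n)$ is the space of real-valued Lipschitz functions with compact support, and $|Du|(x)=\limsup_{y\to x}\frac{|u(y)-u(x)|}{F(y-x)}$ is the local Lipschitz constant with respect to $d_F$; one has $|Du|(x)=F^*(Du(x))$ at points of differentiability, where $F^*(\alpha)=\sup_{v\ne0}\alpha(v)/F(v)$ is the dual norm. The functions $u_\lambda$ are not compactly supported; for them equality is understood with both integrals taken over $\mathbb R^n$ ($u_\lambda$ is smooth on $\mathbb R^n\setminus\{x_0\}$). *)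

theory Defs
  imports "HOL-Analysis.Analysis"
begin

section \<open>Minkowski norms\<close>

definition partial_deriv :: "'n \<Rightarrow> (real^'n \<Rightarrow> real) \<Rightarrow> real^'n \<Rightarrow> real" where
  "partial_deriv i f x = frechet_derivative f (at x) (axis i 1)"

text \<open>Only meant for open sets; continuity of the first-order partial derivatives and hence of the
  derivative itself is part of the recursion.\<close>

fun Ck_on :: "nat \<Rightarrow> (real^'n \<Rightarrow> real) \<Rightarrow> (real^'n) set \<Rightarrow> bool" where
  "Ck_on 0 f S \<longleftrightarrow> continuous_on S f"
| "Ck_on (Suc k) f S \<longleftrightarrow>
     (\<forall>x\<in>S. f differentiable (at x)) \<and> (\<forall>i. Ck_on k (partial_deriv i f) S)"

definition Cinf_on :: "(real^'n \<Rightarrow> real) \<Rightarrow> (real^'n) set \<Rightarrow> bool" where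
  "Cinf_on f S \<longleftrightarrow> (\<forall>k. Ck_on k f S)"

definition fundamental_matrix :: "(real^'n \<Rightarrow> real) \<Rightarrow> real^'n \<Rightarrow> real^'n^'n" where
  "fundamental_matrix F v =
     (\<chi> i j. 1 / 2 * partial_deriv i (partial_deriv j (\<lambda>w. (F w)\<^sup>2)) v)"

text \<open>Symmetry is not demanded: it is automatic for the matrices this is applied to.\<close>

definition pos_def_matrix :: "real^'n^'n \<Rightarrow> bool" where
  "pos_def_matrix A \<longleftrightarrow> (\<forall>w. w \<noteq> 0 \<longrightarrow> 0 < w \<bullet> (A *v w))"

definition minkowski_norm :: "(real^'n \<Rightarrow> real) \<Rightarrow> bool" where
  "minkowski_norm F \<longleftrightarrow>
     (\<forall>v. 0 \<le> F v) \<and>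
     continuous_on UNIV F \<and>
     Cinf_on F (- {0}) \<and>
     (\<forall>t v. F (t *\<^sub>R v) = \<bar>t\<bar> * F v) \<and>
     (\<forall>v. v \<noteq> 0 \<longrightarrow> pos_def_matrix (fundamental_matrix F v))"

text \<open>For a Minkowski norm the set \<open>{x. F x < 1}\<close> is open, bounded and nonempty, so its Lebesgue
  measure is positive and finite and the measure below gives it the volume of the Euclidean
  unit ball.\<close>

definition minkowski_measure :: "(real^'n \<Rightarrow> real) \<Rightarrow> (real^'n) measure" where
  "minkowski_measure F =
     scale_measure
       (ennreal (unit_ball_vol (real CARD('n)) / measure lebesgue {x. F x < 1})) lebesgue"

section \<open>Lipschitz functions\<close>

text \<open>A Minkowski norm is comparable to the Euclidean norm, so Lipschitz continuity for the two
  distances is the same.\<close>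

definition Lip0 :: "(real^'n \<Rightarrow> real) set" where
  "Lip0 = {u. (\<exists>L. L-lipschitz_on UNIV u) \<and> compact (closure {x. u x \<noteq> 0})}"

text \<open>The limsup is taken in the extended reals. It is finite for Lipschitz functions; an infinite
  value (possible at the centre for the extremals below) is sent to 0, which only
  matters there on a null set.\<close>

definition local_lip :: "(real^'n \<Rightarrow> real) \<Rightarrow> (real^'n \<Rightarrow> real) \<Rightarrow> real^'n \<Rightarrow> real" where
  "local_lip F u x =
     real_of_ereal (Limsup (at x) (\<lambda>y. ereal (\<bar>u y - u x\<bar> / F (y - x))))"

section \<open>The Caffarelli-Kohn-Nirenberg inequality\<close>

text \<open>Here the value at \<open>x = x0\<close> is 0 by the convention for division by zero; this is
  a null set.\<close>

definition ckn_integrand ::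
    "(real^'n \<Rightarrow> real) \<Rightarrow> real^'n \<Rightarrow> real \<Rightarrow> real \<Rightarrow> (real^'n \<Rightarrow> real) \<Rightarrow> real^'n \<Rightarrow> real" where
  "ckn_integrand F x0 a p u x = \<bar>u x\<bar> powr p / F (x - x0) powr (a * p)"

definition ckn_lhs ::
    "(real^'n \<Rightarrow> real) \<Rightarrow> real^'n \<Rightarrow> real \<Rightarrow> real \<Rightarrow> (real^'n \<Rightarrow> real) \<Rightarrow> real" where
  "ckn_lhs F x0 a p u =
     (\<integral>x. ckn_integrand F x0 a p u x \<partial>minkowski_measure F) powr (1 / p)"

definition ckn_rhs :: "(real^'n \<Rightarrow> real) \<Rightarrow> (real^'n \<Rightarrow> real) \<Rightarrow> real" where
  "ckn_rhs F u = (\<integral>x. (local_lip F u x)\<^sup>2 \<partial>minkowski_measure F) powr (1 / 2)"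

text \<open>Bochner integrals of non-integrable functions are 0, so finiteness of the two integrals is
  recorded separately.\<close>

definition ckn_integrable ::
    "(real^'n \<Rightarrow> real) \<Rightarrow> real^'n \<Rightarrow> real \<Rightarrow> real \<Rightarrow> (real^'n \<Rightarrow> real) \<Rightarrow> bool" where
  "ckn_integrable F x0 a p u \<longleftrightarrow>
     integrable (minkowski_measure F) (ckn_integrand F x0 a p u) \<and>
     integrable (minkowski_measure F) (\<lambda>x. (local_lip F u x)\<^sup>2)"

definition ckn_const :: "real \<Rightarrow> real \<Rightarrow> real \<Rightarrow> real" where
  "ckn_const n a p =
     (1 / ((n - 2) * (n - a * p))) powr (1 / 2) *
     ((2 - a * p) * Gamma ((2 * n - 2 * a * p) / (2 - a * p)) /
        (n * unit_ball_vol n * (Gamma ((n - a * p) / (2 - a * p)))\<^sup>2))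
       powr ((2 - a * p) / (2 * n - 2 * a * p))"

definition ckn_extremal ::
    "(real^'n \<Rightarrow> real) \<Rightarrow> real^'n \<Rightarrow> real \<Rightarrow> real \<Rightarrow> real \<Rightarrow> real^'n \<Rightarrow> real" where
  "ckn_extremal F x0 a p l x =
     (l + F (x - x0) powr (2 - a * p)) powr ((2 - real CARD('n)) / (2 - a * p))"

end

theory Submission
  imports Defs
begin

text \<open>Write \<open>n\<close> for the dimension and \<open>s = a p\<close>, so that \<open>0 \<le> s < 2\<close> and
  \<open>p = 2 (n - s) / (n - 2)\<close>. The inequality is reduced by symmetrization to an inequality for
  nonincreasing functions on the half-line, and that one is proved by mass transport.

  \<^emph>\<open>Symmetrization.\<close> For \<open>u \<ge> 0\<close> let \<open>U h x\<close> be the supremum of \<open>u\<close> over the \<open>F\<close>-ball of radius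
  \<open>h\<close> around \<open>x\<close>. Its superlevel sets are the Minkowski sums of those of \<open>u\<close> with a ball, so by the
  Brunn-Minkowski inequality (\<open>brunn_minkowski\<close>) the radius of the ball with the volume of
  \<open>{U h > t}\<close> exceeds that for \<open>{u > t}\<close> by at least \<open>h\<close>. If \<open>v\<close> is the decreasing rearrangement of
  \<open>u\<close>, a layer cake formula turns this into
  \<open>n b \<integral> (v (r - h) - v r)\<^sup>2 r\<^sup>n\<^sup>-\<^sup>1 dr \<le> \<integral> (U h - u)\<^sup>2 dx\<close>, where \<open>b\<close> is the volume of the unit
  ball (\<open>discrete_polya_szego\<close>). Divided by \<open>h\<^sup>2\<close>, the right-hand side has an upper limit of at most
  \<open>\<integral> |Du|\<^sup>2\<close> as \<open>h\<close> tends to 0, by the reverse Fatou lemma and the definition of \<open>|Du|\<close> as an upper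
  limit of difference quotients (\<open>incr_limsup\<close>). On the other side, \<open>F\<^sup>-\<^sup>s\<close> is radially decreasing,
  so the weighted \<open>L\<^sup>p\<close> norm can only grow under rearrangement (\<open>hardy_littlewood\<close>).

  \<^emph>\<open>The half-line.\<close> What remains is a lower bound for the limit of
  \<open>\<integral> ((v (r - h) - v r) / h)\<^sup>2 r\<^sup>n\<^sup>-\<^sup>1 dr\<close> in terms of \<open>\<integral> v\<^sup>p r\<^sup>n\<^sup>-\<^sup>1\<^sup>-\<^sup>s dr\<close> (\<open>bliss_inequality\<close>). Let
  \<open>T\<close> be the monotone map that transports the measure \<open>v\<^sup>p r\<^sup>n\<^sup>-\<^sup>1\<^sup>-\<^sup>s dr\<close> to the one belonging to the
  extremal. Test the increments of \<open>v\<close> against \<open>v\<^sup>p\<^sup>/\<^sup>2 T\<^sup>\<alpha> r\<^sup>\<alpha>\<^sup>-\<^sup>1\<close> with \<open>\<alpha> = (2 - s) / 2\<close> and move the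
  increment to the other factor. The derivative that appears there is a sum of two terms, and the
  weighted arithmetic-geometric mean inequality bounds it by an expression that the change of
  variables \<open>y = T r\<close> makes independent of \<open>v\<close> (\<open>flux'_lower\<close>). Every inequality in this chain is
  an equality for the extremal, so the constant is the right one; its value is a Beta integral.

  \<^emph>\<open>Equality and optimality.\<close> For a function of \<open>F (x - x0)\<close> the local Lipschitz constant is the
  absolute value of the radial derivative (\<open>local_lip_radial\<close>), so both sides for the functions
  \<open>u\<^sub>\<lambda>\<close> are Beta integrals, and they match (\<open>extremal_equality\<close>). Truncating \<open>u\<^sub>1\<close> near the centre and
  near infinity gives members of \<open>Lip0\<close> with no larger right-hand side and with left-hand sides
  that converge to that of \<open>u\<^sub>1\<close> (\<open>approx_rhs_le\<close>, \<open>approx_lhs_lim\<close>); hence no smaller constant works.\<close>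

section \<open>Minkowski norms satisfy the triangle inequality\<close>

text \<open>All later arguments see a Minkowski norm only through these properties.\<close>

locale gauge_norm =
  fixes F :: "real^'n \<Rightarrow> real"
  assumes pos: "x \<noteq> 0 \<Longrightarrow> 0 < F x"
    and hom: "F (t *\<^sub>R x) = \<bar>t\<bar> * F x"
    and tri: "F (x + y) \<le> F x + F y"
    and cont: "continuous_on UNIV F"

lemma frechet_derivative_eq_sum_partial_deriv:
  fixes f :: "real^'n \<Rightarrow> real"
  assumes "f differentiable (at x)"
  shows "frechet_derivative f (at x) d = (\<Sum>j\<in>UNIV. d $ j * partial_deriv j f x)"
proof -
  interpret linear "frechet_derivative f (at x)"
    using assms by (rule linear_frechet_derivative)
  have "d = (\<Sum>j\<in>UNIV. (d $ j) *\<^sub>R axis j 1)"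
    by (simp add: basis_expansion scalar_mult_eq_scaleR[symmetric])
  then have "frechet_derivative f (at x) d = frechet_derivative f (at x) (\<Sum>j\<in>UNIV. (d $ j) *\<^sub>R axis j 1)"
    by simp
  also have "\<dots> = (\<Sum>j\<in>UNIV. d $ j * partial_deriv j f x)"
    by (simp add: sum scale partial_deriv_def)
  finally show ?thesis .
qed

lemma has_real_derivative_along_line:
  fixes f :: "real^'n \<Rightarrow> real"
  assumes "f differentiable (at (x + t *\<^sub>R d))"
  shows "((\<lambda>t. f (x + t *\<^sub>R d)) has_real_derivative
            (\<Sum>j\<in>UNIV. d $ j * partial_deriv j f (x + t *\<^sub>R d))) (at t)"
proof -
  have g: "((\<lambda>t. x + t *\<^sub>R d) has_derivative (\<lambda>h. h *\<^sub>R d)) (at t)"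
    by (auto intro!: derivative_eq_intros)
  have f: "(f has_derivative frechet_derivative f (at (x + t *\<^sub>R d))) (at (x + t *\<^sub>R d))"
    using assms frechet_derivative_works by blast
  have "((\<lambda>t. f (x + t *\<^sub>R d)) has_derivative
      (\<lambda>h. frechet_derivative f (at (x + t *\<^sub>R d)) (h *\<^sub>R d))) (at t)"
    using diff_chain_at[OF g f] by (simp add: o_def)
  moreover have "frechet_derivative f (at (x + t *\<^sub>R d)) (h *\<^sub>R d)
     = h * (\<Sum>j\<in>UNIV. d $ j * partial_deriv j f (x + t *\<^sub>R d))" for h
    by (simp add: frechet_derivative_eq_sum_partial_deriv[OF assms] sum_distrib_left mult.assoc)
  ultimately show ?thesis
    by (simp add: has_field_derivative_def mult.commute[of _ "sum _ _"])
qed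

context
  fixes F :: "real^'n \<Rightarrow> real"
  assumes mink: "minkowski_norm F"
begin

lemma mink_hom: "F (t *\<^sub>R v) = \<bar>t\<bar> * F v"
  using mink by (simp add: minkowski_norm_def)

lemma mink_zero: "F 0 = 0"
  using mink_hom[of 0 0] by simp

lemma mink_nonneg: "0 \<le> F v"
  using mink by (simp add: minkowski_norm_def)

lemma square_differentiable:
  assumes "w \<noteq> 0"
  shows "(\<lambda>w. (F w)\<^sup>2) differentiable (at w)"
    and "(\<lambda>w. partial_deriv j (\<lambda>w. (F w)\<^sup>2) w) differentiable (at w)"
proof -
  have "Ck_on (Suc (Suc 0)) F (- {0})"
    using mink by (simp only: minkowski_norm_def Cinf_on_def)
  then have F1: "F differentiable (at w)" and F2: "partial_deriv j F differentiable (at w)"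
    if "w \<noteq> 0" for w j
    using that by (simp_all del: One_nat_def)
  show "(\<lambda>w. (F w)\<^sup>2) differentiable (at w)"
    using F1[OF assms] by (intro derivative_intros) auto
  have eq: "partial_deriv j (\<lambda>w. (F w)\<^sup>2) w = 2 * F w * partial_deriv j F w" if "w \<noteq> 0" for w
  proof -
    have "(F has_derivative frechet_derivative F (at w)) (at w)"
      using F1[OF that] frechet_derivative_works by blast
    then have "((\<lambda>w. (F w)\<^sup>2) has_derivative
        (\<lambda>h. 2 * F w * frechet_derivative F (at w) h)) (at w)"
      by (auto intro!: derivative_eq_intros)
    then have "frechet_derivative (\<lambda>w. (F w)\<^sup>2) (at w) = (\<lambda>h. 2 * F w * frechet_derivative F (at w) h)"
      using frechet_derivative_at by metis
    then show ?thesis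
      by (simp add: partial_deriv_def)
  qed
  have "(\<lambda>w. 2 * F w * partial_deriv j F w) differentiable (at w)"
    using F1[OF assms] F2[OF assms] by (intro derivative_intros) auto
  then obtain D where "((\<lambda>w. 2 * F w * partial_deriv j F w) has_derivative D) (at w)"
    by (auto simp: differentiable_def)
  then have "((\<lambda>w. partial_deriv j (\<lambda>w. (F w)\<^sup>2) w) has_derivative D) (at w)"
    by (rule has_derivative_transform_within_open[where s = "- {0}"]) (use assms eq in auto)
  then show "(\<lambda>w. partial_deriv j (\<lambda>w. (F w)\<^sup>2) w) differentiable (at w)"
    by (auto simp: differentiable_def)
qed

text \<open>Along a line in direction \<open>d\<close> the second derivative of \<open>F\<^sup>2\<close> is twice the quadratic form of the
  fundamental matrix, hence positive: this is how the ellipticity hypothesis is used.\<close>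

lemma square_second_derivative_along_line:
  assumes "x + t *\<^sub>R d \<noteq> 0"
  shows "((\<lambda>t. (F (x + t *\<^sub>R d))\<^sup>2) has_real_derivative
            (\<Sum>j\<in>UNIV. d $ j * partial_deriv j (\<lambda>w. (F w)\<^sup>2) (x + t *\<^sub>R d))) (at t)"
    and "((\<lambda>t. \<Sum>j\<in>UNIV. d $ j * partial_deriv j (\<lambda>w. (F w)\<^sup>2) (x + t *\<^sub>R d)) has_real_derivative
            2 * (d \<bullet> (fundamental_matrix F (x + t *\<^sub>R d) *v d))) (at t)"
proof -
  show "((\<lambda>t. (F (x + t *\<^sub>R d))\<^sup>2) has_real_derivative
            (\<Sum>j\<in>UNIV. d $ j * partial_deriv j (\<lambda>w. (F w)\<^sup>2) (x + t *\<^sub>R d))) (at t)"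
    using has_real_derivative_along_line[OF square_differentiable(1)[OF assms]] by simp
  have "((\<lambda>t. \<Sum>j\<in>UNIV. d $ j * partial_deriv j (\<lambda>w. (F w)\<^sup>2) (x + t *\<^sub>R d)) has_real_derivative
     (\<Sum>j\<in>UNIV. d $ j * (\<Sum>i\<in>UNIV. d $ i *
        partial_deriv i (partial_deriv j (\<lambda>w. (F w)\<^sup>2)) (x + t *\<^sub>R d)))) (at t)"
    by (intro DERIV_sum DERIV_cmult has_real_derivative_along_line)
       (use square_differentiable(2)[OF assms] in simp)
  also have "(\<Sum>j\<in>UNIV. d $ j * (\<Sum>i\<in>UNIV. d $ i *
        partial_deriv i (partial_deriv j (\<lambda>w. (F w)\<^sup>2)) (x + t *\<^sub>R d)))
     = 2 * (d \<bullet> (fundamental_matrix F (x + t *\<^sub>R d) *v d))"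
    unfolding inner_vec_def matrix_vector_mult_def fundamental_matrix_def
    by (subst sum_distrib_left, simp add: sum_distrib_left sum_distrib_right, subst sum.swap)
       (simp add: mult_ac)
  finally show "((\<lambda>t. \<Sum>j\<in>UNIV. d $ j * partial_deriv j (\<lambda>w. (F w)\<^sup>2) (x + t *\<^sub>R d)) has_real_derivative
            2 * (d \<bullet> (fundamental_matrix F (x + t *\<^sub>R d) *v d))) (at t)" .
qed

lemma fundamental_matrix_pos: "w \<noteq> 0 \<Longrightarrow> d \<noteq> 0 \<Longrightarrow> 0 < d \<bullet> (fundamental_matrix F w *v d)"
  using mink by (simp add: minkowski_norm_def pos_def_matrix_def)

text \<open>On the ray through \<open>v\<close> homogeneity makes \<open>F\<^sup>2\<close> the parabola \<open>(1 + t)\<^sup>2 (F v)\<^sup>2\<close>, whose second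
  derivative is therefore both \<open>2 (F v)\<^sup>2\<close> and the positive number given by the fundamental matrix.\<close>

lemma mink_pos:
  assumes "v \<noteq> 0"
  shows "0 < F v"
proof -
  let ?g = "\<lambda>t. \<Sum>j\<in>UNIV. v $ j * partial_deriv j (\<lambda>w. (F w)\<^sup>2) (v + t *\<^sub>R v)"
  have nz: "v + t *\<^sub>R v \<noteq> 0" if "-1 < t" for t :: real
    using that assms by (metis add.commute add_eq_0_iff less_irrefl minus_equation_iff 
        scaleR_cancel_right scaleR_minus_left scaleR_one)
  have sq: "(F (v + t *\<^sub>R v))\<^sup>2 = (1 + t)\<^sup>2 * (F v)\<^sup>2" for t
    using mink_hom[of "1 + t" v] by (simp add: scaleR_add_left power_mult_distrib)
  have g: "?g t = 2 * (1 + t) * (F v)\<^sup>2" if "-1 < t" for t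
  proof -
    have "((\<lambda>t. (1 + t)\<^sup>2 * (F v)\<^sup>2) has_real_derivative 2 * (1 + t) * (F v)\<^sup>2) (at t)"
      by (auto intro!: derivative_eq_intros)
    with square_second_derivative_along_line(1)[OF nz[OF that]] show ?thesis
      unfolding sq using DERIV_unique by blast
  qed
  have "((\<lambda>t. 2 * (1 + t) * (F v)\<^sup>2) has_real_derivative 2 * (F v)\<^sup>2) (at 0)"
    by (auto intro!: derivative_eq_intros)
  then have "(?g has_real_derivative 2 * (F v)\<^sup>2) (at 0)"
    by (rule has_field_derivative_transform_within_open[where S = "{-1<..}"]) (use g in auto)
  with square_second_derivative_along_line(2)[of v 0 v] assms
  have "2 * (F v)\<^sup>2 = 2 * (v \<bullet> (fundamental_matrix F v *v v))"
    using DERIV_unique by fastforce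
  with fundamental_matrix_pos[OF assms assms] have "(F v)\<^sup>2 > 0"
    by simp
  then show ?thesis
    using mink_nonneg[of v] by (simp add: less_le)
qed

text \<open>The origin is excluded because \<open>F\<^sup>2\<close> need not have second derivatives there.\<close>

lemma square_convex_off_zero:
  assumes nz: "\<And>t. t \<in> {0..1} \<Longrightarrow> (1 - t) *\<^sub>R x + t *\<^sub>R y \<noteq> 0" and t: "t \<in> {0..1}"
  shows "(F ((1 - t) *\<^sub>R x + t *\<^sub>R y))\<^sup>2 \<le> (1 - t) * (F x)\<^sup>2 + t * (F y)\<^sup>2"
proof (cases "x = y")
  case True
  then show ?thesis by (simp add: scaleR_add_left[symmetric] algebra_simps)
next
  case False
  define d where "d = y - x"
  have line: "(1 - t) *\<^sub>R x + t *\<^sub>R y = x + t *\<^sub>R d" for t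
    by (simp add: d_def algebra_simps)
  have "convex_on {0..1} (\<lambda>t. (F (x + t *\<^sub>R d))\<^sup>2)"
  proof (rule f''_ge0_imp_convex)
    show "((\<lambda>t. (F (x + t *\<^sub>R d))\<^sup>2) has_real_derivative
            (\<Sum>j\<in>UNIV. d $ j * partial_deriv j (\<lambda>w. (F w)\<^sup>2) (x + t *\<^sub>R d))) (at t)"
      if "t \<in> {0..1}" for t
      using square_second_derivative_along_line(1) nz[OF that] line by simp
    show "((\<lambda>t. \<Sum>j\<in>UNIV. d $ j * partial_deriv j (\<lambda>w. (F w)\<^sup>2) (x + t *\<^sub>R d)) has_real_derivative
            2 * (d \<bullet> (fundamental_matrix F (x + t *\<^sub>R d) *v d))) (at t)"
      if "t \<in> {0..1}" for t
      using square_second_derivative_along_line(2) nz[OF that] line by simp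
    show "0 \<le> 2 * (d \<bullet> (fundamental_matrix F (x + t *\<^sub>R d) *v d))" if "t \<in> {0..1}" for t
      using fundamental_matrix_pos[of "x + t *\<^sub>R d" d] nz[OF that] line False
      by (simp add: d_def less_imp_le)
  qed simp
  then have "(F (x + ((1 - t) *\<^sub>R 0 + t *\<^sub>R 1) *\<^sub>R d))\<^sup>2
      \<le> (1 - t) * (F (x + 0 *\<^sub>R d))\<^sup>2 + t * (F (x + 1 *\<^sub>R d))\<^sup>2"
    using t by (intro convex_onD) auto
  then show ?thesis
    unfolding line by (simp add: d_def)
qed

text \<open>Normalise \<open>x\<close> and \<open>y\<close> to the unit sphere of \<open>F\<close>. If the segment between the normalised points
  misses the origin, convexity of \<open>F\<^sup>2\<close> on it keeps \<open>F\<close> at most 1 there, and the segment contains a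
  multiple of \<open>x + y\<close>. Otherwise the normalised points are opposite and everything is collinear.\<close>

lemma mink_tri: "F (x + y) \<le> F x + F y"
proof (cases "x = 0 \<or> y = 0")
  case True
  then show ?thesis using mink_zero by auto
next
  case False
  then have Fp: "0 < F x" "0 < F y"
    using mink_pos by auto
  define x' y' where "x' = (1 / F x) *\<^sub>R x" and "y' = (1 / F y) *\<^sub>R y"
  have x: "x = F x *\<^sub>R x'" and y: "y = F y *\<^sub>R y'"
    using Fp by (simp_all add: x'_def y'_def)
  have F': "F x' = 1" "F y' = 1"
    using Fp by (simp_all add: x'_def y'_def mink_hom)
  show ?thesis
  proof (cases "\<exists>t\<in>{0..1}. (1 - t) *\<^sub>R x' + t *\<^sub>R y' = 0")
    case True
    then obtain t where t: "t \<in> {0..1}" "(1 - t) *\<^sub>R x' = - (t *\<^sub>R y')"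
      by (auto simp: add_eq_0_iff2)
    then have "F ((1 - t) *\<^sub>R x') = F ((- t) *\<^sub>R y')"
      by simp
    then have "t = 1 / 2"
      unfolding mink_hom using F' t by auto
    with t have "y' = - x'"
      by (metis (no_types, opaque_lifting) add.inverse_inverse add_diff_cancel_left' field_sum_of_halves
          half_gt_zero_iff less_irrefl scaleR_left_imp_eq scaleR_minus_right zero_less_one)
    then have "x + y = (F x - F y) *\<^sub>R x'"
      by (metis x y add.commute diff_conv_add_uminus scaleR_left_diff_distrib scaleR_minus_right)
    then have "F (x + y) = \<bar>F x - F y\<bar>"
      by (simp add: mink_hom F')
    then show ?thesis
      using Fp by simp
  next
    case False
    define t where "t = F y / (F x + F y)"
    have t: "t \<in> {0..1}" "1 - t = F x / (F x + F y)"
      using Fp by (auto simp: t_def field_simps)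
    have "(F ((1 - t) *\<^sub>R x' + t *\<^sub>R y'))\<^sup>2 \<le> (1 - t) * (F x')\<^sup>2 + t * (F y')\<^sup>2"
      by (rule square_convex_off_zero) (use False t in auto)
    then have le1: "F ((1 - t) *\<^sub>R x' + t *\<^sub>R y') \<le> 1"
      using F' by (simp add: abs_square_le_1 mink_nonneg)
    have "(F x + F y) *\<^sub>R ((1 - t) *\<^sub>R x' + t *\<^sub>R y') = x + y"
      using Fp unfolding t(2) unfolding t_def
      by (subst (2) x, subst (2) y) (simp add: scaleR_add_right)
    then have "F (x + y) = (F x + F y) * F ((1 - t) *\<^sub>R x' + t *\<^sub>R y')"
      using mink_hom[of "F x + F y" "(1 - t) *\<^sub>R x' + t *\<^sub>R y'"] Fp by simp
    also have "\<dots> \<le> F x + F y"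
      using le1 Fp by (simp add: mult_left_le)
    finally show ?thesis .
  qed
qed

lemma minkowski_norm_imp_gauge_norm: "gauge_norm F"
  using mink mink_pos mink_hom mink_tri by unfold_locales (auto simp: minkowski_norm_def)

end

section \<open>The Brunn-Minkowski inequality\<close>

abbreviation vol :: "(real^'n) set \<Rightarrow> real" where "vol \<equiv> measure lebesgue"

definition msum :: "(real^'n) set \<Rightarrow> (real^'n) set \<Rightarrow> (real^'n) set" where
  "msum A B = (\<Union>x\<in>A. \<Union>y\<in>B. {x + y})"

lemma mem_msum: "z \<in> msum A B \<longleftrightarrow> (\<exists>x\<in>A. \<exists>y\<in>B. z = x + y)"
  by (auto simp: msum_def)

lemma msum_commute: "msum A B = msum B A"
  by (auto simp: msum_def add.commute)

lemma msum_mono: "A \<subseteq> A' \<Longrightarrow> B \<subseteq> B' \<Longrightarrow> msum A B \<subseteq> msum A' B'"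
  by (auto simp: msum_def)

lemma open_msum: "open A \<Longrightarrow> open (msum A B)"
  unfolding msum_def by (rule open_sums) simp

lemma bounded_msum: "bounded A \<Longrightarrow> bounded B \<Longrightarrow> bounded (msum A B)"
  unfolding msum_def by (rule bounded_sums)

lemma lmeasurable_msum: "open A \<Longrightarrow> bounded A \<Longrightarrow> bounded B \<Longrightarrow> msum A B \<in> lmeasurable"
  by (intro lmeasurable_open open_msum bounded_msum)

lemma vol_box:
  fixes a b :: "real^'n"
  shows "vol (box a b) = (\<Prod>i\<in>UNIV. max 0 (b $ i - a $ i))"
proof (cases "\<forall>i. a $ i \<le> b $ i")
  case True
  then have "cbox a b \<noteq> {}"
    by (simp add: interval_ne_empty_cart)
  then have "measure lborel (cbox a b) = (\<Prod>i\<in>UNIV. b $ i - a $ i)"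
    by (rule content_cbox_cart)
  moreover have "vol (box a b) = measure lborel (cbox a b)"
    by (simp add: measure_lborel_box_eq measure_lborel_cbox_eq)
  moreover have "(\<Prod>i\<in>UNIV. max 0 (b $ i - a $ i)) = (\<Prod>i\<in>UNIV. b $ i - a $ i)"
    using True by (intro prod.cong) auto
  ultimately show ?thesis by simp
next
  case False
  then obtain i where i: "b $ i < a $ i"
    by (auto simp: not_le)
  then have "box a b = {}"
    unfolding interval_eq_empty_cart using less_imp_le by blast
  moreover have "(\<Prod>i\<in>UNIV. max 0 (b $ i - a $ i)) = 0"
    using i by (intro prod_zero bexI[of _ i]) auto
  ultimately show ?thesis by simp
qed

text \<open>Finite disjoint unions of nonempty open boxes are the sets for which the Brunn-Minkowski
  inequality is proved by induction on the number of boxes.\<close>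

definition box_family :: "(real^'n) set set \<Rightarrow> bool" where
  "box_family \<A> \<longleftrightarrow> finite \<A> \<and> disjoint \<A> \<and> (\<forall>S\<in>\<A>. S \<noteq> {} \<and> (\<exists>a b. S = box a b))"

lemma box_familyE:
  assumes "box_family \<A>" "S \<in> \<A>"
  obtains a b where "S = box a b" "S \<noteq> {}"
  using assms unfolding box_family_def by blast

lemma box_family_open: "box_family \<A> \<Longrightarrow> open (\<Union>\<A>)"
  unfolding box_family_def by (intro open_Union) (metis open_box)

lemma box_family_bounded: "box_family \<A> \<Longrightarrow> bounded (\<Union>\<A>)"
  unfolding box_family_def by (intro bounded_Union) (auto simp: bounded_box)

lemma box_family_lmeasurable: "box_family \<A> \<Longrightarrow> \<Union>\<A> \<in> lmeasurable"
  by (simp add: box_family_open box_family_bounded lmeasurable_open)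

lemma vol_Union_box_family:
  assumes "box_family \<A>"
  shows "vol (\<Union>\<A>) = (\<Sum>S\<in>\<A>. vol S)"
  using assms unfolding box_family_def
  by (intro measure_Union') (auto simp: disjoint_def pairwise_def disjnt_def)

definition below :: "'n \<Rightarrow> real \<Rightarrow> (real^'n) set" where "below i c = {x. x $ i < c}"
definition above :: "'n \<Rightarrow> real \<Rightarrow> (real^'n) set" where "above i c = {x. c < x $ i}"

definition cut :: "(real^'n) set set \<Rightarrow> (real^'n) set \<Rightarrow> (real^'n) set set" where
  "cut \<A> H = (\<lambda>S. S \<inter> H) ` \<A> - {{}}"

lemma Union_cut: "\<Union>(cut \<A> H) = \<Union>\<A> \<inter> H"
  by (auto simp: cut_def)

lemma box_Int_below: "box a b \<inter> below i c = box a (\<chi> j. if j = i then min (b $ j) c else b $ j)"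
  unfolding set_eq_iff mem_box_cart below_def Int_iff mem_Collect_eq vec_lambda_beta
  by (intro allI iffI conjI) (auto split: if_splits dest: spec)

lemma box_Int_above: "box a b \<inter> above i c = box (\<chi> j. if j = i then max (a $ j) c else a $ j) b"
  unfolding set_eq_iff mem_box_cart above_def Int_iff mem_Collect_eq vec_lambda_beta
  by (intro allI iffI conjI) (auto split: if_splits dest: spec)

lemma box_family_cut:
  assumes "box_family \<A>" and H: "H = below i c \<or> H = above i c"
  shows "box_family (cut \<A> H)"
  unfolding box_family_def
proof (intro conjI ballI)
  show "finite (cut \<A> H)" "disjoint (cut \<A> H)"
    using assms by (auto simp: box_family_def cut_def disjoint_def)
  fix S assume "S \<in> cut \<A> H"
  then show "S \<noteq> {}" by (simp add: cut_def)
  show "\<exists>a b. S = box a b"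
    proof -
    obtain S' where "S = S' \<inter> H" "S' \<in> \<A>"
      using \<open>S \<in> cut \<A> H\<close> by (auto simp: cut_def)
    moreover from this obtain a b where "S' = box a b"
      using assms(1) box_familyE by blast
    ultimately show ?thesis
      using H box_Int_below[of a b i c] box_Int_above[of a b i c] by auto
  qed
qed

lemma card_cut_le: "finite \<A> \<Longrightarrow> card (cut \<A> H) \<le> card \<A>"
  unfolding cut_def by (meson card_Diff1_le card_image_le finite_imageI le_trans)

lemma card_cut_less:
  assumes "finite \<A>" "S \<in> \<A>" "S \<inter> H = {}"
  shows "card (cut \<A> H) < card \<A>"
proof -
  have "cut \<A> H \<subseteq> (\<lambda>S. S \<inter> H) ` (\<A> - {S})"
    using assms by (auto simp: cut_def)
  then have "card (cut \<A> H) \<le> card ((\<lambda>S. S \<inter> H) ` (\<A> - {S}))"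
    using assms by (intro card_mono) auto
  also have "\<dots> \<le> card (\<A> - {S})"
    using assms by (intro card_image_le) auto
  also have "\<dots> < card \<A>"
    using assms by (intro card_Diff1_less) auto
  finally show ?thesis .
qed

lemma negligible_coordinate_hyperplane: "negligible {x::real^'n. x $ i = c}"
proof -
  have "axis i 1 \<in> (Basis :: (real^'n) set)"
    by (auto simp: Basis_vec_def)
  from negligible_standard_hyperplane[OF this, of c] show ?thesis
    by (simp add: cart_eq_inner_axis)
qed

lemma vol_split_hyperplane:
  fixes U :: "(real^'n) set" and i :: 'n
  assumes "U \<in> lmeasurable"
  shows "vol U = vol (U \<inter> below i c) + vol (U \<inter> above i c)"
proof -
  have m: "below i c \<in> sets lebesgue" "above i c \<in> sets lebesgue"
    by (simp_all add: below_def above_def borel_open open_halfspace_component_lt_cart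
        open_halfspace_component_gt_cart)
  have "vol U = vol ((U \<inter> below i c) \<union> (U \<inter> above i c))"
  proof (rule measure_negligible_symdiff[symmetric])
    show "U \<in> lmeasurable" by fact
    show "negligible (sym_diff U (U \<inter> below i c \<union> U \<inter> above i c))"
      by (rule negligible_subset[OF negligible_coordinate_hyperplane[of i c]]) (auto simp: below_def above_def)
  qed
  also have "\<dots> = vol (U \<inter> below i c) + vol (U \<inter> above i c)"
  proof (rule measure_Un_AE)
    show "AE x in lebesgue. x \<notin> U \<inter> below i c \<or> x \<notin> U \<inter> above i c"
      by (auto simp: below_def above_def)
  qed (use assms m in \<open>auto intro: fmeasurable_Int_fmeasurable\<close>)
  finally show ?thesis .
qed

text \<open>Two disjoint boxes are separated by a coordinate hyperplane. Cutting along it leaves fewer boxes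
  on either side, which drives the induction.\<close>

lemma disjoint_boxes_separated:
  fixes a b a' b' :: "real^'n"
  assumes "box a b \<noteq> {}" "box a' b' \<noteq> {}" "box a b \<inter> box a' b' = {}"
  obtains i c where "box a b \<inter> above i c = {}" "box a' b' \<inter> below i c = {}"
    | i c where "box a' b' \<inter> above i c = {}" "box a b \<inter> below i c = {}"
proof -
  have ab: "a $ i < b $ i" "a' $ i < b' $ i" for i
    using assms by (simp_all add: interval_ne_empty_cart)
  have "\<exists>i. b $ i \<le> a' $ i \<or> b' $ i \<le> a $ i"
  proof (rule ccontr)
    assume "\<not> ?thesis"
    then have lt: "a' $ i < b $ i" "a $ i < b' $ i" for i
      by (auto simp: not_le)
    define z :: "real^'n" where "z = (\<chi> i. (max (a $ i) (a' $ i) + min (b $ i) (b' $ i)) / 2)"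
    have "a $ i < z $ i \<and> z $ i < b $ i \<and> a' $ i < z $ i \<and> z $ i < b' $ i" for i
      using ab[of i] lt[of i] by (auto simp: z_def max_def min_def)
    then have "z \<in> box a b \<inter> box a' b'"
      by (simp add: mem_box_cart)
    with assms(3) show False by auto
  qed
  then obtain i where "b $ i \<le> a' $ i \<or> b' $ i \<le> a $ i" by blast
  then show ?thesis
  proof
    assume "b $ i \<le> a' $ i"
    then show ?thesis
      by (intro that(1)[of i "b $ i"]) (auto simp: mem_box_cart above_def below_def not_less
          dest!: spec[of _ i])
  next
    assume "b' $ i \<le> a $ i"
    then show ?thesis
      by (intro that(2)[of i "b' $ i"]) (auto simp: mem_box_cart above_def below_def not_less
          dest!: spec[of _ i])
  qed
qed

lemma vol_open_pos:
  fixes S :: "(real^'n) set"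
  assumes "open S" "bounded S" "S \<noteq> {}"
  shows "0 < vol S"
  using assms open_not_negligible[OF assms(1,3)] lmeasurable_open[OF assms(2,1)]
  by (metis less_le measure_nonneg negligible_iff_measure)

text \<open>The volume below a moving hyperplane is continuous in its position, so the intermediate value
  theorem cuts the second family in the ratio in which the first one has been cut.\<close>

lemma box_family_cut_with_ratio:
  fixes \<B> :: "(real^'n) set set"
  assumes B: "box_family \<B>" and \<theta>: "0 < \<theta>" "\<theta> < 1"
  obtains c where "vol (\<Union>\<B> \<inter> below i c) = \<theta> * vol (\<Union>\<B>)"
proof -
  define f where "f c = vol (\<Union>\<B> \<inter> below i c)" for c
  have f_eq: "f c = (\<Sum>S\<in>\<B>. vol (S \<inter> below i c))" for c
  proof -
    have "f c = vol (\<Union>S\<in>\<B>. S \<inter> below i c)"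
      by (simp add: f_def UN_simps)
    also have "\<dots> = (\<Sum>S\<in>\<B>. vol (S \<inter> below i c))"
    proof (rule measure_UNION')
      show "finite \<B>" using B by (simp add: box_family_def)
      show "S \<inter> below i c \<in> lmeasurable" if "S \<in> \<B>" for S
        using that B box_Int_below by (metis box_family_def lmeasurable_box)
      show "pairwise (\<lambda>S T. disjnt (S \<inter> below i c) (T \<inter> below i c)) \<B>"
        using B by (auto simp: box_family_def disjoint_def pairwise_def disjnt_def)
    qed
    finally show ?thesis .
  qed
  have "continuous_on UNIV (\<lambda>c. vol (S \<inter> below i c))" if S: "S \<in> \<B>" for S
  proof -
    obtain a b where "S = box a b"
      using box_familyE[OF B S] .
    then have eq: "vol (S \<inter> below i c) = (\<Prod>j\<in>UNIV. max 0 ((if j = i then min (b $ j) c else b $ j) - a $ j))" for c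
      by (simp add: box_Int_below vol_box)
    have "continuous_on UNIV (\<lambda>c. if j = i then min (b $ j) c else b $ j)" for j
      by (cases "j = i") (auto intro!: continuous_intros)
    then show ?thesis
      unfolding eq by (intro continuous_intros)
  qed
  then have cont: "continuous_on UNIV f"
    unfolding f_eq[abs_def] by (intro continuous_on_sum)
  obtain R where R: "\<And>x. x \<in> \<Union>\<B> \<Longrightarrow> norm x \<le> R"
    using box_family_bounded[OF B] unfolding bounded_iff by blast
  have comp: "\<bar>x $ i\<bar> < \<bar>R\<bar> + 1" if "x \<in> \<Union>\<B>" for x
    using R[OF that] component_le_norm_cart[of x i] by linarith
  have "\<Union>\<B> \<inter> below i (- (\<bar>R\<bar> + 1)) = {}"
    using comp by (force simp: below_def)
  then have lo: "f (- (\<bar>R\<bar> + 1)) = 0"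
    by (simp add: f_def)
  have "\<Union>\<B> \<inter> below i (\<bar>R\<bar> + 1) = \<Union>\<B>"
    using comp by (force simp: below_def)
  then have hi: "f (\<bar>R\<bar> + 1) = vol (\<Union>\<B>)"
    by (simp add: f_def)
  have "\<exists>c\<ge>- (\<bar>R\<bar> + 1). c \<le> \<bar>R\<bar> + 1 \<and> f c = \<theta> * vol (\<Union>\<B>)"
  proof (rule IVT')
    show "f (- (\<bar>R\<bar> + 1)) \<le> \<theta> * vol (\<Union>\<B>)" "\<theta> * vol (\<Union>\<B>) \<le> f (\<bar>R\<bar> + 1)"
      using \<theta> unfolding lo hi by (auto simp: mult_left_le_one_le)
    show "continuous_on {- (\<bar>R\<bar> + 1)..\<bar>R\<bar> + 1} f"
      using cont continuous_on_subset by blast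
  qed simp
  then show ?thesis
    using that by (auto simp: f_def)
qed

text \<open>For two boxes the sum is the box of added side lengths, and the inequality is the
  arithmetic-geometric mean inequality for the quotients of the side lengths by their sums.\<close>

lemma brunn_minkowski_box:
  fixes a b a' b' :: "real^'n"
  assumes ne: "box a b \<noteq> {}" "box a' b' \<noteq> {}"
  shows "root CARD('n) (vol (box a b)) + root CARD('n) (vol (box a' b'))
           \<le> root CARD('n) (vol (msum (box a b) (box a' b')))"
proof -
  let ?n = "CARD('n)"
  define l l' where "l i = b $ i - a $ i" and "l' i = b' $ i - a' $ i" for i
  have l: "0 < l i" "0 < l' i" for i
    using ne by (simp_all add: interval_ne_empty_cart l_def l'_def)
  have v: "vol (box a b) = (\<Prod>i\<in>UNIV. l i)" "vol (box a' b') = (\<Prod>i\<in>UNIV. l' i)"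
    "vol (box (a + a') (b + b')) = (\<Prod>i\<in>UNIV. l i + l' i)"
    unfolding vol_box
    by (intro prod.cong refl; use l in \<open>simp add: l_def l'_def max_def less_imp_le add_pos_pos\<close>;
        smt (verit) l l_def l'_def)+
  have "box (a + a') (b + b') \<subseteq> msum (box a b) (box a' b')"
  proof
    fix z assume z: "z \<in> box (a + a') (b + b')"
    define x where "x = (\<chi> i. a $ i + l i * ((z $ i - a $ i - a' $ i) / (l i + l' i)))"
    have frac: "0 < (z $ i - a $ i - a' $ i) / (l i + l' i)" "(z $ i - a $ i - a' $ i) / (l i + l' i) < 1" for i
    proof -
      have "a $ i + a' $ i < z $ i" "z $ i < b $ i + b' $ i"
        using z by (simp_all add: mem_box_cart)
      then show "0 < (z $ i - a $ i - a' $ i) / (l i + l' i)" "(z $ i - a $ i - a' $ i) / (l i + l' i) < 1"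
        using l[of i] by (simp_all add: l_def l'_def)
    qed
    have "x \<in> box a b"
      unfolding mem_box_cart
    proof
      fix i
      have "l i * ((z $ i - a $ i - a' $ i) / (l i + l' i)) < l i"
        using l[of i] frac[of i] by (metis mult.right_neutral mult_less_cancel_left_pos)
      moreover have "0 < l i * ((z $ i - a $ i - a' $ i) / (l i + l' i))"
        using l[of i] frac[of i] by (intro mult_pos_pos)
      ultimately show "a $ i < x $ i \<and> x $ i < b $ i"
        unfolding x_def vec_lambda_beta by (simp only: l_def) linarith
    qed
    moreover have "z - x \<in> box a' b'"
      unfolding mem_box_cart
    proof
      fix i
      have eq: "(z - x) $ i = a' $ i + l' i * ((z $ i - a $ i - a' $ i) / (l i + l' i))"
        using l[of i] by (simp add: x_def field_simps add_divide_distrib[symmetric])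
      have "l' i * ((z $ i - a $ i - a' $ i) / (l i + l' i)) < l' i"
        using l[of i] frac[of i] by (metis mult.right_neutral mult_less_cancel_left_pos)
      moreover have "0 < l' i * ((z $ i - a $ i - a' $ i) / (l i + l' i))"
        using l[of i] frac[of i] by (intro mult_pos_pos)
      ultimately show "a' $ i < (z - x) $ i \<and> (z - x) $ i < b' $ i"
        unfolding eq by (simp only: l'_def) linarith
    qed
    ultimately show "z \<in> msum (box a b) (box a' b')"
      unfolding mem_msum by (intro bexI[of _ x] bexI[of _ "z - x"]) auto
  qed
  then have sub: "vol (box (a + a') (b + b')) \<le> vol (msum (box a b) (box a' b'))"
    by (intro measure_mono_fmeasurable lmeasurable_msum) (auto simp: bounded_box)
  have amgm: "root ?n (\<Prod>i\<in>UNIV. x i) \<le> (\<Sum>i\<in>UNIV. x i) / ?n" if "\<And>i::'n. 0 \<le> x i" for x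
    using arith_geom_mean[of "UNIV :: 'n set" x] that
    by (simp add: root_powr_inverse prod_nonneg sum_divide_distrib)
  let ?r = "\<lambda>i. l i / (l i + l' i)" and ?r' = "\<lambda>i. l' i / (l i + l' i)"
  have split: "root ?n (\<Prod>i\<in>UNIV. l i) = root ?n (\<Prod>i\<in>UNIV. ?r i) * root ?n (\<Prod>i\<in>UNIV. l i + l' i)"
    "root ?n (\<Prod>i\<in>UNIV. l' i) = root ?n (\<Prod>i\<in>UNIV. ?r' i) * root ?n (\<Prod>i\<in>UNIV. l i + l' i)"
    unfolding real_root_mult[symmetric] prod.distrib[symmetric]
    using l add_pos_pos[OF l] by (simp_all add: less_imp_neq[symmetric])
  have rpos: "0 \<le> ?r i" "0 \<le> ?r' i" for i
    using l[of i] by simp_all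
  have "root ?n (\<Prod>i\<in>UNIV. ?r i) + root ?n (\<Prod>i\<in>UNIV. ?r' i)
      \<le> (\<Sum>i\<in>UNIV. ?r i) / ?n + (\<Sum>i\<in>UNIV. ?r' i) / ?n"
    by (intro add_mono amgm rpos)
  also have "\<dots> = (\<Sum>i\<in>UNIV. ?r i + ?r' i) / ?n"
    by (simp add: sum.distrib add_divide_distrib)
  also have "\<dots> = 1"
  proof -
    have "?r i + ?r' i = 1" for i
      using l[of i] by (simp add: add_divide_distrib[symmetric])
    then show ?thesis by simp
  qed
  finally have "root ?n (\<Prod>i\<in>UNIV. l i) + root ?n (\<Prod>i\<in>UNIV. l' i) \<le> root ?n (\<Prod>i\<in>UNIV. l i + l' i)"
    unfolding split distrib_right[symmetric]
    using l mult_right_mono[of "root ?n (\<Prod>i\<in>UNIV. ?r i) + root ?n (\<Prod>i\<in>UNIV. ?r' i)" 1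
        "root ?n (\<Prod>i\<in>UNIV. l i + l' i)"]
    by (simp add: prod_nonneg less_imp_le add_pos_pos)
  also have "\<dots> \<le> root ?n (vol (msum (box a b) (box a' b')))"
    using sub v(3) by simp
  finally show ?thesis
    using v by simp
qed

text \<open>The cutting step of Hadwiger and Ohmann. Cut both families by parallel hyperplanes in the same
  volume ratio \<open>\<theta>\<close>. The sums of the two lower parts and of the two upper parts are disjoint
  subsets of the whole sum, and by induction their volumes are at least \<open>\<theta>\<close> and \<open>1 - \<theta>\<close> times the
  \<open>n\<close>-th power of the sum of the roots.\<close>

lemma brunn_minkowski_cut_step:
  fixes \<A> \<B> :: "(real^'n) set set"
  assumes A: "box_family \<A>" and B: "box_family \<B>" "\<B> \<noteq> {}" and card: "2 \<le> card \<A>"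
    and IH: "\<And>\<A>' \<B>' :: (real^'n) set set. box_family \<A>' \<Longrightarrow> box_family \<B>' \<Longrightarrow> \<A>' \<noteq> {} \<Longrightarrow> \<B>' \<noteq> {} \<Longrightarrow>
        card \<A>' + card \<B>' < card \<A> + card \<B> \<Longrightarrow>
        root CARD('n) (vol (\<Union>\<A>')) + root CARD('n) (vol (\<Union>\<B>')) \<le> root CARD('n) (vol (msum (\<Union>\<A>') (\<Union>\<B>')))"
  shows "root CARD('n) (vol (\<Union>\<A>)) + root CARD('n) (vol (\<Union>\<B>)) \<le> root CARD('n) (vol (msum (\<Union>\<A>) (\<Union>\<B>)))"
proof -
  let ?n = "CARD('n)" let ?A = "\<Union>\<A>" and ?B = "\<Union>\<B>"
  have fin: "finite \<A>" "finite \<B>"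
    using A B by (auto simp: box_family_def)
  obtain S S' where S: "S \<in> \<A>" "S' \<in> \<A>" "S \<noteq> S'"
    using card by (metis card_le_Suc0_iff_eq fin(1) not_less_eq_eq numeral_2_eq_2)
  obtain a b where ab: "S = box a b" "S \<noteq> {}"
    using box_familyE[OF A S(1)] .
  obtain a' b' where ab': "S' = box a' b'" "S' \<noteq> {}"
    using box_familyE[OF A S(2)] .
  have "S \<inter> S' = {}"
    using A S by (auto simp: box_family_def disjoint_def)
  obtain i c T T' where T: "T \<in> \<A>" "T' \<in> \<A>" "T \<noteq> {}" "T' \<noteq> {}" "T \<inter> above i c = {}" "T' \<inter> below i c = {}"
  proof (rule disjoint_boxes_separated[of a b a' b'])
    show "box a b \<noteq> {}" "box a' b' \<noteq> {}" "box a b \<inter> box a' b' = {}"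
      using ab ab' \<open>S \<inter> S' = {}\<close> by auto
  qed (use that ab ab' S in blast)+
  define \<theta> where "\<theta> = vol (?A \<inter> below i c) / vol ?A"
  have ob: "open T" "bounded T" "open T'" "bounded T'"
    using box_familyE[OF A T(1)] box_familyE[OF A T(2)] by (metis open_box bounded_box)+
  have m: "?A \<in> lmeasurable" "?B \<in> lmeasurable"
    using A B by (simp_all add: box_family_lmeasurable)
  have eqA: "vol ?A = vol (?A \<inter> below i c) + vol (?A \<inter> above i c)"
    by (rule vol_split_hyperplane) (rule m)
  have T_below: "T \<inter> below i c \<noteq> {}"
  proof
    assume "T \<inter> below i c = {}"
    with T have "T \<subseteq> {x. x $ i = c}"
      by (force simp: below_def above_def)
    then have "negligible T"
      using negligible_coordinate_hyperplane negligible_subset by blast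
    with ob T show False
      using open_not_negligible by blast
  qed
  have T_above: "T' \<inter> above i c \<noteq> {}"
  proof
    assume "T' \<inter> above i c = {}"
    with T have "T' \<subseteq> {x. x $ i = c}"
      by (force simp: below_def above_def)
    then have "negligible T'"
      using negligible_coordinate_hyperplane negligible_subset by blast
    with ob T show False
      using open_not_negligible by blast
  qed
  have pos_cut: "0 < vol (\<Union>\<C> \<inter> H)"
    if "box_family \<C>" "\<Union>\<C> \<inter> H \<noteq> {}" "H = below j d \<or> H = above j d" for \<C> :: "(real^'n) set set" and H j d
    unfolding Union_cut[symmetric]
    using box_family_cut[OF that(1,3)] that(2)
    by (intro vol_open_pos box_family_open box_family_bounded) (simp_all add: Union_cut)
  have pA: "0 < vol (?A \<inter> below i c)" "0 < vol (?A \<inter> above i c)"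
    using T(1,2) T_below T_above by (auto intro!: pos_cut[OF A, of _ i c])
  then have \<theta>: "0 < \<theta>" "\<theta> < 1"
    using eqA by (auto simp: \<theta>_def)
  obtain d where d: "vol (?B \<inter> below i d) = \<theta> * vol ?B"
    using box_family_cut_with_ratio[OF B(1) \<theta>] .
  have eqB: "vol ?B = vol (?B \<inter> below i d) + vol (?B \<inter> above i d)"
    by (rule vol_split_hyperplane) (rule m)
  obtain U where "U \<in> \<B>" using B(2) by blast
  then have "?B \<noteq> {}"
    using box_familyE[OF B(1)] by blast
  then have pB: "0 < vol ?B"
    using B by (intro vol_open_pos box_family_open box_family_bounded)
  have A_below: "vol (?A \<inter> below i c) = \<theta> * vol ?A" and A_above: "vol (?A \<inter> above i c) = (1 - \<theta>) * vol ?A"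
    using pA eqA by (simp_all add: \<theta>_def field_simps)
  have B_below: "vol (?B \<inter> below i d) = \<theta> * vol ?B" and B_above: "vol (?B \<inter> above i d) = (1 - \<theta>) * vol ?B"
    using d eqB by (simp_all add: algebra_simps)
  have ne: "cut \<A> H \<noteq> {}" if "0 < vol (?A \<inter> H)" for H
    using that by (metis Sup_empty Union_cut less_irrefl measure_empty)
  have neB: "cut \<B> H \<noteq> {}" if "0 < vol (?B \<inter> H)" for H
    using that by (metis Sup_empty Union_cut less_irrefl measure_empty)
  let ?s = "root ?n (vol ?A) + root ?n (vol ?B)"
  have s0: "0 \<le> ?s" by simp
  \<comment> \<open>On either side the induction hypothesis applies, because both cuts of the first family have fewer boxes.\<close>
  have half: "\<theta>' * ?s ^ ?n \<le> vol (msum (?A \<inter> H) (?B \<inter> H'))"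
    if H: "H = below i c \<and> H' = below i d \<or> H = above i c \<and> H' = above i d"
      and v: "vol (?A \<inter> H) = \<theta>' * vol ?A" "vol (?B \<inter> H') = \<theta>' * vol ?B" and "0 < \<theta>'"
    for H H' \<theta>'
  proof -
    have "card (cut \<A> H) < card \<A>"
      using H T fin card_cut_less by blast
    then have c: "card (cut \<A> H) + card (cut \<B> H') < card \<A> + card \<B>"
      using card_cut_le[OF fin(2), of H'] by linarith
    have pos: "0 < vol (?A \<inter> H)" "0 < vol (?B \<inter> H')"
      using v pA eqA pB \<open>0 < \<theta>'\<close> by auto
    have "root ?n (vol (\<Union>(cut \<A> H))) + root ?n (vol (\<Union>(cut \<B> H')))
        \<le> root ?n (vol (msum (\<Union>(cut \<A> H)) (\<Union>(cut \<B> H'))))"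
      using H c by (intro IH box_family_cut[OF A, of _ i c] box_family_cut[OF B(1), of _ i d] ne neB pos) auto
    then have "root ?n \<theta>' * ?s \<le> root ?n (vol (msum (?A \<inter> H) (?B \<inter> H')))"
      unfolding Union_cut v by (simp add: real_root_mult distrib_left)
    then have "(root ?n \<theta>' * ?s) ^ ?n \<le> (root ?n (vol (msum (?A \<inter> H) (?B \<inter> H')))) ^ ?n"
      using \<open>0 < \<theta>'\<close> by (intro power_mono) auto
    then show ?thesis
      using \<open>0 < \<theta>'\<close> by (simp add: power_mult_distrib)
  qed
  let ?M1 = "msum (?A \<inter> below i c) (?B \<inter> below i d)" and ?M2 = "msum (?A \<inter> above i c) (?B \<inter> above i d)"
  have lm: "?M1 \<in> lmeasurable" "?M2 \<in> lmeasurable" "msum ?A ?B \<in> lmeasurable"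
    unfolding Union_cut[symmetric]
    using A B box_family_cut[OF A, of _ i c] box_family_cut[OF B(1), of _ i d]
    by (auto intro!: lmeasurable_msum box_family_open box_family_bounded)
  have "?s ^ ?n = \<theta> * ?s ^ ?n + (1 - \<theta>) * ?s ^ ?n"
    by (simp add: algebra_simps)
  also have "\<dots> \<le> vol ?M1 + vol ?M2"
    using half[OF _ A_below B_below] half[OF _ A_above B_above] \<theta> by (intro add_mono) auto
  also have "\<dots> = vol (?M1 \<union> ?M2)"
  proof (rule measure_Un_AE[symmetric])
    show "AE x in lebesgue. x \<notin> ?M1 \<or> x \<notin> ?M2"
    proof (rule AE_I2)
      have "x $ i < c + d" if "x \<in> ?M1" for x
        using that add_strict_mono by (fastforce simp: msum_def below_def)
      moreover have "c + d < x $ i" if "x \<in> ?M2" for x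
        using that add_strict_mono by (fastforce simp: msum_def above_def)
      ultimately show "x \<notin> ?M1 \<or> x \<notin> ?M2" for x
        using less_asym by blast
    qed
  qed (use lm in auto)
  also have "\<dots> \<le> vol (msum ?A ?B)"
    using lm by (intro measure_mono_fmeasurable Un_least msum_mono) auto
  finally have "root ?n (?s ^ ?n) \<le> root ?n (vol (msum ?A ?B))"
    by simp
  then show ?thesis
    using s0 by (simp add: real_root_power_cancel)
qed

lemma brunn_minkowski_box_family:
  fixes \<A> \<B> :: "(real^'n) set set"
  assumes "box_family \<A>" "box_family \<B>" "\<A> \<noteq> {}" "\<B> \<noteq> {}"
  shows "root CARD('n) (vol (\<Union>\<A>)) + root CARD('n) (vol (\<Union>\<B>)) \<le> root CARD('n) (vol (msum (\<Union>\<A>) (\<Union>\<B>)))"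
  using assms
proof (induction "card \<A> + card \<B>" arbitrary: \<A> \<B> rule: less_induct)
  case less
  have fin: "finite \<A>" "finite \<B>"
    using less.prems by (auto simp: box_family_def)
  then have card: "1 \<le> card \<A>" "1 \<le> card \<B>"
    using less.prems by (simp_all add: Suc_le_eq card_gt_0_iff)
  consider "2 \<le> card \<A>" | "2 \<le> card \<B>" | "card \<A> = 1" "card \<B> = 1"
    using card by linarith
  then show ?case
  proof cases
    case 1
    then show ?thesis
      by (rule brunn_minkowski_cut_step[OF less.prems(1,2,4)]) (rule less.hyps)
  next
    case 2
    have "root CARD('n) (vol (\<Union>\<B>)) + root CARD('n) (vol (\<Union>\<A>)) \<le> root CARD('n) (vol (msum (\<Union>\<B>) (\<Union>\<A>)))"
      by (rule brunn_minkowski_cut_step[OF less.prems(2,1,3) 2], rule less.hyps)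
         (simp_all add: add.commute)
    then show ?thesis
      by (simp add: add.commute msum_commute)
  next
    case 3
    then obtain S S' where S: "\<A> = {S}" "\<B> = {S'}"
      by (auto simp: card_1_singleton_iff)
    then have "S \<in> \<A>" "S' \<in> \<B>" by auto
    obtain a b where "S = box a b" "S \<noteq> {}"
      using box_familyE[OF less.prems(1) \<open>S \<in> \<A>\<close>] .
    moreover obtain a' b' where "S' = box a' b'" "S' \<noteq> {}"
      using box_familyE[OF less.prems(2) \<open>S' \<in> \<B>\<close>] .
    ultimately show ?thesis
      using brunn_minkowski_box[of a b a' b'] S by simp
  qed
qed

text \<open>A bounded open set is a countable union of closed boxes with disjoint interiors; finitely many of
  the interiors already have almost the full volume.\<close>

lemma open_inner_box_family:
  fixes A :: "(real^'n) set"
  assumes A: "open A" "bounded A" and "0 < e"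
  obtains \<A> where "box_family \<A>" "\<Union>\<A> \<subseteq> A" "vol A - e < vol (\<Union>\<A>)"
proof -
  obtain a where a: "A \<subseteq> box (- a) a"
    using bounded_subset_box_symmetric[OF A(2)] .
  define a' where "a' = (\<chi> i. \<bar>a $ i\<bar> + 1)"
  have a': "\<bar>a $ i\<bar> < a' $ i" "a $ i \<le> a' $ i" for i
    by (simp_all add: a'_def)
  have sub: "A \<subseteq> cbox (- a') a'"
  proof
    fix x assume "x \<in> A"
    then have "x \<in> box (- a) a" using a by blast
    then show "x \<in> cbox (- a') a'"
      unfolding mem_box_cart by (smt (verit) a' vector_uminus_component)
  qed
  have ne: "box (- a') a' \<noteq> {}"
    unfolding interval_ne_empty_cart by (smt (verit) a' vector_uminus_component)
  have "\<exists>r>0. ball x r \<subseteq> A" if "x \<in> A" for x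
    using A(1) that by (simp add: open_contains_ball)
  then obtain r where r: "\<And>x. x \<in> A \<Longrightarrow> 0 < r x \<and> ball x (r x) \<subseteq> A"
    by metis
  define g where "g x = (if x \<in> A then ball x (r x) else ball x 1)" for x
  have "gauge g"
    using r by (auto simp: gauge_def g_def)
  then obtain \<D> where D: "countable \<D>" "\<Union>\<D> \<subseteq> cbox (- a') a'"
    "\<And>K. K \<in> \<D> \<Longrightarrow> interior K \<noteq> {} \<and> (\<exists>c d. K = cbox c d)"
    "pairwise (\<lambda>A B. interior A \<inter> interior B = {}) \<D>"
    "\<And>K. K \<in> \<D> \<Longrightarrow> \<exists>x \<in> A \<inter> K. K \<subseteq> g x" "A \<subseteq> \<Union>\<D>"
    by (rule covering_lemma[OF sub ne]) blast
  have KA: "K \<subseteq> A" if "K \<in> \<D>" for K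
    using D(5)[OF that] r by (fastforce simp: g_def)
  then have UD: "\<Union>\<D> = A"
    using D(6) by blast
  have box: "\<exists>c d. K = cbox c d \<and> interior K = box c d" if "K \<in> \<D>" for K
    using D(3)[OF that] interior_cbox by metis
  obtain D' where D': "D' \<subseteq> \<D>" "finite D'" "vol (\<Union>\<D>) - e < vol (\<Union>D')"
  proof (rule measure_countable_Union_approachable[OF D(1) \<open>0 < e\<close>])
    show lm: "d \<in> lmeasurable" if "d \<in> \<D>" for d
      using box[OF that] by auto
    show "vol (\<Union>D') \<le> vol A" if "D' \<subseteq> \<D>" "finite D'" for D'
    proof (rule measure_mono_fmeasurable)
      show "\<Union>D' \<subseteq> A" using that KA by blast
      show "\<Union>D' \<in> sets lebesgue"
        using that lm by (intro sets.finite_Union) blast+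
      show "A \<in> lmeasurable" using A by (simp add: lmeasurable_open)
    qed
  qed
  define \<A> where "\<A> = interior ` D'"
  have ne_int: "interior K \<noteq> {}" if "K \<in> D'" for K
    using D(3) D'(1) that by blast
  have disj: "interior K \<inter> interior L = {}" if "K \<in> D'" "L \<in> D'" "K \<noteq> L" for K L
    using D(4) D'(1) that by (auto simp: pairwise_def)
  have "box_family \<A>"
    unfolding box_family_def
  proof (intro conjI ballI)
    show "finite \<A>" using D'(2) by (simp add: \<A>_def)
    show "disjoint \<A>" using disj by (auto simp: \<A>_def disjoint_def)
    fix S assume "S \<in> \<A>"
    then obtain K where K: "K \<in> D'" "S = interior K" by (auto simp: \<A>_def)
    show "S \<noteq> {}" using ne_int K by blast
    show "\<exists>a b. S = box a b" using box[of K] D'(1) K by blast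
  qed
  moreover have "\<Union>\<A> \<subseteq> A"
    using D'(1) KA interior_subset unfolding \<A>_def by blast
  moreover have "vol A - e < vol (\<Union>\<A>)"
  proof -
    have "vol (\<Union>D') = (\<Sum>K\<in>D'. vol K)"
    proof (rule measure_negligible_finite_Union)
      show "finite D'" by fact
      show "S \<in> lmeasurable" if "S \<in> D'" for S
        using box[of S] D'(1) that by auto
      show "pairwise (\<lambda>S T. negligible (S \<inter> T)) D'"
        unfolding pairwise_def
      proof (intro ballI impI)
        fix K L assume KL: "K \<in> D'" "L \<in> D'" "K \<noteq> L"
        obtain c d c' d' where cd: "K = cbox c d" "L = cbox c' d'"
          using box[of K] box[of L] KL D'(1) by blast
        then have "interior (K \<inter> L) = {}"
          using disj[OF KL] by simp
        then show "negligible (K \<inter> L)"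
          unfolding cd Int_interval negligible_interval interior_cbox .
      qed
    qed
    also have "\<dots> = (\<Sum>K\<in>D'. vol (interior K))"
    proof (rule sum.cong[OF refl])
      fix K assume "K \<in> D'"
      then obtain c d where "K = cbox c d" "interior K = box c d"
        using box[of K] D'(1) by blast
      then show "vol K = vol (interior K)"
        by (simp add: measure_lborel_box_eq measure_lborel_cbox_eq)
    qed
    also have "\<dots> = (\<Sum>S\<in>\<A>. vol S)"
      unfolding \<A>_def
    proof (rule sum.reindex_cong[symmetric, OF _ refl refl])
      show "inj_on interior D'"
      proof (rule inj_onI, rule ccontr)
        fix K L assume "K \<in> D'" "L \<in> D'" "interior K = interior L" "K \<noteq> L"
        then show False
          using disj[of K L] ne_int[of K] by simp
      qed
    qed
    also have "\<dots> = vol (\<Union>\<A>)"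
      using vol_Union_box_family[OF \<open>box_family \<A>\<close>] by simp
    finally show ?thesis
      using D'(3) UD by simp
  qed
  ultimately show ?thesis
    using that by blast
qed

text \<open>Exhaust both sets from inside by box families.\<close>

theorem brunn_minkowski:
  fixes A B :: "(real^'n) set"
  assumes A: "open A" "bounded A" "A \<noteq> {}" and B: "open B" "bounded B" "B \<noteq> {}"
  shows "root CARD('n) (vol A) + root CARD('n) (vol B) \<le> root CARD('n) (vol (msum A B))"
proof (rule tendsto_upperbound)
  let ?f = "\<lambda>e. root CARD('n) (vol A - e) + root CARD('n) (vol B - e)"
  have "(?f \<longlongrightarrow> root CARD('n) (vol A - 0) + root CARD('n) (vol B - 0)) (at_right 0)"
    by (intro tendsto_intros)
  then show "(?f \<longlongrightarrow> root CARD('n) (vol A) + root CARD('n) (vol B)) (at_right 0)"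
    by simp
  let ?m = "min (vol A) (vol B)"
  have "0 < ?m"
    unfolding min_less_iff_conj using vol_open_pos[OF A] vol_open_pos[OF B] by blast
  then have "eventually (\<lambda>e. e \<in> {0<..<?m}) (at_right 0)"
    by (rule eventually_at_right_real)
  then show "eventually (\<lambda>e. ?f e \<le> root CARD('n) (vol (msum A B))) (at_right 0)"
  proof eventually_elim
    case (elim e)
    then have e: "0 < e" "e < vol A" "e < vol B" by auto
    obtain \<A> where 1: "box_family \<A>" "\<Union>\<A> \<subseteq> A" "vol A - e < vol (\<Union>\<A>)"
      using open_inner_box_family[OF A(1,2) e(1)] .
    obtain \<B> where 2: "box_family \<B>" "\<Union>\<B> \<subseteq> B" "vol B - e < vol (\<Union>\<B>)"
      using open_inner_box_family[OF B(1,2) e(1)] .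
    have "\<A> \<noteq> {}" "\<B> \<noteq> {}"
      using 1 2 e by auto
    have "?f e \<le> root CARD('n) (vol (\<Union>\<A>)) + root CARD('n) (vol (\<Union>\<B>))"
      using 1 2 by (intro add_mono) auto
    also have "\<dots> \<le> root CARD('n) (vol (msum (\<Union>\<A>) (\<Union>\<B>)))"
      by (rule brunn_minkowski_box_family) fact+
    also have "\<dots> \<le> root CARD('n) (vol (msum A B))"
    proof -
      have "vol (msum (\<Union>\<A>) (\<Union>\<B>)) \<le> vol (msum A B)"
      proof (rule measure_mono_fmeasurable)
        show "msum (\<Union>\<A>) (\<Union>\<B>) \<subseteq> msum A B"
          using 1 2 by (intro msum_mono)
        show "msum (\<Union>\<A>) (\<Union>\<B>) \<in> sets lebesgue"
          using lmeasurable_msum[of "\<Union>\<A>" "\<Union>\<B>"] 1 2 box_family_open box_family_bounded by blast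
        show "msum A B \<in> lmeasurable"
          using A B by (intro lmeasurable_msum)
      qed
      then show ?thesis by simp
    qed
    finally show ?case .
  qed
qed simp

section \<open>Substitution and Beta integrals on the half-line\<close>

text \<open>The substitution rule on \<open>[1/k, k]\<close>, passed to the limit: both sides are measures of increasing
  unions of intervals.\<close>

lemma nn_integral_substitution_Ioi:
  fixes f g g' :: "real \<Rightarrow> real"
  assumes f[measurable]: "f \<in> borel_measurable borel"
    and deriv: "\<And>x. 0 < x \<Longrightarrow> (g has_real_derivative g' x) (at x)"
    and cont: "continuous_on {0<..} g'"
    and nonneg: "\<And>x. 0 < x \<Longrightarrow> 0 \<le> g' x"
    and I: "g ` {0<..} = I"
  shows "(\<integral>\<^sup>+x. ennreal (f x * indicator I x) \<partial>lborel)
       = (\<integral>\<^sup>+x. ennreal (f (g x) * g' x * indicator {0<..} x) \<partial>lborel)"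
proof -
  have contg: "continuous_on {0<..} g"
    using deriv by (meson DERIV_isCont continuous_at_imp_continuous_on greaterThan_iff)
  define G G' where "G x = indicator {0<..} x *\<^sub>R g x" and "G' x = indicator {0<..} x *\<^sub>R g' x" for x
  have [measurable]: "G \<in> borel_measurable borel" "G' \<in> borel_measurable borel"
    unfolding G_def[abs_def] G'_def[abs_def]
    by (rule borel_measurable_continuous_on_indicator, simp, fact)+
  have mono: "g x \<le> g y" if "0 < x" "x \<le> y" for x y
    using deriv nonneg that by (intro DERIV_nonneg_imp_nondecreasing[OF \<open>x \<le> y\<close>]) (meson less_le_trans)
  define A B where "A k = {1 / real (Suc k)..real (Suc k)}" and "B k = {g (1 / real (Suc k))..g (real (Suc k))}" for k
  have le: "1 / real (Suc k) \<le> real (Suc k)" for k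
    by (simp add: field_simps)
  have "incseq A"
    unfolding A_def by (intro incseq_SucI) (auto simp: frac_le intro: order_trans[rotated])
  have "incseq B"
    unfolding B_def
  proof (intro incseq_SucI, unfold atLeastatMost_subset_iff, intro disjI2 conjI)
    show "g (1 / real (Suc (Suc k))) \<le> g (1 / real (Suc k))" for k
      by (intro mono) (auto simp: frac_le)
    show "g (real (Suc k)) \<le> g (real (Suc (Suc k)))" for k
      by (intro mono) auto
  qed
  have arch: "\<exists>k. x \<in> A k" if "0 < x" for x
  proof -
    obtain k1 where "1 / x < real (Suc k1)"
      using reals_Archimedean2[of "1 / x"] by (metis less_trans of_nat_less_iff lessI)
    moreover obtain k2 where "x < real (Suc k2)"
      using reals_Archimedean2[of x] by (metis less_trans of_nat_less_iff lessI)
    ultimately have *: "1 / x < real (Suc (max k1 k2))" "x < real (Suc (max k1 k2))"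
      by auto
    then have "1 / real (Suc (max k1 k2)) < x"
      using that by (simp add: field_simps)
    with * show ?thesis
      by (intro exI[of _ "max k1 k2"]) (simp add: A_def)
  qed
  have A_pos: "0 < x" if "x \<in> A k" for x k
    using that unfolding A_def by (auto intro: less_le_trans[rotated])
  have UA: "(\<Union>k. A k) = {0<..}"
    using arch A_pos by auto
  have UB: "(\<Union>k. B k) = I"
  proof (intro equalityI subsetI)
    fix y assume "y \<in> I"
    then obtain x where x: "0 < x" "y = g x" using I by auto
    then obtain k where "x \<in> A k" using arch by blast
    then have "y \<in> B k"
      using x mono by (auto simp: A_def B_def)
    then show "y \<in> (\<Union>k. B k)" by blast
  next
    fix y assume "y \<in> (\<Union>k. B k)"
    then obtain k where "y \<in> B k" by blast
    moreover have "continuous_on {1 / real (Suc k)..real (Suc k)} g"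
      by (rule continuous_on_subset[OF contg]) (auto intro: less_le_trans[rotated])
    ultimately obtain x where "x \<in> A k" "g x = y"
      using IVT'[of g "1 / real (Suc k)" y "real (Suc k)"] le[of k] by (auto simp: A_def B_def)
    then show "y \<in> I"
      using A_pos I by blast
  qed
  define D E where "D = density lborel (\<lambda>x. ennreal (f x))"
    and "E = density lborel (\<lambda>x. ennreal (f (G x) * G' x))"
  have "emeasure D (B k) = emeasure E (A k)" for k
  proof -
    have sub: "{1 / real (Suc k)..real (Suc k)} \<subseteq> {0<..}"
      by (auto intro: less_le_trans[rotated])
    have "emeasure D (B k) = (\<integral>\<^sup>+x. ennreal (f x * indicator (B k) x) \<partial>lborel)"
      unfolding D_def by (subst emeasure_density) (auto simp: B_def intro!: nn_integral_cong split: split_indicator)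
    also have "\<dots> = (\<integral>\<^sup>+x. ennreal (f (g x) * g' x * indicator (A k) x) \<partial>lborel)"
      unfolding A_def B_def
      by (rule nn_integral_substitution)
         (use sub le deriv nonneg continuous_on_subset[OF cont sub] in \<open>auto simp: set_borel_measurable_def\<close>)
    also have "\<dots> = (\<integral>\<^sup>+x. ennreal (f (G x) * G' x) * indicator (A k) x \<partial>lborel)"
      using A_pos by (auto intro!: nn_integral_cong simp: G_def G'_def split: split_indicator)
    also have "\<dots> = emeasure E (A k)"
      unfolding E_def by (subst emeasure_density) (auto simp: A_def)
    finally show ?thesis .
  qed
  then have "(SUP k. emeasure D (B k)) = (SUP k. emeasure E (A k))"
    by simp
  also have "(SUP k. emeasure D (B k)) = emeasure D I"
    unfolding UB[symmetric] by (rule SUP_emeasure_incseq[OF _ \<open>incseq B\<close>]) (auto simp: B_def D_def)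
  also have "(SUP k. emeasure E (A k)) = emeasure E {0<..}"
    unfolding UA[symmetric] by (rule SUP_emeasure_incseq[OF _ \<open>incseq A\<close>]) (auto simp: A_def E_def)
  finally have "emeasure D I = emeasure E {0<..}" .
  moreover have "I \<in> sets borel"
    unfolding UB[symmetric] by (auto simp: B_def)
  moreover have "emeasure E {0<..} = (\<integral>\<^sup>+x. ennreal (f (g x) * g' x * indicator {0<..} x) \<partial>lborel)"
  proof -
    have "(\<lambda>x. ennreal (f (G x) * G' x)) \<in> borel_measurable lborel"
      by measurable
    then have "emeasure E {0<..} = (\<integral>\<^sup>+x. ennreal (f (G x) * G' x) * indicator {0<..} x \<partial>lborel)"
      unfolding E_def by (rule emeasure_density) simp
    then show ?thesis
      by (auto intro!: nn_integral_cong simp: G_def G'_def split: split_indicator)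
  qed
  moreover have "emeasure D I = (\<integral>\<^sup>+x. ennreal (f x * indicator I x) \<partial>lborel)"
    unfolding D_def using \<open>I \<in> sets borel\<close>
    by (subst emeasure_density) (auto intro!: nn_integral_cong split: split_indicator)
  ultimately show ?thesis by simp
qed

text \<open>Substitute \<open>t = y\<^sup>b / (1 + y\<^sup>b)\<close> in Euler's Beta integral.\<close>

lemma nn_integral_Beta_half_line:
  fixes a c b :: real
  assumes "0 < a" "0 < c" "0 < b"
  shows "(\<integral>\<^sup>+y. ennreal (y powr (b * a - 1) * (1 + y powr b) powr (- (a + c)) * indicator {0<..} y) \<partial>lborel)
       = ennreal (Beta a c / b)"
proof -
  define f where "f t = t powr (a - 1) * (1 - t) powr (c - 1) * indicator {0..1} t" for t :: real
  define g where "g y = y powr b / (1 + y powr b)" for y :: real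
  define g' where "g' y = b * y powr (b - 1) / (1 + y powr b)\<^sup>2" for y :: real
  have pos: "0 < 1 + y powr b" for y
    by (simp add: add_pos_nonneg)
  have "(\<integral>\<^sup>+t. ennreal (indicator {0..1} t * (t powr (a - 1) * (1 - t) powr (c - 1))) \<partial>lborel) = ennreal (Beta a c)"
    by (rule nn_integral_has_integral_lebesgue) (use has_integral_Beta_real[OF assms(1,2)] in auto)
  also have "(\<integral>\<^sup>+t. ennreal (indicator {0..1} t * (t powr (a - 1) * (1 - t) powr (c - 1))) \<partial>lborel)
      = (\<integral>\<^sup>+t. ennreal (f t * indicator {0<..<1} t) \<partial>lborel)"
    by (intro nn_integral_cong) (auto simp: f_def split: split_indicator)
  also have "\<dots> = (\<integral>\<^sup>+y. ennreal (f (g y) * g' y * indicator {0<..} y) \<partial>lborel)"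
  proof (rule nn_integral_substitution_Ioi)
    show "f \<in> borel_measurable borel"
      unfolding f_def by measurable
    show "(g has_real_derivative g' y) (at y)" if "0 < y" for y
    proof -
      have d: "((\<lambda>y. y powr b) has_real_derivative b * y powr (b - 1)) (at y)"
        using has_real_derivative_powr[OF that] .
      have "((\<lambda>y. y powr b / (1 + y powr b)) has_real_derivative
         (b * y powr (b - 1) * (1 + y powr b) - y powr b * (b * y powr (b - 1))) / ((1 + y powr b) * (1 + y powr b))) (at y)"
        by (rule DERIV_divide[OF d DERIV_add[OF DERIV_const d, simplified]]) (use pos in \<open>simp add: less_imp_neq[symmetric]\<close>)
      then show ?thesis
        unfolding g_def g'_def by (simp add: power2_eq_square algebra_simps)
    qed
    show "continuous_on {0<..} g'"
      unfolding g'_def using pos by (intro continuous_intros) (auto simp: less_imp_neq[symmetric])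
    show "0 \<le> g' y" if "0 < y" for y
      using assms by (simp add: g'_def)
    show "g ` {0<..} = {0<..<1}"
    proof (intro equalityI subsetI)
      fix t assume "t \<in> g ` {0<..}"
      then show "t \<in> {0<..<1}"
        using pos by (auto simp: g_def)
    next
      fix t :: real assume t: "t \<in> {0<..<1}"
      define y where "y = (t / (1 - t)) powr (1 / b)"
      have "y powr b = t / (1 - t)"
        using t assms by (simp add: y_def powr_powr)
      then have "g y = t"
        using t by (simp add: g_def divide_simps) (use pos[of y] in \<open>auto simp: algebra_simps\<close>)
      moreover have "0 < y" using t by (simp add: y_def)
      ultimately show "t \<in> g ` {0<..}" by force
    qed
  qed
  also have "\<dots> = (\<integral>\<^sup>+y. ennreal b * ennreal (y powr (b * a - 1) * (1 + y powr b) powr (- (a + c)) * indicator {0<..} y) \<partial>lborel)"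
  proof (rule nn_integral_cong)
    fix y :: real
    show "ennreal (f (g y) * g' y * indicator {0<..} y)
        = ennreal b * ennreal (y powr (b * a - 1) * (1 + y powr b) powr (- (a + c)) * indicator {0<..} y)"
    proof (cases "0 < y")
      case True
      define L where "L = 1 + y powr b"
      have L: "0 < L" "1 < L" using pos True by (simp_all add: L_def)
      have 1: "1 - g y = 1 / L" "g y = y powr b / L"
        using L by (simp_all add: g_def L_def[symmetric] field_simps)
      have "g y \<in> {0..1}"
        using L True by (simp add: g_def L_def[symmetric]) (simp add: L_def)
      then have "f (g y) * g' y = (y powr b / L) powr (a - 1) * (1 / L) powr (c - 1) * (b * y powr (b - 1) / L\<^sup>2)"
        by (simp only: f_def 1(1)) (simp add: 1(2) g'_def L_def[symmetric])
      also have "\<dots> = b * (y powr (b * a - 1) * L powr (- (a + c)))"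
      proof -
        have "(y powr b / L) powr (a - 1) = exp ((a - 1) * (b * ln y - ln L))"
          using True L by (simp add: powr_def ln_div)
        moreover have "(1 / L) powr (c - 1) = exp ((c - 1) * (- ln L))"
          using L by (simp add: powr_def ln_div)
        moreover have "y powr (b - 1) / L\<^sup>2 = exp ((b - 1) * ln y - 2 * ln L)"
        proof -
          have "L\<^sup>2 = exp (2 * ln L)"
            using L by (simp add: exp_double)
          then show ?thesis
            using True by (simp add: powr_def exp_diff)
        qed
        moreover have "y powr (b * a - 1) * L powr (- (a + c)) = exp ((b * a - 1) * ln y + (- (a + c)) * ln L)"
          using True L by (simp add: powr_def exp_add exp_minus exp_diff)
        ultimately have eq: "(y powr b / L) powr (a - 1) * (1 / L) powr (c - 1) * (y powr (b - 1) / L\<^sup>2)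
            = y powr (b * a - 1) * L powr (- (a + c))"
          by (simp only: exp_add[symmetric]) (simp add: algebra_simps)
        show ?thesis
          unfolding eq[symmetric] by simp
      qed
      finally show ?thesis
        using True assms by (simp add: L_def ennreal_mult')
    qed simp
  qed
  also have "\<dots> = ennreal b * (\<integral>\<^sup>+y. ennreal (y powr (b * a - 1) * (1 + y powr b) powr (- (a + c)) * indicator {0<..} y) \<partial>lborel)"
    by (rule nn_integral_cmult) measurable
  finally have eq: "ennreal b * (\<integral>\<^sup>+y. ennreal (y powr (b * a - 1) * (1 + y powr b) powr (- (a + c)) * indicator {0<..} y) \<partial>lborel) = ennreal (Beta a c)"
    by simp
  have inv: "ennreal (1 / b) * (ennreal b * x) = x" for x
    using assms by (simp add: mult.assoc[symmetric] ennreal_mult'[symmetric])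
  have "ennreal (1 / b) * ennreal (Beta a c) = ennreal (Beta a c / b)"
    using assms by (subst ennreal_mult'[symmetric]) auto
  then show ?thesis
    using eq inv by metis
qed

text \<open>The graph of the convex function \<open>x \<mapsto> x\<^sup>q\<close> lies above its tangent at \<open>y\<close>; this is Young's
  inequality for \<open>x\<close> and \<open>y\<^sup>q\<^sup>-\<^sup>1\<close>.\<close>

lemma powr_tangent_le:
  fixes x y q :: real
  assumes "0 \<le> x" "x \<le> y" "1 < q"
  shows "y powr q - x powr q \<le> q * (y powr (q - 1) * (y - x))"
proof -
  have "x * y powr (q - 1) \<le> x powr q / q + (y powr (q - 1)) powr (q / (q - 1)) / (q / (q - 1))"
    using assms by (intro Youngs_inequality) (auto simp: field_simps)
  moreover have "(y powr (q - 1)) powr (q / (q - 1)) = y powr q" "y powr (q - 1) * y = y powr q"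
    using assms by (simp_all add: powr_powr powr_mult_base mult.commute)
  ultimately have "x * y powr (q - 1) \<le> x powr q / q + y powr q * (q - 1) / q"
    by simp
  then have "q * (x * y powr (q - 1)) \<le> x powr q + (q * y powr q - y powr q)"
    using assms by (simp add: field_simps)
  moreover have "q * (y powr (q - 1) * (y - x)) = q * y powr q - q * (x * y powr (q - 1))"
  proof -
    have "q * (y powr (q - 1) * (y - x)) = q * (y powr (q - 1) * y) - q * (x * y powr (q - 1))"
      by (simp add: algebra_simps)
    then show ?thesis
      using \<open>y powr (q - 1) * y = y powr q\<close> by simp
  qed
  ultimately show ?thesis
    by linarith
qed

section \<open>The one-dimensional weighted inequality of Bliss\<close>

text \<open>The parameters of the one-dimensional problem. In the variable \<open>r\<^sup>a\<^sup>l\<close> the weights become those of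
  the radial Sobolev inequality in dimension \<open>2 nu\<close>; the density \<open>k\<close> is that of
  \<open>g\<^sup>p y\<^sup>n\<^sup>-\<^sup>1\<^sup>-\<^sup>s dy\<close> for the extremal \<open>g y = (1 + y\<^sup>2\<^sup>-\<^sup>s)\<close> to the power \<open>- (n - 2) / (2 - s)\<close>.\<close>

locale bliss =
  fixes n s :: real
  assumes n: "3 \<le> n" and s: "0 \<le> s" "s < 2"
begin

definition p where "p = 2 * (n - s) / (n - 2)"
definition q where "q = p / 2 + 1"
definition al where "al = (2 - s) / 2"
definition nu where "nu = (n - s) / (2 - s)"

definition L :: "real \<Rightarrow> real" where "L y = 1 + y powr (2 - s)"
definition k :: "real \<Rightarrow> real" where "k y = y powr (n - 1 - s) * L y powr (- (2 * nu))"
definition J :: real where "J = Beta nu nu / (2 - s)"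

lemma param: "0 < al" "al \<le> 1" "0 < nu" "1 < nu" "2 < p" "1 < q" "0 < n - s" "0 < n - 1 - s" "0 < n - 2" "0 < 2 - s"
  using n s by (auto simp: al_def nu_def p_def q_def field_simps)

text \<open>On this identity and the next one the transport argument rests: in the arithmetic-geometric mean
  step they make the powers of \<open>T\<close> cancel and combine those of \<open>v\<close> and \<open>r\<close> to the density of
  the profile.\<close>

lemma nu_al: "2 * nu * al = n - s"
  using param by (simp add: nu_def al_def)

lemma p_nu: "p = p / (2 * nu) + q"
proof -
  have "p = 2 * nu * ((2 - s) / (n - 2))"
    using param by (simp add: nu_def p_def)
  then have *: "p / (2 * nu) = (2 - s) / (n - 2)"
    using param(3) by simp
  have "(2 - s) / (n - 2) + (n - s) / (n - 2) + (n - 2) / (n - 2) = (2 - s + (n - s) + (n - 2)) / (n - 2)"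
    by (simp only: add_divide_distrib)
  also have "2 - s + (n - s) + (n - 2) = 2 * (n - s)" by simp
  finally have "(2 - s) / (n - 2) + (n - s) / (n - 2) + 1 = p"
    using param(9) by (simp add: p_def)
  moreover have "p = 2 * ((n - s) / (n - 2))"
    by (simp only: p_def times_divide_eq_right)
  ultimately show ?thesis
    unfolding q_def * by linarith
qed

lemma L_ge1: "1 \<le> L y" by (simp add: L_def)
lemma L_pos: "0 < L y" using L_ge1[of y] by linarith
lemma L_nz: "L y = 0 \<Longrightarrow> False" using L_pos[of y] by linarith

lemma k_nonneg: "0 \<le> k y" by (simp add: k_def)
lemma k_pos: "0 < y \<Longrightarrow> 0 < k y" using L_pos[of y] by (simp add: k_def)

lemma continuous_L: "continuous_on {0..} L"
  unfolding L_def using param by (intro continuous_on_add continuous_on_powr' continuous_intros) auto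

lemma continuous_k: "continuous_on {0..} k"
  unfolding k_def using param L_pos
  by (intro continuous_on_mult continuous_on_powr' continuous_L continuous_intros) (auto simp: less_imp_le dest: L_nz)

lemma measurable_k [measurable]: "k \<in> borel_measurable borel" "L \<in> borel_measurable borel"
  unfolding k_def[abs_def] L_def[abs_def] by measurable

lemma total_k: "(\<integral>\<^sup>+y. ennreal (k y * indicator {0<..} y) \<partial>lborel) = ennreal J"
proof -
  have "(2 - s) * nu - 1 = n - 1 - s"
    using param by (simp add: nu_def)
  moreover have "- (nu + nu) = - (2 * nu)" by simp
  ultimately show ?thesis
    using nn_integral_Beta_half_line[of nu nu "2 - s"] param by (simp only: k_def L_def J_def)
qed

text \<open>This ratio between the two integrals over the extremal is what makes the upper and the lower
  bound of the transport argument meet.\<close>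

lemma Beta_step: "Beta (nu + 1) (nu - 1) = (n - s) / (n - 2) * Beta nu nu"
proof -
  have "nu \<notin> \<int>\<^sub>\<le>\<^sub>0" "nu - 1 \<notin> \<int>\<^sub>\<le>\<^sub>0"
    using param nonpos_Ints_nonpos by fastforce+
  note 0 = this
  have 1: "nu * Beta nu (nu - 1) = (2 * nu - 1) * Beta (nu + 1) (nu - 1)"
    using Beta_plus1_left[OF 0(1), of "nu - 1"] by (simp add: algebra_simps)
  have 2: "(nu - 1) * Beta nu (nu - 1) = (2 * nu - 1) * Beta nu nu"
    using Beta_plus1_right[OF 0(2), of nu] by (simp add: algebra_simps)
  have "(2 * nu - 1) * ((nu - 1) * Beta (nu + 1) (nu - 1)) = (nu - 1) * (nu * Beta nu (nu - 1))"
    unfolding 1 by (rule mult.left_commute)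
  also have "\<dots> = nu * ((2 * nu - 1) * Beta nu nu)"
    unfolding 2[symmetric] by (rule mult.left_commute)
  also have "\<dots> = (2 * nu - 1) * (nu * Beta nu nu)"
    by (rule mult.left_commute)
  finally have "(nu - 1) * Beta (nu + 1) (nu - 1) = nu * Beta nu nu"
    using param(4) by simp
  then have "Beta (nu + 1) (nu - 1) = nu / (nu - 1) * Beta nu nu"
    using param(4) by (simp add: eq_divide_eq mult.commute)
  moreover have "nu / (nu - 1) = (n - s) / (n - 2)"
  proof -
    have "nu - 1 = (n - 2) / (2 - s)"
      using param by (simp add: nu_def diff_divide_distrib[symmetric] divide_simps)
    then show ?thesis using param by (simp add: nu_def)
  qed
  ultimately show ?thesis
    by simp
qed

lemma total_k2:
  "(\<integral>\<^sup>+y. ennreal (y powr (2 - s) * k y * indicator {0<..} y) \<partial>lborel) = ennreal ((n - s) / (n - 2) * J)"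
proof -
  have e: "(2 - s) * (nu + 1) - 1 = (2 - s) + (n - 1 - s)"
    using param by (simp add: nu_def field_simps)
  have "(\<integral>\<^sup>+y. ennreal (y powr (2 - s) * k y * indicator {0<..} y) \<partial>lborel)
     = (\<integral>\<^sup>+y. ennreal (y powr ((2 - s) * (nu + 1) - 1) * (1 + y powr (2 - s)) powr (- (nu + 1 + (nu - 1))) * indicator {0<..} y) \<partial>lborel)"
    unfolding e k_def L_def mult.assoc[symmetric] powr_add[symmetric] by simp
  also have "\<dots> = ennreal (Beta (nu + 1) (nu - 1) / (2 - s))"
    using param by (intro nn_integral_Beta_half_line) auto
  finally show ?thesis
    by (simp add: Beta_step J_def)
qed

lemma J_pos: "0 < J"
  using param by (simp add: J_def Beta_def Gamma_real_pos)

definition G where "G y = integral {0..y} k"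

lemma G_deriv:
  assumes "0 < y" shows "(G has_real_derivative k y) (at y)"
proof -
  have "((\<lambda>x. integral {0..x} k) has_real_derivative k y) (at y within {0..y + 1})"
    using assms by (intro integral_has_real_derivative continuous_on_subset[OF continuous_k]) auto
  moreover have "at y within {0..y + 1} = at y"
    using assms by (intro at_within_interior) (simp add: interior_atLeastAtMost_real)
  ultimately show ?thesis
    unfolding G_def[abs_def] by simp
qed

lemma G_cont: "continuous_on {0..} G"
proof -
  have "continuous (at y within {0..}) G" if "0 \<le> y" for y
  proof -
    have "continuous_on {0..y + 1} G"
      unfolding G_def[abs_def]
      by (intro indefinite_integral_continuous_1 integrable_continuous_real continuous_on_subset[OF continuous_k]) auto
    then have "continuous (at y within {0..y + 1}) G"
      using that by (simp add: continuous_on_eq_continuous_within)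
    moreover have "at y within {0..y + 1} = at y within {0..}"
      by (rule at_within_nhd[where S = "{..<y + 1}"]) auto
    ultimately show ?thesis by simp
  qed
  then show ?thesis by (simp add: continuous_on_eq_continuous_within)
qed

lemma G_0: "G 0 = 0" by (simp add: G_def)

lemma G_strict: "0 \<le> x \<Longrightarrow> x < y \<Longrightarrow> G x < G y"
  by (rule DERIV_pos_imp_increasing_open) 
     (use G_deriv k_pos in \<open>auto intro: continuous_on_subset[OF G_cont]\<close>, meson G_deriv k_pos le_less_trans)

lemma G_inj: "0 \<le> x \<Longrightarrow> 0 \<le> y \<Longrightarrow> G x = G y \<Longrightarrow> x = y"
  using G_strict by (metis less_irrefl linorder_neqE_linordered_idom)

lemma G_mono: "0 \<le> x \<Longrightarrow> x \<le> y \<Longrightarrow> G x \<le> G y"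
  using G_strict by (metis less_eq_real_def)

lemma G_nn:
  assumes "0 \<le> y" shows "(\<integral>\<^sup>+t. ennreal (k t * indicator {0<..y} t) \<partial>lborel) = ennreal (G y)"
proof -
  have "(k has_integral G y) {0..y}"
    unfolding G_def by (intro integrable_integral integrable_continuous_real continuous_on_subset[OF continuous_k]) auto
  then have "(\<integral>\<^sup>+t. ennreal (indicator {0..y} t * k t) \<partial>lborel) = ennreal (G y)"
    by (intro nn_integral_has_integral_lebesgue) (auto simp: k_nonneg)
  moreover have "(\<integral>\<^sup>+t. ennreal (k t * indicator {0<..y} t) \<partial>lborel) = (\<integral>\<^sup>+t. ennreal (indicator {0..y} t * k t) \<partial>lborel)"
    using param by (intro nn_integral_cong) (auto simp: k_def split: split_indicator)
  ultimately show ?thesis by simp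
qed

text \<open>\<open>H Y\<close> is the second moment, with exponent \<open>2 - s\<close>, of the extremal density on \<open>(0, Y]\<close>. The
  target measure is cut off at \<open>Y\<close> so that the transport map stays bounded on the whole half-line;
  \<open>Y\<close> tends to infinity only at the end.\<close>

definition H where "H Y = enn2real (\<integral>\<^sup>+t. ennreal (t powr (2 - s) * k t * indicator {0<..Y} t) \<partial>lborel)"

lemma H_nn: "(\<integral>\<^sup>+t. ennreal (t powr (2 - s) * k t * indicator {0<..Y} t) \<partial>lborel) = ennreal (H Y)"
proof -
  have "(\<integral>\<^sup>+t. ennreal (t powr (2 - s) * k t * indicator {0<..Y} t) \<partial>lborel)
     \<le> (\<integral>\<^sup>+y. ennreal (y powr (2 - s) * k y * indicator {0<..} y) \<partial>lborel)"
    by (intro nn_integral_mono) (auto split: split_indicator)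
  then have "(\<integral>\<^sup>+t. ennreal (t powr (2 - s) * k t * indicator {0<..Y} t) \<partial>lborel) < top"
    unfolding total_k2 using ennreal_less_top le_less_trans by blast
  then show ?thesis
    by (simp add: H_def)
qed

lemma H_nonneg: "0 \<le> H Y" by (simp add: H_def)

lemma nn_integral_Ioc_tendsto:
  fixes f :: "real \<Rightarrow> real"
  assumes [measurable]: "f \<in> borel_measurable borel" and "\<And>x. 0 \<le> f x"
  shows "(\<lambda>i. \<integral>\<^sup>+t. ennreal (f t * indicator {0<..real i} t) \<partial>lborel) \<longlonglongrightarrow> (\<integral>\<^sup>+t. ennreal (f t * indicator {0<..} t) \<partial>lborel)"
proof (rule nn_integral_LIMSEQ)
  show "incseq (\<lambda>i t. ennreal (f t * indicator {0<..real i} t))"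
    using assms(2) by (auto simp: incseq_def le_fun_def split: split_indicator)
  show "(\<lambda>i. ennreal (f t * indicator {0<..real i} t)) \<longlonglongrightarrow> ennreal (f t * indicator {0<..} t)" for t
  proof (rule tendsto_eventually)
    obtain N where "t \<le> real N" using real_arch_simple by blast
    then show "eventually (\<lambda>i. ennreal (f t * indicator {0<..real i} t) = ennreal (f t * indicator {0<..} t)) sequentially"
      by (intro eventually_sequentiallyI[of N]) (auto split: split_indicator)
  qed
qed auto

lemma G_lim: "(\<lambda>i. G (real i)) \<longlonglongrightarrow> J"
  using nn_integral_Ioc_tendsto[of k] k_nonneg J_pos G_mono[of 0 "real _"]
  by (simp add: G_nn total_k G_0 tendsto_ennreal_iff)

lemma H_lim: "(\<lambda>i. H (real i)) \<longlonglongrightarrow> (n - s) / (n - 2) * J"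
  using nn_integral_Ioc_tendsto[of "\<lambda>y. y powr (2 - s) * k y"] k_nonneg J_pos param
  by (simp add: H_nn total_k2 H_nonneg tendsto_ennreal_iff)

end

text \<open>A profile that vanishes beyond \<open>R\<close>, normalised so that its mass is that of the extremal on
  \<open>(0, Y]\<close>.\<close>

locale bliss_profile = bliss +
  fixes v :: "real \<Rightarrow> real" and R Y :: real
  assumes v_anti: "x \<le> y \<Longrightarrow> v y \<le> v x"
    and v_nonneg: "0 \<le> v x"
    and v_cont: "continuous_on UNIV v"
    and v_zero: "R \<le> x \<Longrightarrow> v x = 0"
    and R: "0 < R" and Y: "0 < Y"
    and mass: "integral {0..R} (\<lambda>t. v t powr p * t powr (n - 1 - s)) = G Y"
begin

definition m where "m t = v t powr p * t powr (n - 1 - s)"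
definition V where "V r = integral {0..r} m"

lemma measurable_v [measurable]: "v \<in> borel_measurable borel"
  using v_cont by (rule borel_measurable_continuous_onI)

lemma measurable_m [measurable]: "m \<in> borel_measurable borel"
  unfolding m_def[abs_def] by measurable

lemma continuous_m: "continuous_on {0..} m"
  unfolding m_def using param v_nonneg
  by (intro continuous_on_mult continuous_on_powr' continuous_intros continuous_on_subset[OF v_cont]) auto

lemma m_nonneg: "0 \<le> m t" by (simp add: m_def)

lemma V_deriv:
  assumes "0 < r" shows "(V has_real_derivative m r) (at r)"
proof -
  have "((\<lambda>x. integral {0..x} m) has_real_derivative m r) (at r within {0..r + 1})"
    using assms by (intro integral_has_real_derivative continuous_on_subset[OF continuous_m]) auto
  moreover have "at r within {0..r + 1} = at r"
    using assms by (intro at_within_interior) (simp add: interior_atLeastAtMost_real)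
  ultimately show ?thesis
    unfolding V_def[abs_def] by simp
qed

lemma V_cont: "continuous_on {0..b} V"
  unfolding V_def[abs_def]
  by (intro indefinite_integral_continuous_1 integrable_continuous_real continuous_on_subset[OF continuous_m]) auto

lemma V_mono:
  assumes "0 \<le> x" "x \<le> y" shows "V x \<le> V y"
proof (cases "x = y")
  case False
  show ?thesis
  proof (rule DERIV_nonneg_imp_increasing_open[where f = V])
    show "x \<le> y" using assms by simp
    show "\<exists>d. (V has_real_derivative d) (at z) \<and> 0 \<le> d" if "x < z" "z < y" for z
      using V_deriv[of z] m_nonneg that assms by auto
    show "continuous_on {x..y} V"
      by (rule continuous_on_subset[OF V_cont[of y]]) (use assms in auto)
  qed
qed simp

lemma V_0: "V 0 = 0" by (simp add: V_def)

lemma V_R: "V R = G Y"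
  using mass by (simp add: V_def m_def[abs_def])

lemma V_le: "0 \<le> r \<Longrightarrow> V r \<le> G Y"
proof (cases "r \<le> R")
  case False
  have "V r = V R"
  proof (rule DERIV_isconst2[of R r])
    show "R < r" using False by simp
    show "continuous_on {R..r} V"
      by (rule continuous_on_subset[OF V_cont[of r]]) (use R in auto)
    show "(V has_real_derivative 0) (at x)" if "R < x" "x < r" for x
      using V_deriv[of x] that R v_zero[of x] param by (simp add: m_def)
  qed (use False in auto)
  then show ?thesis by (simp add: V_R)
qed (use V_mono[of r R] V_R in auto)

lemma V_nonneg: "0 \<le> r \<Longrightarrow> 0 \<le> V r"
  using V_mono[of 0 r] V_0 by simp

lemma V_pos:
  assumes "0 < r" shows "0 < V r"
proof -
  have "v 0 \<noteq> 0"
  proof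
    assume "v 0 = 0"
    then have "v t = 0" if "0 \<le> t" for t
      using v_anti[OF that] v_nonneg[of t] by simp
    then have "V R = integral {0..R} (\<lambda>t. 0)"
      unfolding V_def by (intro integral_cong) (simp add: m_def)
    then show False
      using V_R G_strict[of 0 Y] G_0 Y by simp
  qed
  then have v0: "0 < v 0" using v_nonneg[of 0] by simp
  have "continuous (at 0) v"
    using v_cont by (simp add: continuous_on_eq_continuous_at)
  then have "eventually (\<lambda>x. 0 < v x) (at 0)"
    using order_tendstoD(1)[OF _ v0] by (simp add: isCont_def)
  then obtain d where d: "0 < d" "\<And>x. x \<noteq> 0 \<Longrightarrow> dist x 0 < d \<Longrightarrow> 0 < v x"
    unfolding eventually_at by auto
  define c where "c = min r (d / 2)"
  have c: "0 < c" "c \<le> r" "c < d" using assms d by (auto simp: c_def)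
  have "V 0 < V c"
  proof (rule DERIV_pos_imp_increasing_open[where f = V])
    show "\<exists>y. (V has_real_derivative y) (at x) \<and> 0 < y" if "0 < x" "x < c" for x
      using V_deriv[of x] d(2)[of x] that c by (intro exI[of _ "m x"]) (auto simp: m_def)
  qed (use c V_cont in auto)
  also have "V c \<le> V r" using c by (intro V_mono) auto
  finally show ?thesis by (simp add: V_0)
qed

text \<open>\<open>T\<close> is the monotone transport map: the mass of the profile on \<open>(0, r]\<close> equals the mass of the
  extremal on \<open>(0, T r]\<close>.\<close>

definition Ginv where "Ginv c = (THE y. 0 \<le> y \<and> G y = c)"
definition T where "T r = Ginv (V r)"

lemma Ginv_G: "0 \<le> y \<Longrightarrow> Ginv (G y) = y"
  unfolding Ginv_def using G_inj by (intro the_equality) auto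

lemma G_IVT:
  assumes "0 \<le> c" "c \<le> G b" "0 \<le> b"
  obtains y where "0 \<le> y" "y \<le> b" "G y = c"
  using IVT'[of G 0 c b] assms continuous_on_subset[OF G_cont, of "{0..b}"] G_0 by auto

lemma T_props:
  assumes "0 \<le> r" shows "0 \<le> T r" "T r \<le> Y" "G (T r) = V r"
proof -
  obtain y where "0 \<le> y" "y \<le> Y" "G y = V r"
    using G_IVT[of "V r" Y] V_nonneg[OF assms] V_le[OF assms] Y by auto
  then show "0 \<le> T r" "T r \<le> Y" "G (T r) = V r"
    using Ginv_G[of y] by (simp_all add: T_def)
qed

lemma T_pos: "0 < r \<Longrightarrow> 0 < T r"
  using T_props[of r] V_pos[of r] G_0 by (metis less_eq_real_def less_irrefl)

lemma T_image: "T ` {0<..} = {0<..Y}"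
proof (intro equalityI subsetI)
  fix y assume "y \<in> T ` {0<..}"
  then show "y \<in> {0<..Y}" using T_pos T_props by fastforce
next
  fix y assume y: "y \<in> {0<..Y}"
  have "G 0 < G y" "G y \<le> G Y" using y by (auto intro: G_strict G_mono)
  then obtain r where r: "0 \<le> r" "r \<le> R" "V r = G y"
    using IVT'[of V 0 "G y" R] V_cont V_0 V_R R G_0 by auto
  moreover have "r \<noteq> 0" using r V_0 G_0 \<open>G 0 < G y\<close> by auto
  moreover have "T r = y" using r y by (simp add: T_def Ginv_G)
  ultimately show "y \<in> T ` {0<..}" by force
qed

definition T' where "T' r = m r / k (T r)"

lemma Ginv_deriv:
  assumes "0 < y" shows "(Ginv has_real_derivative inverse (k y)) (at (G y))"
proof (rule DERIV_inverse_function[where f = G and a = 0 and b = "G (2 * y)"])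
  show "(G has_real_derivative k y) (at (Ginv (G y)))"
    using G_deriv assms by (simp add: Ginv_G)
  show "k y \<noteq> 0" using k_pos[OF assms] by simp
  show "0 < G y" "G y < G (2 * y)" using G_strict[of 0 y] G_strict[of y "2 * y"] assms G_0 by auto
  show "G (Ginv z) = z" if z: "0 < z" "z < G (2 * y)" for z
  proof -
    obtain x where "0 \<le> x" "x \<le> 2 * y" "G x = z"
      by (rule G_IVT[of z "2 * y"]) (use z assms in auto)
    then show ?thesis using Ginv_G by auto
  qed
  show "isCont Ginv (G y)"
  proof (rule isCont_inverse_function[where f = G and x = y and d = "y / 2"])
    show "0 < y / 2" using assms by simp
    show "Ginv (G z) = z" if "\<bar>z - y\<bar> \<le> y / 2" for z
      using that assms by (intro Ginv_G) linarith
    show "isCont G z" if "\<bar>z - y\<bar> \<le> y / 2" for z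
    proof -
      have "0 < z" using that assms by linarith
      then show ?thesis using G_deriv DERIV_isCont by blast
    qed
  qed
qed

lemma T_deriv:
  assumes "0 < r" shows "(T has_real_derivative T' r) (at r)"
proof -
  have "(Ginv has_real_derivative inverse (k (T r))) (at (V r))"
    using Ginv_deriv[OF T_pos[OF assms]] T_props[of r] assms by simp
  from DERIV_chain[OF this V_deriv[OF assms]] show ?thesis
    by (simp add: T_def[abs_def] T'_def o_def field_simps)
qed

lemma T'_nonneg: "0 \<le> T' r"
  by (simp add: T'_def m_nonneg k_nonneg)

lemma T_contOn: "continuous_on {0<..} T"
  using T_deriv by (meson DERIV_isCont continuous_at_imp_continuous_on greaterThan_iff)

lemma T'_contOn: "continuous_on {0<..} T'"
proof -
  have "continuous_on {0<..} (\<lambda>r. k (T r))"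
    by (rule continuous_on_compose2[OF continuous_k T_contOn]) (use T_pos in \<open>auto intro: less_imp_le\<close>)
  moreover have "k (T r) \<noteq> 0" if "0 < r" for r
    using k_pos[OF T_pos[OF that]] by simp
  moreover have "continuous_on {0<..} m"
    by (rule continuous_on_subset[OF continuous_m]) auto
  ultimately show ?thesis
    unfolding T'_def by (intro continuous_on_divide) auto
qed

lemma T_mono:
  assumes "0 < x" "x \<le> y" shows "T x \<le> T y"
proof (rule DERIV_nonneg_imp_nondecreasing[where f = T, OF assms(2)])
  show "\<exists>d. (T has_real_derivative d) (at z) \<and> 0 \<le> d" if "x \<le> z" "z \<le> y" for z
    using T_deriv[of z] T'_nonneg[of z] assms that by (intro exI[of _ "T' z"]) auto
qed

lemma T_nonpos: "r \<le> 0 \<Longrightarrow> T r = 0"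
proof -
  assume "r \<le> 0"
  then have "V r = G 0" by (cases "r = 0") (simp_all add: V_def G_def)
  then show ?thesis by (simp add: T_def Ginv_G)
qed

lemma measurable_T [measurable]: "T \<in> borel_measurable borel"
proof -
  have "(\<lambda>r. indicator {0<..} r *\<^sub>R T r) \<in> borel_measurable borel"
    by (rule borel_measurable_continuous_on_indicator, simp, rule T_contOn)
  moreover have "(\<lambda>r. indicator {0<..} r *\<^sub>R T r) = T"
    using T_nonpos by (auto simp: fun_eq_iff split: split_indicator)
  ultimately show ?thesis by simp
qed

text \<open>The change of variables \<open>y = T r\<close>; the Jacobian \<open>T'\<close> turns the extremal density into the density
  of the profile.\<close>

lemma transport:
  assumes [measurable]: "f \<in> borel_measurable borel"
  shows "(\<integral>\<^sup>+r. ennreal (f (T r) * m r * indicator {0<..} r) \<partial>lborel)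
       = (\<integral>\<^sup>+y. ennreal (f y * k y * indicator {0<..Y} y) \<partial>lborel)"
proof -
  have "(\<integral>\<^sup>+y. ennreal (f y * k y * indicator {0<..Y} y) \<partial>lborel)
      = (\<integral>\<^sup>+r. ennreal (f (T r) * k (T r) * T' r * indicator {0<..} r) \<partial>lborel)"
    by (rule nn_integral_substitution_Ioi) (use T_deriv T'_contOn T'_nonneg T_image in auto)
  also have "\<dots> = (\<integral>\<^sup>+r. ennreal (f (T r) * m r * indicator {0<..} r) \<partial>lborel)"
  proof (intro nn_integral_cong)
    fix r :: real
    show "ennreal (f (T r) * k (T r) * T' r * indicator {0<..} r) = ennreal (f (T r) * m r * indicator {0<..} r)"
      using k_pos[OF T_pos[of r]] by (cases "0 < r") (auto simp: T'_def)
  qed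
  finally show ?thesis by simp
qed

text \<open>The increments of \<open>v\<close> are tested against \<open>v\<^sup>p\<^sup>/\<^sup>2 B\<close> with \<open>B = T\<^sup>a\<^sup>l r\<^sup>a\<^sup>l\<^sup>-\<^sup>1\<close> and the weight \<open>r\<^sup>n\<^sup>-\<^sup>1\<close>.
  Here \<open>flux\<close> is \<open>B r\<^sup>n\<^sup>-\<^sup>1\<close>, and \<open>flux_sq\<close> below is \<open>B\<^sup>2 r\<^sup>n\<^sup>-\<^sup>1\<close>.\<close>

definition flux where "flux r = r powr (n - 2 + al) * T r powr al"
definition flux' where "flux' r = (n - 2 + al) * r powr (n - 3 + al) * T r powr al + r powr (n - 2 + al) * (al * T r powr (al - 1) * T' r)"

lemma measurable_flux [measurable]: "flux \<in> borel_measurable borel"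
  unfolding flux_def[abs_def] by measurable

lemma flux_deriv:
  assumes "0 < r" shows "(flux has_real_derivative flux' r) (at r)"
proof -
  have 1: "((\<lambda>r. r powr (n - 2 + al)) has_real_derivative (n - 2 + al) * r powr (n - 3 + al)) (at r)"
    using has_real_derivative_powr[OF assms, of "n - 2 + al"] by (simp add: algebra_simps)
  have 2: "((\<lambda>r. T r powr al) has_real_derivative al * T r powr (al - 1) * T' r) (at r)"
    using DERIV_chain[OF has_real_derivative_powr[OF T_pos[OF assms], of al] T_deriv[OF assms]]
    by (simp add: o_def)
  from DERIV_mult[OF 1 2] show ?thesis
    unfolding flux_def[abs_def] flux'_def by (simp add: algebra_simps)
qed

lemma flux_nonneg: "0 \<le> flux r" by (simp add: flux_def)

lemma flux_mono: "0 < x \<Longrightarrow> x \<le> y \<Longrightarrow> flux x \<le> flux y"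
  unfolding flux_def using T_mono[of x y] T_pos[of x] param
  by (intro mult_mono powr_mono2) (auto intro: less_imp_le)

text \<open>The heart of the transport proof. The derivative of \<open>flux\<close> is \<open>(n - s) (t X + (1 - t) Z)\<close> with
  \<open>t = 1 / (2 nu)\<close>, where \<open>X\<close> contains \<open>T'\<close>. The weighted geometric mean of \<open>X\<close> and \<open>Z\<close>, multiplied
  by \<open>v\<^sup>q\<close>, is exactly \<open>L (T r)\<close> times the density of the profile, as taking logarithms shows.\<close>

lemma flux'_lower:
  assumes r: "0 < r"
  shows "(n - s) * (L (T r) * m r) \<le> v r powr q * flux' r"
proof (cases "v r = 0")
  case True
  then show ?thesis using param by (simp add: m_def)
next
  case False
  then have v: "0 < v r" using v_nonneg[of r] by simp
  have T: "0 < T r" using T_pos r by simp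
  define X where "X = T r powr (al - 1) * T' r * r powr (n - 2 + al)"
  define Z where "Z = r powr (n - 3 + al) * T r powr al"
  have T': "0 < T' r" using v r k_pos[OF T] by (simp add: T'_def m_def)
  have XZ: "0 < X" "0 < Z" using r T T' by (simp_all add: X_def Z_def)
  define t where "t = 1 / (2 * nu)"
  have t: "0 < t" "t < 1" using param by (auto simp: t_def)
  have t_nu: "2 * nu * t = 1" using param(3) by (simp add: t_def)
  have t_ns: "t * (n - s) = al"
    unfolding nu_al[symmetric] using param(3) by (simp add: t_def)
  have t_p: "q + t * p = p"
    using p_nu by (simp add: t_def)
  have al2: "2 * al = 2 - s" by (simp add: al_def)
  \<comment> \<open>\<open>X\<close> stands for the derivative of \<open>T\<close> and \<open>Z\<close> for that of the power of \<open>r\<close>; their weights \<open>t\<close> and \<open>1 - t\<close> are \<open>1/N\<close> and \<open>(N - 1)/N\<close> for the effective dimension \<open>N = 2 nu\<close>.\<close>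
  have young: "X powr t * Z powr (1 - t) \<le> t * X + (1 - t) * Z"
    using XZ t by (intro Youngs_inequality_0) auto
  have "flux' r = al * X + (n - 2 + al) * Z"
    by (simp add: flux'_def X_def Z_def algebra_simps)
  also have "\<dots> = (n - s) * (t * X + (1 - t) * Z)"
  proof -
    have "(n - s) * (t * X + (1 - t) * Z) = (t * (n - s)) * X + (n - s) * Z - (t * (n - s)) * Z"
      by (simp add: algebra_simps)
    also have "\<dots> = al * X + (n - s - al) * Z"
      unfolding t_ns by (simp add: algebra_simps)
    also have "n - s - al = n - 2 + al" using al2 by linarith
    finally show ?thesis by simp
  qed
  finally have flux': "flux' r = (n - s) * (t * X + (1 - t) * Z)" .
  have lnL: "T' r = m r / (T r powr (n - 1 - s) * L (T r) powr (- (2 * nu)))"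
    by (simp add: T'_def k_def)
  have lnm: "ln (m r) = p * ln (v r) + (n - 1 - s) * ln r"
    using v r by (simp add: m_def ln_mult ln_powr)
  have m: "0 < m r" using v r by (simp add: m_def)
  have lnT': "ln (T' r) = p * ln (v r) + (n - 1 - s) * ln r - (n - 1 - s) * ln (T r) + 2 * nu * ln (L (T r))"
    unfolding lnL using m T L_pos[of "T r"] lnm by (simp add: ln_div ln_mult ln_powr)
  have lnX: "ln X = (al - 1) * ln (T r) + ln (T' r) + (n - 2 + al) * ln r"
    using T T' r by (simp add: X_def ln_mult ln_powr)
  have lnZ: "ln Z = (n - 3 + al) * ln r + al * ln (T r)"
    using T r by (simp add: Z_def ln_mult ln_powr)
  have "ln (v r powr q * (X powr t * Z powr (1 - t))) = q * ln (v r) + (t * ln X + (1 - t) * ln Z)"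
    using v XZ by (simp add: ln_mult ln_powr)
  also have "\<dots> = ln (L (T r) * m r)"
  proof -
    have a: "t * (2 * nu) = 1" "t * (n - s) = al" using t_nu t_ns by (simp_all add: mult_ac)
    have "t * ln X + (1 - t) * ln Z = ln Z + t * (ln X - ln Z)" by (simp add: algebra_simps)
    also have "ln X - ln Z = p * ln (v r) + (n - s) * ln r - (n - s) * ln (T r) + 2 * nu * ln (L (T r))"
      unfolding lnX lnZ lnT' by (simp add: algebra_simps)
    also have "t * \<dots> = t * p * ln (v r) + (t * (n - s)) * ln r - (t * (n - s)) * ln (T r) + (t * (2 * nu)) * ln (L (T r))"
      by (simp add: algebra_simps)
    finally have "q * ln (v r) + (t * ln X + (1 - t) * ln Z)
      = (q + t * p) * ln (v r) + (n - 3 + al + al) * ln r + ln (L (T r))"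
      unfolding a lnZ by (simp add: algebra_simps)
    moreover have "q + t * p = p" "n - 3 + al + al = n - 1 - s"
      using t_p al2 by auto
    ultimately show ?thesis
      using L_pos[of "T r"] m by (simp add: ln_mult lnm)
  qed
  finally have eq: "v r powr q * (X powr t * Z powr (1 - t)) = L (T r) * m r"
    using v XZ m L_pos[of "T r"] by (subst (asm) ln_inj_iff) auto
  have "(n - s) * (L (T r) * m r) = v r powr q * ((n - s) * (X powr t * Z powr (1 - t)))"
    unfolding eq[symmetric] by simp
  also have "\<dots> \<le> v r powr q * flux' r"
    unfolding flux' using young param(7) by (intro mult_left_mono) auto
  finally show ?thesis .
qed

definition flux_sq where "flux_sq r = T r powr (2 - s) * r powr (n - 1 - s)"

lemma measurable_flux_sq [measurable]: "flux_sq \<in> borel_measurable borel"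
  unfolding flux_sq_def[abs_def] by measurable

lemma flux_sq_nonneg: "0 \<le> flux_sq r" by (simp add: flux_sq_def)

text \<open>At step size \<open>h\<close>: the energy density of the increments, and the increments of \<open>flux\<close> that they are
  paired with. Under the integral, the increment has been moved from \<open>v\<^sup>q\<close> to \<open>flux\<close>.\<close>

definition energy_incr where "energy_incr h r = ((v (r - h) - v r) / h)\<^sup>2 * r powr (n - 1)"
definition flux_incr where "flux_incr h r = 2 * (n - 2) / q * (v r powr q * ((flux (r + h) - flux r) / h))"

lemma measurable_energy_incr [measurable]: "energy_incr h \<in> borel_measurable borel" "flux_incr h \<in> borel_measurable borel"
  unfolding energy_incr_def[abs_def] flux_incr_def[abs_def] by measurable

text \<open>Convexity of \<open>x\<^sup>q\<close> bounds the increment of \<open>v\<^sup>q\<close> by that of \<open>v\<close> times \<open>q v (r - h)\<^sup>p\<^sup>/\<^sup>2\<close>, and then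
  \<open>2 x y \<le> x\<^sup>2 + y\<^sup>2\<close> separates the energy from the test function. The factor \<open>n - 2\<close> makes this last
  step sharp for the extremal, whose derivative is \<open>- (n - 2)\<close> times the test function.\<close>

lemma pointwise_discrete_bliss:
  assumes "0 < h" "0 < r"
  shows "2 * (n - 2) / q * ((v (r - h) powr q - v r powr q) * flux r / h)
       \<le> energy_incr h r + (n - 2)\<^sup>2 * (v (r - h) powr p * flux_sq r)"
proof -
  define A D B where "A = v (r - h)" and "D = (v (r - h) - v r) / h"
    and "B = T r powr al * r powr (al - 1)"
  have AD: "0 \<le> D" "0 \<le> A" "v r \<le> A" using assms v_anti[of "r - h" r] v_nonneg by (auto simp: D_def A_def)
  have T: "0 < T r" using T_pos assms by simp
  have flux: "flux r = B * r powr (n - 1)"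
    using assms by (simp add: flux_def B_def powr_add[symmetric] mult.assoc) (simp add: algebra_simps)
  have flux_sq: "flux_sq r = B\<^sup>2 * r powr (n - 1)"
  proof -
    have "T r powr (2 - s) = (T r powr al)\<^sup>2"
      by (simp add: power2_eq_square powr_add[symmetric] al_def)
    moreover have "r powr (n - 1 - s) = (r powr (al - 1))\<^sup>2 * r powr (n - 1)"
      by (simp add: power2_eq_square powr_add[symmetric] al_def)
    ultimately show ?thesis
      by (simp add: flux_sq_def B_def power_mult_distrib)
  qed
  have Ap: "A powr p = (A powr (q - 1))\<^sup>2"
  proof (cases "A = 0")
    case True then show ?thesis using param by simp
  next
    case False
    then show ?thesis using AD by (simp add: powr_power q_def)
  qed
  have "(A powr q - v r powr q) / h \<le> q * (A powr (q - 1) * D)"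
    using divide_right_mono[OF powr_tangent_le[of "v r" A q], of h] v_nonneg[of r] AD param(6) assms
    by (simp add: D_def A_def)
  then have "2 * (n - 2) / q * (((A powr q - v r powr q) / h) * flux r) \<le> 2 * (n - 2) / q * ((q * (A powr (q - 1) * D)) * flux r)"
    using param by (intro mult_left_mono mult_right_mono) (auto simp: flux_nonneg)
  also have "\<dots> = 2 * D * ((n - 2) * (A powr (q - 1) * B)) * r powr (n - 1)"
    using param(6) by (simp add: flux)
  also have "\<dots> \<le> (D\<^sup>2 + ((n - 2) * (A powr (q - 1) * B))\<^sup>2) * r powr (n - 1)"
    using sum_squares_bound[of D "(n - 2) * (A powr (q - 1) * B)"] by (intro mult_right_mono) auto
  also have "\<dots> = energy_incr h r + (n - 2)\<^sup>2 * (A powr p * flux_sq r)"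
    unfolding flux_sq Ap energy_incr_def D_def by (simp only: power_mult_distrib distrib_right mult.assoc)
  finally show ?thesis
    by (simp add: A_def)
qed

lemma flux_integral_finite: "(\<integral>\<^sup>+r. ennreal (v r powr q * flux r * indicator {0<..} r) \<partial>lborel) < top"
proof -
  let ?C = "v 0 powr q * (R powr (n - 2 + al) * Y powr al)"
  have "(\<integral>\<^sup>+r. ennreal (v r powr q * flux r * indicator {0<..} r) \<partial>lborel)
      \<le> (\<integral>\<^sup>+r. ennreal ?C * indicator {0..R} r \<partial>lborel)"
  proof (intro nn_integral_mono)
    fix r :: real
    show "ennreal (v r powr q * flux r * indicator {0<..} r) \<le> ennreal ?C * indicator {0..R} r"
    proof (cases "0 < r \<and> r < R")
      case True
      then have "v r powr q * flux r \<le> ?C"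
        unfolding flux_def using v_anti[of 0 r] v_nonneg T_props[of r] param
        by (intro mult_mono powr_mono2) auto
      then show ?thesis using True by (auto intro!: ennreal_leI)
    next
      case False
      then have "r \<le> 0 \<or> v r = 0" using v_zero[of r] by auto
      then show ?thesis using param(6) by (auto split: split_indicator)
    qed
  qed
  also have "\<dots> < top"
    using R by (simp add: nn_integral_cmult_indicator ennreal_mult_less_top)
  finally show ?thesis .
qed

text \<open>Summation by parts: translate the integral with \<open>v (r - h)\<close> by \<open>h\<close>. The contribution of \<open>(0, h]\<close>
  is nonnegative and is dropped.\<close>

lemma discrete_bliss:
  assumes h: "0 < h"
  shows "(\<integral>\<^sup>+r. ennreal (flux_incr h r * indicator {0<..} r) \<partial>lborel)
     \<le> (\<integral>\<^sup>+r. ennreal (energy_incr h r * indicator {0<..} r) \<partial>lborel)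
       + ennreal ((n - 2)\<^sup>2) * (\<integral>\<^sup>+r. ennreal (v (r - h) powr p * flux_sq r * indicator {0<..} r) \<partial>lborel)"
proof -
  let ?c = "2 * (n - 2) / q / h"
  have c: "0 \<le> ?c" using param h by auto
  let ?I = "indicator {0<..} :: real \<Rightarrow> real"
  define P0 where "P0 = (\<integral>\<^sup>+r. ennreal (v r powr q * flux r * ?I r) \<partial>lborel)"
  define A1 where "A1 = (\<integral>\<^sup>+r. ennreal ((v (r - h) powr q - v r powr q) * flux r * ?I r) \<partial>lborel)"
  define A2 where "A2 = (\<integral>\<^sup>+r. ennreal (v r powr q * (flux (r + h) - flux r) * ?I r) \<partial>lborel)"
  have vq: "v r powr q \<le> v (r - h) powr q" for r
    using v_anti[of "r - h" r] v_nonneg[of r] h param by (intro powr_mono2) auto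
  have "A2 + P0 = (\<integral>\<^sup>+r. ennreal (v r powr q * flux (r + h) * ?I r) \<partial>lborel)"
    unfolding A2_def P0_def
  proof (subst nn_integral_add[symmetric])
    have "0 \<le> flux (r + h) - flux r" if "0 < r" for r
      using flux_mono[of r "r + h"] h that by simp
    then have "ennreal (v r powr q * (flux (r + h) - flux r) * ?I r) + ennreal (v r powr q * flux r * ?I r)
        = ennreal (v r powr q * flux (r + h) * ?I r)" for r
      using flux_nonneg[of r] by (cases "0 < r") (simp_all add: ennreal_plus[symmetric] right_diff_distrib mult_left_mono del: ennreal_plus)
    then show "(\<integral>\<^sup>+r. ennreal (v r powr q * (flux (r + h) - flux r) * ?I r) + ennreal (v r powr q * flux r * ?I r) \<partial>lborel)
       = (\<integral>\<^sup>+r. ennreal (v r powr q * flux (r + h) * ?I r) \<partial>lborel)"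
      by simp
  qed auto
  also have "\<dots> = (\<integral>\<^sup>+r. ennreal (v (r - h) powr q * flux r * indicator {h<..} r) \<partial>lborel)"
  proof -
    have "(\<integral>\<^sup>+r. ennreal (v (r - h) powr q * flux r * indicator {h<..} r) \<partial>lborel)
       = (\<integral>\<^sup>+r. ennreal (v ((h + 1 * r) - h) powr q * flux (h + 1 * r) * indicator {h<..} (h + 1 * r)) \<partial>lborel)"
      by (subst nn_integral_real_affine[where c = 1 and t = h]) auto
    also have "\<dots> = (\<integral>\<^sup>+r. ennreal (v r powr q * flux (r + h) * ?I r) \<partial>lborel)"
      by (intro nn_integral_cong) (auto simp: add.commute split: split_indicator)
    finally show ?thesis by simp
  qed
  also have "\<dots> \<le> (\<integral>\<^sup>+r. ennreal (v (r - h) powr q * flux r * ?I r) \<partial>lborel)"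
    using h flux_nonneg by (intro nn_integral_mono) (auto split: split_indicator)
  also have "\<dots> = A1 + P0"
    unfolding A1_def P0_def
  proof (subst nn_integral_add[symmetric])
    have "ennreal ((v (r - h) powr q - v r powr q) * flux r * ?I r) + ennreal (v r powr q * flux r * ?I r)
        = ennreal (v (r - h) powr q * flux r * ?I r)" for r
      using flux_nonneg[of r] vq[of r]
      by (cases "0 < r") (simp_all add: ennreal_plus[symmetric] left_diff_distrib mult_right_mono del: ennreal_plus)
    then show "(\<integral>\<^sup>+r. ennreal (v (r - h) powr q * flux r * ?I r) \<partial>lborel)
       = (\<integral>\<^sup>+r. ennreal ((v (r - h) powr q - v r powr q) * flux r * ?I r) + ennreal (v r powr q * flux r * ?I r) \<partial>lborel)"
      by simp
  qed auto
  finally have "P0 + A2 \<le> P0 + A1"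
    by (simp only: add.commute)
  moreover have "P0 \<noteq> top"
    using flux_integral_finite by (simp add: P0_def less_top)
  ultimately have "A2 \<le> A1"
    unfolding ennreal_add_left_cancel_le by simp
  have "(\<integral>\<^sup>+r. ennreal (flux_incr h r * ?I r) \<partial>lborel) = ennreal ?c * A2"
    unfolding A2_def using c
    by (subst nn_integral_cmult[symmetric]) (auto intro!: nn_integral_cong simp: flux_incr_def ennreal_mult'[symmetric] mult_ac)
  also have "\<dots> \<le> ennreal ?c * A1"
    using \<open>A2 \<le> A1\<close> by (rule mult_left_mono) simp
  also have "\<dots> = (\<integral>\<^sup>+r. ennreal (2 * (n - 2) / q * ((v (r - h) powr q - v r powr q) * flux r / h) * ?I r) \<partial>lborel)"
    unfolding A1_def using c
    by (subst nn_integral_cmult[symmetric]) (auto intro!: nn_integral_cong simp: ennreal_mult'[symmetric] mult_ac)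
  also have "\<dots> \<le> (\<integral>\<^sup>+r. ennreal (energy_incr h r * ?I r) + ennreal ((n - 2)\<^sup>2) * ennreal (v (r - h) powr p * flux_sq r * ?I r) \<partial>lborel)"
  proof (rule nn_integral_mono)
    fix r :: real
    show "ennreal (2 * (n - 2) / q * ((v (r - h) powr q - v r powr q) * flux r / h) * ?I r)
        \<le> ennreal (energy_incr h r * ?I r) + ennreal ((n - 2)\<^sup>2) * ennreal (v (r - h) powr p * flux_sq r * ?I r)"
    proof (cases "0 < r")
      case True
      have "ennreal (2 * (n - 2) / q * ((v (r - h) powr q - v r powr q) * flux r / h))
          \<le> ennreal (energy_incr h r + (n - 2)\<^sup>2 * (v (r - h) powr p * flux_sq r))"
        using pointwise_discrete_bliss[OF h True] by (rule ennreal_leI)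
      also have "\<dots> = ennreal (energy_incr h r) + ennreal ((n - 2)\<^sup>2) * ennreal (v (r - h) powr p * flux_sq r)"
        using flux_sq_nonneg by (simp add: ennreal_mult' energy_incr_def)
      finally show ?thesis using True by simp
    qed simp
  qed
  also have "\<dots> = (\<integral>\<^sup>+r. ennreal (energy_incr h r * ?I r) \<partial>lborel)
       + ennreal ((n - 2)\<^sup>2) * (\<integral>\<^sup>+r. ennreal (v (r - h) powr p * flux_sq r * ?I r) \<partial>lborel)"
    by (subst nn_integral_add) (auto simp: nn_integral_cmult)
  finally show ?thesis .
qed

definition hs :: "nat \<Rightarrow> real" where "hs i = 1 / real (Suc i)"

lemma hs: "0 < hs i" "hs i \<le> 1" "hs \<longlonglongrightarrow> 0"
  unfolding hs_def[abs_def] using LIMSEQ_Suc[OF lim_1_over_n] by (auto simp: divide_simps)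

text \<open>The difference quotients of \<open>flux\<close> converge to its derivative, to which \<open>flux'_lower\<close> applies.\<close>

lemma flux_incr_lower: 
  "ennreal (2 * (n - 2) / q * (n - s) * (L (T r) * m r * indicator {0<..} r))
     \<le> liminf (\<lambda>i. ennreal (flux_incr (hs i) r * indicator {0<..} r))"
proof (cases "0 < r")
  case True
  have h0: "filterlim hs (at 0) sequentially"
    using hs by (auto simp: filterlim_at intro!: eventuallyI less_imp_neq[symmetric])
  have "((\<lambda>h. (flux (r + h) - flux r) / h) \<longlongrightarrow> flux' r) (at 0)"
    using flux_deriv[OF True] by (simp add: DERIV_def)
  from filterlim_compose[OF this h0]
  have "(\<lambda>i. flux_incr (hs i) r) \<longlonglongrightarrow> 2 * (n - 2) / q * (v r powr q * flux' r)"
    unfolding flux_incr_def by (intro tendsto_intros)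
  then have "(\<lambda>i. ennreal (flux_incr (hs i) r * indicator {0<..} r)) \<longlonglongrightarrow> ennreal (2 * (n - 2) / q * (v r powr q * flux' r))"
    using True by (auto intro!: tendsto_ennrealI)
  then have "liminf (\<lambda>i. ennreal (flux_incr (hs i) r * indicator {0<..} r)) = ennreal (2 * (n - 2) / q * (v r powr q * flux' r))"
    by (intro lim_imp_Liminf) auto
  moreover have "2 * (n - 2) / q * ((n - s) * (L (T r) * m r)) \<le> 2 * (n - 2) / q * (v r powr q * flux' r)"
    using flux'_lower[OF True] param by (intro mult_left_mono) auto
  ultimately show ?thesis
    using True by (auto intro!: ennreal_leI simp: mult.assoc)
qed simp

lemma transported_L:
  "(\<integral>\<^sup>+r. ennreal (L (T r) * m r * indicator {0<..} r) \<partial>lborel) = ennreal (G Y + H Y)"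
proof -
  have "(\<integral>\<^sup>+r. ennreal (L (T r) * m r * indicator {0<..} r) \<partial>lborel)
     = (\<integral>\<^sup>+y. ennreal (k y * indicator {0<..Y} y) + ennreal (y powr (2 - s) * k y * indicator {0<..Y} y) \<partial>lborel)"
    unfolding transport[OF measurable_k(2)]
    by (intro nn_integral_cong)
       (auto simp: L_def k_nonneg ennreal_plus[symmetric] algebra_simps simp del: ennreal_plus split: split_indicator)
  also have "\<dots> = ennreal (G Y) + ennreal (H Y)"
    using Y by (subst nn_integral_add) (auto simp: G_nn H_nn)
  also have "\<dots> = ennreal (G Y + H Y)"
    using G_mono[of 0 Y] G_0 Y H_nonneg by (intro ennreal_plus[symmetric]) auto
  finally show ?thesis .
qed

lemma shifted_limit:
  "(\<lambda>i. \<integral>\<^sup>+r. ennreal (v (r - hs i) powr p * flux_sq r * indicator {0<..} r) \<partial>lborel) \<longlonglongrightarrow> ennreal (H Y)"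
proof -
  have eq: "(\<integral>\<^sup>+r. ennreal (v r powr p * flux_sq r * indicator {0<..} r) \<partial>lborel) = ennreal (H Y)"
    using transport[of "\<lambda>y. y powr (2 - s)"] H_nn[of Y] by (simp add: flux_sq_def m_def mult_ac)
  let ?C = "v (- 1) powr p * (Y powr (2 - s) * (R + 1) powr (n - 1 - s))"
  have "(\<lambda>i. \<integral>\<^sup>+r. ennreal (v (r - hs i) powr p * flux_sq r * indicator {0<..} r) \<partial>lborel)
     \<longlonglongrightarrow> (\<integral>\<^sup>+r. ennreal (v r powr p * flux_sq r * indicator {0<..} r) \<partial>lborel)"
  proof (rule nn_integral_dominated_convergence[where w = "\<lambda>r. ennreal ?C * indicator {0..R + 1} r"])
    show "(\<integral>\<^sup>+r. ennreal ?C * indicator {0..R + 1} r \<partial>lborel) < \<infinity>"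
      using R by (simp add: nn_integral_cmult_indicator ennreal_mult_less_top)
    show "AE r in lborel. ennreal (v (r - hs i) powr p * flux_sq r * indicator {0<..} r) \<le> ennreal ?C * indicator {0..R + 1} r" for i
    proof (rule AE_I2)
      fix r :: real
      show "ennreal (v (r - hs i) powr p * flux_sq r * indicator {0<..} r) \<le> ennreal ?C * indicator {0..R + 1} r"
      proof (cases "0 < r \<and> r < R + 1")
        case True
        then have "v (r - hs i) powr p * flux_sq r \<le> ?C"
          unfolding flux_sq_def using v_anti[of "-1" "r - hs i"] v_nonneg T_props[of r] param hs(1)[of i] hs(2)[of i]
          by (intro mult_mono powr_mono2) auto
        then show ?thesis using True by (auto intro!: ennreal_leI)
      next
        case False
        then have "r \<le> 0 \<or> v (r - hs i) = 0" using v_zero[of "r - hs i"] hs(1)[of i] hs(2)[of i] by auto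
        then show ?thesis using param(5) by (auto split: split_indicator)
      qed
    qed
    show "AE r in lborel. (\<lambda>i. ennreal (v (r - hs i) powr p * flux_sq r * indicator {0<..} r))
        \<longlonglongrightarrow> ennreal (v r powr p * flux_sq r * indicator {0<..} r)"
    proof (rule AE_I2)
      fix r :: real
      have "(\<lambda>i. r - hs i) \<longlonglongrightarrow> r - 0"
        by (intro tendsto_intros hs)
      then have "(\<lambda>i. v (r - hs i)) \<longlonglongrightarrow> v r"
        using v_cont continuous_on_tendsto_compose[of UNIV v "\<lambda>i. r - hs i" r] by auto
      then have "(\<lambda>i. v (r - hs i) powr p) \<longlonglongrightarrow> v r powr p"
        using param v_nonneg by (intro tendsto_powr2) auto
      then show "(\<lambda>i. ennreal (v (r - hs i) powr p * flux_sq r * indicator {0<..} r))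
        \<longlonglongrightarrow> ennreal (v r powr p * flux_sq r * indicator {0<..} r)"
        by (intro tendsto_ennrealI tendsto_mult tendsto_const)
    qed
  qed measurable
  then show ?thesis unfolding eq .
qed

text \<open>Fatou's lemma on the side of \<open>flux\<close>, dominated convergence for the square of the test function,
  and the change of variables in both.\<close>

lemma normalized_bliss:
  assumes "0 \<le> E"
    and E: "\<And>e. 0 < e \<Longrightarrow> eventually (\<lambda>i. (\<integral>\<^sup>+r. ennreal (energy_incr (hs i) r * indicator {0<..} r) \<partial>lborel) \<le> ennreal (E + e)) sequentially"
  shows "2 * (n - 2) / q * (n - s) * (G Y + H Y) \<le> E + (n - 2)\<^sup>2 * H Y"
proof -
  let ?c = "2 * (n - 2) / q * (n - s)"
  have c: "0 \<le> ?c" using param by auto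
  have GH: "0 \<le> G Y + H Y"
    using G_mono[of 0 Y] G_0 Y H_nonneg[of Y] by auto
  have main: "ennreal (?c * (G Y + H Y)) \<le> liminf (\<lambda>i. \<integral>\<^sup>+r. ennreal (flux_incr (hs i) r * indicator {0<..} r) \<partial>lborel)"
  proof -
    have "ennreal (?c * (G Y + H Y)) = (\<integral>\<^sup>+r. ennreal (?c * (L (T r) * m r * indicator {0<..} r)) \<partial>lborel)"
      using c GH unfolding ennreal_mult'[OF c] transported_L[symmetric]
      by (subst nn_integral_cmult[symmetric]) auto
    also have "\<dots> \<le> (\<integral>\<^sup>+r. liminf (\<lambda>i. ennreal (flux_incr (hs i) r * indicator {0<..} r)) \<partial>lborel)"
      by (intro nn_integral_mono flux_incr_lower)
    also have "\<dots> \<le> liminf (\<lambda>i. \<integral>\<^sup>+r. ennreal (flux_incr (hs i) r * indicator {0<..} r) \<partial>lborel)"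
      by (rule nn_integral_liminf) measurable
    finally show ?thesis .
  qed
  have upper: "?c * (G Y + H Y) \<le> E + (n - 2)\<^sup>2 * H Y + e * (1 + (n - 2)\<^sup>2)" if e: "0 < e" for e
  proof -
    have "ennreal (H Y) < ennreal (H Y + e)"
      using e H_nonneg by (simp add: ennreal_lessI)
    from order_tendstoD(2)[OF shifted_limit this]
    have "eventually (\<lambda>i. (\<integral>\<^sup>+r. ennreal (v (r - hs i) powr p * flux_sq r * indicator {0<..} r) \<partial>lborel) < ennreal (H Y + e)) sequentially" .
    with E[OF e] have "eventually (\<lambda>i. (\<integral>\<^sup>+r. ennreal (flux_incr (hs i) r * indicator {0<..} r) \<partial>lborel)
        \<le> ennreal (E + e + (n - 2)\<^sup>2 * (H Y + e))) sequentially"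
    proof eventually_elim
      case (elim i)
      have "(\<integral>\<^sup>+r. ennreal (flux_incr (hs i) r * indicator {0<..} r) \<partial>lborel)
          \<le> ennreal (E + e) + ennreal ((n - 2)\<^sup>2) * ennreal (H Y + e)"
        using discrete_bliss[OF hs(1)[of i]] elim
        by (elim order_trans) (intro add_mono mult_left_mono, auto)
      also have "\<dots> = ennreal (E + e + (n - 2)\<^sup>2 * (H Y + e))"
        unfolding ennreal_mult'[OF zero_le_power2, symmetric]
        using assms(1) e H_nonneg[of Y] by (intro ennreal_plus[symmetric]) auto
      finally show ?case .
    qed
    then have "liminf (\<lambda>i. \<integral>\<^sup>+r. ennreal (flux_incr (hs i) r * indicator {0<..} r) \<partial>lborel) \<le> ennreal (E + e + (n - 2)\<^sup>2 * (H Y + e))"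
      by (intro Liminf_le) auto
    with main have "ennreal (?c * (G Y + H Y)) \<le> ennreal (E + e + (n - 2)\<^sup>2 * (H Y + e))"
      by (rule order_trans)
    then have "?c * (G Y + H Y) \<le> E + e + (n - 2)\<^sup>2 * (H Y + e)"
      using assms(1) e H_nonneg[of Y] by (subst (asm) ennreal_le_iff) auto
    then show ?thesis by (simp add: algebra_simps)
  qed
  show ?thesis
  proof (rule field_le_epsilon)
    fix e :: real assume "0 < e"
    have d: "0 < 1 + (n - 2)\<^sup>2" by (simp add: add_pos_nonneg)
    show "?c * (G Y + H Y) \<le> E + (n - 2)\<^sup>2 * H Y + e"
      using upper[of "e / (1 + (n - 2)\<^sup>2)"] \<open>0 < e\<close> d by simp
  qed
qed

end

context bliss
begin

text \<open>Scale the profile by \<open>c\<close> to have the mass \<open>G Y\<close>, apply \<open>normalized_bliss\<close> and let \<open>Y\<close> tend to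
  infinity. The energy enters only through an upper bound for its discrete versions along
  \<open>h = 1 / (i + 1)\<close>, which is the form in which symmetrization supplies it.\<close>

theorem bliss_inequality:
  fixes v :: "real \<Rightarrow> real"
  assumes anti: "\<And>x y. x \<le> y \<Longrightarrow> v y \<le> v x" and nonneg: "\<And>x. 0 \<le> v x"
    and cont: "continuous_on UNIV v" and zero: "\<And>x. R \<le> x \<Longrightarrow> v x = 0" and R: "0 < R"
    and v0: "0 < v 0" and E0: "0 \<le> E"
    and E: "\<And>e. 0 < e \<Longrightarrow> eventually (\<lambda>i. (\<integral>\<^sup>+r. ennreal (((v (r - 1 / real (Suc i)) - v r) / (1 / real (Suc i)))\<^sup>2
          * r powr (n - 1) * indicator {0<..} r) \<partial>lborel) \<le> ennreal (E + e)) sequentially"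
  shows "(n - 2) * (n - s) * J * (integral {0..R} (\<lambda>t. v t powr p * t powr (n - 1 - s)) / J) powr (2 / p) \<le> E"
proof -
  define I where "I = integral {0..R} (\<lambda>t. v t powr p * t powr (n - 1 - s))"
  have cont_m: "continuous_on {0..R} (\<lambda>t. v t powr p * t powr (n - 1 - s))"
    using param nonneg
    by (intro continuous_on_mult continuous_on_powr' continuous_intros continuous_on_subset[OF cont]) auto
  have "0 \<le> I"
    unfolding I_def by (intro integral_nonneg integrable_continuous_real cont_m) auto
  moreover have "I \<noteq> 0"
  proof
    assume "I = 0"
    then have zero_all: "\<forall>t\<in>{0..R}. v t powr p * t powr (n - 1 - s) = 0"
      unfolding I_def using R by (subst (asm) integral_eq_0_iff[OF cont_m]) auto
    have "isCont v 0"
      using cont by (simp add: continuous_on_eq_continuous_at)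
    then have "eventually (\<lambda>x. 0 < v x) (at 0)"
      using order_tendstoD(1)[OF _ v0] by (simp add: isCont_def)
    then obtain d where d: "0 < d" "\<And>x. x \<noteq> 0 \<Longrightarrow> dist x 0 < d \<Longrightarrow> 0 < v x"
      unfolding eventually_at by auto
    define c where "c = min R (d / 2)"
    have c: "0 < c" "c \<le> R" "c < d" using R d by (auto simp: c_def)
    then have "0 < v c" using d(2)[of c] by simp
    then have "0 < v c powr p * c powr (n - 1 - s)" using c by simp
    then show False using zero_all c by (metis atLeastAtMost_iff less_eq_real_def less_irrefl)
  qed
  ultimately have I: "0 < I" by simp
  have step: "2 * (n - 2) / q * (n - s) * (G Y + H Y) - (n - 2)\<^sup>2 * H Y \<le> ((G Y / I) powr (1 / p))\<^sup>2 * E" if Y: "0 < Y" for Y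
  proof -
    define c where "c = (G Y / I) powr (1 / p)"
    have GY: "0 < G Y" using G_strict[of 0 Y] Y G_0 by simp
    have c: "0 < c" using GY I by (simp add: c_def)
    have cp: "c powr p = G Y / I"
      using GY I param by (simp add: c_def powr_powr)
    interpret bliss_profile n s "\<lambda>x. c * v x" R Y
    proof
      show "c * v y \<le> c * v x" if "x \<le> y" for x y
        using anti[OF that] c by simp
      show "0 \<le> c * v x" for x using c nonneg by simp
      show "continuous_on UNIV (\<lambda>x. c * v x)" using cont by (intro continuous_intros)
      show "c * v x = 0" if "R \<le> x" for x using zero[OF that] by simp
      have "integral {0..R} (\<lambda>t. (c * v t) powr p * t powr (n - 1 - s))
          = integral {0..R} (\<lambda>t. c powr p * (v t powr p * t powr (n - 1 - s)))"
        using c nonneg by (simp add: powr_mult mult.assoc)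
      also have "\<dots> = c powr p * I"
        by (simp add: I_def)
      also have "\<dots> = G Y" using cp I by simp
      finally show "integral {0..R} (\<lambda>t. (c * v t) powr p * t powr (n - 1 - s)) = G Y" .
    qed (use R Y in auto)
    have "2 * (n - 2) / q * (n - s) * (G Y + H Y) \<le> c\<^sup>2 * E + (n - 2)\<^sup>2 * H Y"
    proof (rule normalized_bliss)
      show "0 \<le> c\<^sup>2 * E" using E0 by simp
      fix e :: real assume e: "0 < e"
      \<comment> \<open>The energy scales with \<open>c\<^sup>2\<close>, so the tolerance \<open>e\<close> for the scaled profile is \<open>e / c\<^sup>2\<close> for \<open>v\<close>.\<close>
      have "eventually (\<lambda>i. (\<integral>\<^sup>+r. ennreal (((v (r - 1 / real (Suc i)) - v r) / (1 / real (Suc i)))\<^sup>2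
          * r powr (n - 1) * indicator {0<..} r) \<partial>lborel) \<le> ennreal (E + e / c\<^sup>2)) sequentially"
        using e c by (intro E) simp
      then show "eventually (\<lambda>i. (\<integral>\<^sup>+r. ennreal (energy_incr (hs i) r * indicator {0<..} r) \<partial>lborel) \<le> ennreal (c\<^sup>2 * E + e)) sequentially"
      proof eventually_elim
        case (elim i)
        have [measurable]: "v \<in> borel_measurable borel"
          using cont by (rule borel_measurable_continuous_onI)
        have eq: "energy_incr (hs i) r = c\<^sup>2 * (((v (r - 1 / real (Suc i)) - v r) / (1 / real (Suc i)))\<^sup>2 * r powr (n - 1))" for r
          unfolding energy_incr_def hs_def right_diff_distrib[symmetric] times_divide_eq_right[symmetric]
          by (simp only: power_mult_distrib mult.assoc)
        have "(\<integral>\<^sup>+r. ennreal (energy_incr (hs i) r * indicator {0<..} r) \<partial>lborel)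
            = ennreal (c\<^sup>2) * (\<integral>\<^sup>+r. ennreal (((v (r - 1 / real (Suc i)) - v r) / (1 / real (Suc i)))\<^sup>2
          * r powr (n - 1) * indicator {0<..} r) \<partial>lborel)"
          by (subst nn_integral_cmult[symmetric]) (auto simp: eq ennreal_mult'[symmetric] mult.assoc simp del: times_divide_eq_right divide_divide_eq_right)
        also have "\<dots> \<le> ennreal (c\<^sup>2) * ennreal (E + e / c\<^sup>2)"
          using elim by (rule mult_left_mono) simp
        also have "\<dots> = ennreal (c\<^sup>2 * E + e)"
          using c by (simp add: ennreal_mult'[symmetric] distrib_left)
        finally show ?case .
      qed
    qed
    then show ?thesis by (simp add: c_def)
  qed
  have lim_l: "(\<lambda>i. 2 * (n - 2) / q * (n - s) * (G (real i) + H (real i)) - (n - 2)\<^sup>2 * H (real i))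
      \<longlonglongrightarrow> 2 * (n - 2) / q * (n - s) * (J + (n - s) / (n - 2) * J) - (n - 2)\<^sup>2 * ((n - s) / (n - 2) * J)"
    by (intro tendsto_intros G_lim H_lim)
  have lim_r: "(\<lambda>i. ((G (real i) / I) powr (1 / p))\<^sup>2 * E) \<longlonglongrightarrow> ((J / I) powr (1 / p))\<^sup>2 * E"
    using I J_pos by (intro tendsto_intros G_lim) auto
  have "2 * (n - 2) / q * (n - s) * (J + (n - s) / (n - 2) * J) - (n - 2)\<^sup>2 * ((n - s) / (n - 2) * J)
      \<le> ((J / I) powr (1 / p))\<^sup>2 * E"
    by (rule tendsto_le[OF _ lim_r lim_l]) (simp, rule eventually_sequentiallyI[of 1], rule step, simp)
  moreover have "2 * (n - 2) / q * (n - s) * (J + (n - s) / (n - 2) * J) = 2 * (n - 2) * (n - s) * J"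
  proof -
    have "p = 2 * ((n - s) / (n - 2))" by (simp only: p_def times_divide_eq_right)
    then have "q = (n - s) / (n - 2) + 1" unfolding q_def by linarith
    then have "J + (n - s) / (n - 2) * J = q * J" by (simp add: algebra_simps)
    then show ?thesis using param(6) by simp
  qed
  moreover have "(n - 2)\<^sup>2 * ((n - s) / (n - 2) * J) = (n - 2) * (n - s) * J"
    using param(9) by (simp add: power2_eq_square)
  ultimately have "2 * ((n - 2) * (n - s) * J) - (n - 2) * (n - s) * J \<le> ((J / I) powr (1 / p))\<^sup>2 * E"
    by (simp only: mult.assoc)
  then have le: "(n - 2) * (n - s) * J \<le> ((J / I) powr (1 / p))\<^sup>2 * E"
    by linarith
  have "((J / I) powr (1 / p))\<^sup>2 = (J / I) powr (2 / p)"
    using I J_pos by (simp add: powr_power)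
  then have "(I / J) powr (2 / p) * ((J / I) powr (1 / p))\<^sup>2 = 1"
    using I J_pos by (simp add: powr_mult[symmetric])
  moreover have "(I / J) powr (2 / p) * ((n - 2) * (n - s) * J) \<le> (I / J) powr (2 / p) * (((J / I) powr (1 / p))\<^sup>2 * E)"
    using le by (intro mult_left_mono) auto
  ultimately have "(I / J) powr (2 / p) * ((n - 2) * (n - s) * J) \<le> E"
    by (simp add: mult.assoc[symmetric])
  then show ?thesis
    by (simp add: I_def mult.commute)
qed

end

section \<open>Balls and radial functions of a gauge norm\<close>

lemma emeasure_lborel_open_bounded:
  fixes S :: "(real^'n) set"
  assumes "open S" "bounded S"
  shows "emeasure lborel S = ennreal (vol S)"
proof -
  have "emeasure lebesgue S = ennreal (vol S)"
    by (rule emeasure_eq_measure2) (rule lmeasurable_open[OF assms(2,1)])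
  then show ?thesis using assms by simp
qed

context gauge_norm
begin

lemma F_zero [simp]: "F 0 = 0"
  using hom[of 0 0] by simp

lemma F_nonneg: "0 \<le> F x"
  using pos[of x] by (cases "x = 0") auto

lemma F_minus: "F (- x) = F x"
  using hom[of "-1" x] by simp

lemma F_commute: "F (x - y) = F (y - x)"
  using F_minus[of "x - y"] by simp

lemma F_triangle_diff: "\<bar>F x - F y\<bar> \<le> F (x - y)"
  using tri[of "x - y" y] tri[of "y - x" x] F_commute[of x y] by simp

lemma F_eq_zero_iff: "F x = 0 \<longleftrightarrow> x = 0"
  using pos[of x] by (cases "x = 0") auto

lemma F_contOn: "continuous_on S F"
  using cont continuous_on_subset by blast

lemma measurable_F [measurable]: "F \<in> borel_measurable borel"
  using cont by (rule borel_measurable_continuous_onI)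

lemma F_lower: obtains c where "0 < c" "\<And>x. c * norm x \<le> F x"
proof -
  let ?S = "sphere 0 1 :: (real^'n) set"
  obtain z where z: "z \<in> ?S" "\<And>x. x \<in> ?S \<Longrightarrow> F z \<le> F x"
    using continuous_attains_inf[of ?S F] F_contOn by (auto simp: sphere_eq_empty)
  have "F z * norm x \<le> F x" for x
  proof (cases "x = 0")
    case False
    have "F z \<le> F ((1 / norm x) *\<^sub>R x)" using False by (intro z) simp
    then show ?thesis using False by (simp add: hom field_simps)
  qed simp
  moreover have "0 < F z" using z by (intro pos) auto
  ultimately show ?thesis using that by blast
qed

lemma F_upper: obtains C where "0 < C" "\<And>x. F x \<le> C * norm x"
proof -
  let ?S = "sphere 0 1 :: (real^'n) set"
  obtain z where z: "z \<in> ?S" "\<And>x. x \<in> ?S \<Longrightarrow> F x \<le> F z"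
    using continuous_attains_sup[of ?S F] F_contOn by (auto simp: sphere_eq_empty)
  have "F x \<le> F z * norm x" for x
  proof (cases "x = 0")
    case False
    have "F ((1 / norm x) *\<^sub>R x) \<le> F z" using False by (intro z) simp
    then show ?thesis using False by (simp add: hom field_simps)
  qed simp
  moreover have "0 < F z" using z by (intro pos) auto
  ultimately show ?thesis using that by blast
qed

definition Bl where "Bl r = {x. F x < r}"
definition b where "b = vol (Bl 1)"

lemma open_gauge_ball: "open {x. F (x - x0) < r}"
  by (intro open_Collect_less continuous_intros continuous_on_compose2[OF cont]) auto

lemma bounded_gauge_ball: "bounded {x. F (x - x0) < r}"
proof -
  obtain c where c: "0 < c" "\<And>x. c * norm x \<le> F x" using F_lower by blast
  have "norm (x - x0) \<le> r / c" if "F (x - x0) < r" for x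
    using c(2)[of "x - x0"] that c(1) by (simp add: field_simps)
  then have "{x. F (x - x0) < r} \<subseteq> cball x0 (r / c)"
    by (auto simp: dist_norm norm_minus_commute)
  then show ?thesis using bounded_cball bounded_subset by blast
qed

lemma open_Bl: "open (Bl r)" and bounded_Bl: "bounded (Bl r)"
  using open_gauge_ball[of 0 r] bounded_gauge_ball[of 0 r] by (simp_all add: Bl_def)

lemma b_pos: "0 < b"
  unfolding b_def by (rule vol_open_pos[OF open_Bl bounded_Bl]) (use F_zero in \<open>auto simp: Bl_def intro: exI[of _ 0]\<close>)

lemma emeasure_gauge_ball:
  assumes "0 \<le> r" shows "emeasure lborel {x. F (x - x0) < r} = ennreal (b * r ^ CARD('n))"
proof (cases "r = 0")
  case True
  then have "{x. F (x - x0) < r} = {}" using F_nonneg by (auto simp: not_less)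
  then show ?thesis using True by (simp add: power_0_left)
next
  case False
  then have r: "0 < r" using assms by simp
  have "emeasure lborel {x. F (x - x0) < r}
      = emeasure (density (distr lborel borel (\<lambda>x. x0 + r *\<^sub>R x)) (\<lambda>_. ennreal (\<bar>r\<bar> ^ DIM(real^'n)))) {x. F (x - x0) < r}"
    using lborel_affine[of r x0] r by simp
  also have "\<dots> = ennreal (r ^ CARD('n)) * emeasure lborel ((\<lambda>x. x0 + r *\<^sub>R x) -` {x. F (x - x0) < r})"
    using open_gauge_ball[of x0 r] r by (subst emeasure_density_const) (auto simp: emeasure_distr)
  also have "(\<lambda>x. x0 + r *\<^sub>R x) -` {x. F (x - x0) < r} = Bl 1"
    using r by (auto simp: Bl_def hom)
  also have "emeasure lborel (Bl 1) = ennreal b"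
    unfolding b_def by (rule emeasure_lborel_open_bounded[OF open_Bl bounded_Bl])
  finally show ?thesis using r b_pos by (simp add: ennreal_mult'[symmetric] mult.commute)
qed

lemma vol_Bl: "0 \<le> r \<Longrightarrow> vol (Bl r) = b * r ^ CARD('n)"
  using emeasure_gauge_ball[of r 0] emeasure_lborel_open_bounded[OF open_Bl bounded_Bl, of r] b_pos
  by (simp add: Bl_def)

text \<open>Balls have volume \<open>b r\<^sup>n\<close> around any centre, and the intervals \<open>{..<a}\<close> determine a measure on the
  line.\<close>

lemma distr_gauge:
  "distr lborel borel (\<lambda>x. F (x - x0))
     = density lborel (\<lambda>r. ennreal (real CARD('n) * b * r ^ (CARD('n) - 1) * indicator {0<..} r))"
  (is "?M = ?N")
proof (rule measure_eqI_generator_eq)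
  have [measurable]: "(\<lambda>x. F (x - x0)) \<in> borel_measurable borel" by measurable
  let ?E = "range (\<lambda>a::real. {..<a})"
  show "Int_stable ?E"
  proof (rule Int_stableI)
    fix A B assume "A \<in> ?E" "B \<in> ?E"
    then obtain a b where "A = {..<a}" "B = {..<b}" by auto
    then have "A \<inter> B = {..<min a b}" by auto
    then show "A \<inter> B \<in> ?E" by simp
  qed
  show "?E \<subseteq> Pow UNIV" by auto
  have "sets borel = sigma_sets UNIV ?E"
    unfolding borel_Iio by simp
  then show "sets ?M = sigma_sets UNIV ?E" "sets ?N = sigma_sets UNIV ?E" by simp_all
  show "range (\<lambda>i. {..<real i}) \<subseteq> ?E" by auto
  show "(\<Union>i. {..<real i}) = UNIV"
    using reals_Archimedean2 by auto
  have M: "emeasure ?M {..<a} = emeasure lborel {x. F (x - x0) < a}" for a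
    by (subst emeasure_distr) (auto simp: vimage_def)
  show "emeasure ?M {..<real i} \<noteq> \<infinity>" for i
    unfolding M by (simp add: emeasure_gauge_ball)
  fix X assume "X \<in> ?E"
  then obtain a where X: "X = {..<a}" by auto
  show "emeasure ?M X = emeasure ?N X"
  proof (cases "0 \<le> a")
    case True
    have "emeasure ?N X = (\<integral>\<^sup>+r. ennreal (real CARD('n) * b * r ^ (CARD('n) - 1) * indicator {0<..} r) * indicator {..<a} r \<partial>lborel)"
      unfolding X by (rule emeasure_density) auto
    also have "\<dots> = (\<integral>\<^sup>+r. ennreal (real CARD('n) * b * r ^ (CARD('n) - 1)) * indicator {0..a} r \<partial>lborel)"
    proof (rule nn_integral_cong_AE)
      have "AE r in lborel. r \<noteq> 0 \<and> r \<noteq> a"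
        using AE_lborel_singleton[of 0] AE_lborel_singleton[of a] by eventually_elim auto
      then show "AE r in lborel. ennreal (real CARD('n) * b * r ^ (CARD('n) - 1) * indicator {0<..} r) * indicator {..<a} r
          = ennreal (real CARD('n) * b * r ^ (CARD('n) - 1)) * indicator {0..a} r"
        by eventually_elim (auto split: split_indicator)
    qed
    also have "\<dots> = ennreal (b * a ^ CARD('n) - b * 0 ^ CARD('n))"
      by (rule nn_integral_FTC_Icc) (use b_pos True in \<open>auto intro!: derivative_eq_intros\<close>)
    finally show ?thesis
      unfolding X M by (simp add: emeasure_gauge_ball[OF True] power_0_left)
  next
    case False
    have "emeasure ?N X = (\<integral>\<^sup>+r. ennreal (real CARD('n) * b * r ^ (CARD('n) - 1) * indicator {0<..} r) * indicator {..<a} r \<partial>lborel)"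
      unfolding X by (rule emeasure_density) auto
    also have "\<dots> = (\<integral>\<^sup>+(r::real). 0 \<partial>lborel)"
      using False by (intro nn_integral_cong) (auto split: split_indicator)
    finally have "emeasure ?N X = 0" by simp
    moreover have "{x. F (x - x0) < a} = {}"
      using False F_nonneg by (auto simp: not_less intro: order_trans[of a 0])
    ultimately show ?thesis unfolding X M by simp
  qed
qed

lemma nn_integral_radial:
  assumes [measurable]: "f \<in> borel_measurable borel"
  shows "(\<integral>\<^sup>+x. f (F (x - x0)) \<partial>lborel)
     = (\<integral>\<^sup>+r. ennreal (real CARD('n) * b * r ^ (CARD('n) - 1) * indicator {0<..} r) * f r \<partial>lborel)"
proof -
  have "(\<integral>\<^sup>+x. f (F (x - x0)) \<partial>lborel) = (\<integral>\<^sup>+r. f r \<partial>distr lborel borel (\<lambda>x. F (x - x0)))"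
    by (subst nn_integral_distr) auto
  also have "\<dots> = (\<integral>\<^sup>+r. ennreal (real CARD('n) * b * r ^ (CARD('n) - 1) * indicator {0<..} r) * f r \<partial>lborel)"
    unfolding distr_gauge by (rule nn_integral_density) auto
  finally show ?thesis .
qed

lemma brunn_minkowski_gauge:
  assumes A: "open A" "bounded A" "A \<noteq> {}" and "0 < h"
  shows "root CARD('n) (vol A / b) + h \<le> root CARD('n) (vol (msum A (Bl h)) / b)"
proof -
  have "Bl h \<noteq> {}" using \<open>0 < h\<close> F_zero by (auto simp: Bl_def intro: exI[of _ 0])
  from brunn_minkowski[OF A open_Bl bounded_Bl this]
  have "root CARD('n) (vol A) + root CARD('n) (b * h ^ CARD('n)) \<le> root CARD('n) (vol (msum A (Bl h)))"
    using \<open>0 < h\<close> by (simp add: vol_Bl)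
  moreover have "root CARD('n) (b * h ^ CARD('n)) = root CARD('n) b * h"
    using \<open>0 < h\<close> by (simp add: real_root_mult real_root_power_cancel)
  moreover have rb: "0 < root CARD('n) b" using b_pos by simp
  ultimately have "(root CARD('n) (vol A) + root CARD('n) b * h) / root CARD('n) b
      \<le> root CARD('n) (vol (msum A (Bl h))) / root CARD('n) b"
    by (intro divide_right_mono) auto
  then show ?thesis
    using rb by (simp add: real_root_divide add_divide_distrib)
qed

end

section \<open>Decreasing rearrangement\<close>

text \<open>\<open>(f - g)\<^sup>2\<close> is the area of the square over \<open>[g, f)\<close>; integrate its indicator first over the point
  \<open>x\<close>.\<close>

lemma nn_integral_square_layer_cake:
  fixes f g :: "'a \<Rightarrow> real"
  assumes "sigma_finite_measure M" and [measurable]: "f \<in> borel_measurable M" "g \<in> borel_measurable M"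
    and le: "\<And>x. g x \<le> f x"
  shows "(\<integral>\<^sup>+x. ennreal ((f x - g x)\<^sup>2) \<partial>M)
    = (\<integral>\<^sup>+a. (\<integral>\<^sup>+c. emeasure M {x \<in> space M. g x \<le> min a c \<and> max a c < f x} \<partial>lborel) \<partial>lborel)"
proof -
  interpret sigma_finite_measure M by fact
  interpret P1: pair_sigma_finite M "lborel :: real measure" ..
  have len: "(\<integral>\<^sup>+a. indicator {g x..<f x} a \<partial>lborel) = ennreal (f x - g x)" for x
    using le[of x] by simp
  have sq: "ennreal ((f x - g x)\<^sup>2) = (\<integral>\<^sup>+a. (\<integral>\<^sup>+c. indicator {g x..<f x} a * indicator {g x..<f x} c \<partial>lborel) \<partial>lborel)" for x
  proof -
    have "(\<integral>\<^sup>+a. (\<integral>\<^sup>+c. indicator {g x..<f x} a * indicator {g x..<f x} c \<partial>lborel) \<partial>lborel)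
       = (\<integral>\<^sup>+a. indicator {g x..<f x} a * ennreal (f x - g x) \<partial>lborel)"
      by (subst nn_integral_cmult) (auto simp: len simp del: nn_integral_indicator)
    also have "\<dots> = ennreal (f x - g x) * ennreal (f x - g x)"
      by (subst nn_integral_multc) (auto simp: len simp del: nn_integral_indicator)
    finally show ?thesis
      using le[of x] by (simp add: power2_eq_square ennreal_mult'[symmetric])
  qed
  have "(\<integral>\<^sup>+x. ennreal ((f x - g x)\<^sup>2) \<partial>M)
      = (\<integral>\<^sup>+x. (\<integral>\<^sup>+a. (\<integral>\<^sup>+c. indicator {z. g x \<le> z \<and> z < f x} a * indicator {z. g x \<le> z \<and> z < f x} c \<partial>lborel) \<partial>lborel) \<partial>M)"
    unfolding sq by (simp add: atLeastLessThan_def Collect_conj_eq[symmetric] lessThan_def atLeast_def)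
  also have "\<dots> = (\<integral>\<^sup>+a. (\<integral>\<^sup>+x. (\<integral>\<^sup>+c. indicator {z. g x \<le> z \<and> z < f x} a * indicator {z. g x \<le> z \<and> z < f x} c \<partial>lborel) \<partial>M) \<partial>lborel)"
    by (rule P1.Fubini'[symmetric]) (simp add: indicator_def)
  also have "\<dots> = (\<integral>\<^sup>+a. (\<integral>\<^sup>+c. (\<integral>\<^sup>+x. indicator {z. g x \<le> z \<and> z < f x} a * indicator {z. g x \<le> z \<and> z < f x} c \<partial>M) \<partial>lborel) \<partial>lborel)"
    by (intro nn_integral_cong P1.Fubini'[symmetric]) (simp add: indicator_def)
  also have "\<dots> = (\<integral>\<^sup>+a. (\<integral>\<^sup>+c. (\<integral>\<^sup>+x. indicator {x \<in> space M. g x \<le> min a c \<and> max a c < f x} x \<partial>M) \<partial>lborel) \<partial>lborel)"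
    by (intro nn_integral_cong) (auto split: split_indicator)
  also have "\<dots> = (\<integral>\<^sup>+a. (\<integral>\<^sup>+c. emeasure M {x \<in> space M. g x \<le> min a c \<and> max a c < f x} \<partial>lborel) \<partial>lborel)"
    by (intro nn_integral_cong nn_integral_indicator) measurable
  finally show ?thesis .
qed

lemma nn_integral_weighted_layer_cake:
  fixes f :: "'a \<Rightarrow> real" and w :: "'a \<Rightarrow> ennreal"
  assumes "sigma_finite_measure M" and [measurable]: "f \<in> borel_measurable M" "w \<in> borel_measurable M"
    and nonneg: "\<And>x. 0 \<le> f x"
  shows "(\<integral>\<^sup>+x. ennreal (f x) * w x \<partial>M) = (\<integral>\<^sup>+c. (\<integral>\<^sup>+x. w x * indicator {x. 0 \<le> c \<and> c < f x} x \<partial>M) \<partial>lborel)"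
proof -
  interpret sigma_finite_measure M by fact
  interpret P1: pair_sigma_finite M "lborel :: real measure" ..
  have "(\<integral>\<^sup>+x. ennreal (f x) * w x \<partial>M) = (\<integral>\<^sup>+x. (\<integral>\<^sup>+c. w x * indicator {c. 0 \<le> c \<and> c < f x} c \<partial>lborel) \<partial>M)"
  proof (rule nn_integral_cong)
    fix x
    have "(\<integral>\<^sup>+c. w x * indicator {0..<f x} c \<partial>lborel) = w x * ennreal (f x)"
      using nonneg[of x] by (subst nn_integral_cmult) auto
    then show "ennreal (f x) * w x = (\<integral>\<^sup>+c. w x * indicator {c. 0 \<le> c \<and> c < f x} c \<partial>lborel)"
      by (simp add: atLeastLessThan_def Collect_conj_eq[symmetric] lessThan_def atLeast_def mult.commute)
  qed
  also have "\<dots> = (\<integral>\<^sup>+c. (\<integral>\<^sup>+x. w x * indicator {c. 0 \<le> c \<and> c < f x} c \<partial>M) \<partial>lborel)"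
    by (rule P1.Fubini'[symmetric]) (simp add: indicator_def)
  also have "\<dots> = (\<integral>\<^sup>+c. (\<integral>\<^sup>+x. w x * indicator {x. 0 \<le> c \<and> c < f x} x \<partial>M) \<partial>lborel)"
    by (intro nn_integral_cong) (auto split: split_indicator)
  finally show ?thesis .
qed

text \<open>The functions to be symmetrized. The Lipschitz condition is stated for \<open>F\<close> itself, since only
  distances in \<open>F\<close> occur below.\<close>

locale lip_profile = gauge_norm F for F :: "real^'n \<Rightarrow> real" +
  fixes u :: "real^'n \<Rightarrow> real" and K :: real
  assumes u_nonneg: "0 \<le> u x"
    and u_lip: "\<bar>u x - u y\<bar> \<le> K * F (x - y)"
    and u_supp: "bounded {x. u x \<noteq> 0}"
    and u_pos: "\<exists>x. 0 < u x"
    and K: "0 < K"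
begin

lemma u_cont: "continuous_on UNIV u"
proof -
  obtain C where C: "0 < C" "\<And>x. F x \<le> C * norm x" using F_upper by blast
  have "(K * C)-lipschitz_on UNIV u"
  proof (rule lipschitz_onI)
    show "dist (u x) (u y) \<le> K * C * dist x y" for x y
    proof -
      have "\<bar>u x - u y\<bar> \<le> K * F (x - y)" by (rule u_lip)
      also have "\<dots> \<le> K * (C * norm (x - y))" using C K by (intro mult_left_mono) auto
      finally show ?thesis by (simp add: dist_norm mult.assoc)
    qed
  qed (use K C in auto)
  then show ?thesis by (rule lipschitz_on_continuous_on)
qed

lemma measurable_u [measurable]: "u \<in> borel_measurable borel"
  using u_cont by (rule borel_measurable_continuous_onI)

definition A where "A t = {x. t < u x}"
text \<open>This sup-convolution enlarges superlevel sets by a ball, which is what Brunn-Minkowski controls,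
  while its difference quotients \<open>(U h - u) / h\<close> are bounded by \<open>|Du|\<close> in the limit.\<close>

definition U where "U h x = Sup (u ` {y. F (y - x) < h})"

lemma open_A: "open (A t)"
  unfolding A_def by (intro open_Collect_less continuous_intros u_cont)

lemma bounded_A: "0 \<le> t \<Longrightarrow> bounded (A t)"
  by (rule bounded_subset[OF u_supp]) (auto simp: A_def)

lemma A_anti: "t \<le> t' \<Longrightarrow> A t' \<subseteq> A t" by (auto simp: A_def)

lemma emeasure_A: "0 \<le> t \<Longrightarrow> emeasure lborel (A t) = ennreal (vol (A t))"
  by (rule emeasure_lborel_open_bounded[OF open_A bounded_A])

lemma u_le_on_ball:
  assumes "F (y - x) < h" shows "u y \<le> u x + K * h"
proof -
  have "K * F (y - x) \<le> K * h" using K assms by (intro mult_left_mono) auto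
  then show ?thesis using u_lip[of y x] by linarith
qed

lemma U_bdd: "bdd_above (u ` {y. F (y - x) < h})"
  using u_le_on_ball by (intro bdd_aboveI2[where M = "u x + K * h"]) auto

lemma U_ge: "F (y - x) < h \<Longrightarrow> u y \<le> U h x"
  unfolding U_def by (intro cSup_upper U_bdd) auto

lemma U_le: "0 < h \<Longrightarrow> (\<And>y. F (y - x) < h \<Longrightarrow> u y \<le> z) \<Longrightarrow> U h x \<le> z"
  unfolding U_def by (intro cSup_least) (auto intro: exI[of _ x])

lemma U_superlevel:
  assumes "0 < h" shows "{x. t < U h x} = msum (A t) (Bl h)"
proof (intro equalityI subsetI)
  fix x assume "x \<in> {x. t < U h x}"
  then have "\<not> (\<forall>y. F (y - x) < h \<longrightarrow> u y \<le> t)"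
    using U_le[OF assms, of x t] by auto
  then obtain y where "F (y - x) < h" "t < u y" by (auto simp: not_le)
  then show "x \<in> msum (A t) (Bl h)"
    unfolding mem_msum by (intro bexI[of _ y] bexI[of _ "x - y"]) (auto simp: A_def Bl_def F_commute)
next
  fix x assume "x \<in> msum (A t) (Bl h)"
  then obtain y z where "t < u y" "F z < h" "x = y + z" by (auto simp: mem_msum A_def Bl_def)
  then show "x \<in> {x. t < U h x}"
    using U_ge[of y x h] F_minus[of z] by auto
qed

lemma measurable_U [measurable]: "0 < h \<Longrightarrow> U h \<in> borel_measurable borel"
  by (rule borel_measurableI_greater) (simp add: U_superlevel open_msum open_A)

lemma U_bounds:
  assumes "0 < h" shows "u x \<le> U h x" "U h x \<le> u x + K * h"
  using U_ge[of x x h] U_le[OF assms, of x] u_le_on_ball assms by auto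

lemma U_supp:
  assumes "0 < h" "h \<le> 1" "U h x \<noteq> 0 \<or> u x \<noteq> 0" shows "x \<in> msum (A 0) (Bl 1)"
proof -
  have "0 < U h x" using assms U_bounds[OF assms(1), of x] u_nonneg[of x] by auto
  then have "x \<in> msum (A 0) (Bl h)" using U_superlevel[OF assms(1), of 0] by auto
  moreover have "Bl h \<subseteq> Bl 1" using assms by (auto simp: Bl_def)
  ultimately show ?thesis using msum_mono by blast
qed

text \<open>The radius of the ball with the volume of the superlevel set.\<close>

definition rho where "rho t = root CARD('n) (vol (A t) / b)"

lemma rho_nonneg: "0 \<le> rho t" using b_pos by (simp add: rho_def)

lemma rho_power: "b * rho t ^ CARD('n) = vol (A t)"
  using b_pos by (simp add: rho_def)

lemma rho_anti:
  assumes "0 \<le> t" "t \<le> t'" shows "rho t' \<le> rho t"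
proof -
  have "vol (A t') \<le> vol (A t)"
    using lmeasurable_open[OF bounded_A open_A, of t] lmeasurable_open[OF bounded_A open_A, of t'] assms A_anti
    by (intro measure_mono_fmeasurable) auto
  then show ?thesis using b_pos by (simp add: rho_def divide_right_mono)
qed

lemma rho_pos: "0 \<le> t \<Longrightarrow> 0 < rho t \<longleftrightarrow> A t \<noteq> {}"
  using vol_open_pos[OF open_A bounded_A, of t] b_pos by (auto simp: rho_def zero_less_divide_iff)

lemma rho_msum:
  assumes "0 \<le> t" "A t \<noteq> {}" "0 < h"
  shows "rho t + h \<le> root CARD('n) (vol (msum (A t) (Bl h)) / b)"
  unfolding rho_def using brunn_minkowski_gauge[OF open_A bounded_A] assms by blast

text \<open>The ball of radius \<open>h\<close> around a point where \<open>u > t + K h\<close> stays inside \<open>{u > t}\<close>; apply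
  Brunn-Minkowski. This is what makes the rearrangement Lipschitz.\<close>

lemma rho_lip:
  assumes "0 \<le> t" "0 < h" "A (t + K * h) \<noteq> {}"
  shows "rho (t + K * h) + h \<le> rho t"
proof -
  have Kh: "0 < K * h" using K assms by simp
  have "msum (A (t + K * h)) (Bl h) \<subseteq> A t"
  proof
    fix z assume "z \<in> msum (A (t + K * h)) (Bl h)"
    then obtain x y where xy: "t + K * h < u x" "F y < h" "z = x + y"
      by (auto simp: mem_msum A_def Bl_def)
    then show "z \<in> A t"
      using u_le_on_ball[of x z h] by (simp add: A_def F_minus)
  qed
  then have "vol (msum (A (t + K * h)) (Bl h)) \<le> vol (A t)"
    using lmeasurable_open[OF bounded_A open_A, of t] assms Kh
      lmeasurable_msum[OF open_A bounded_A bounded_Bl, of "t + K * h" h]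
    by (intro measure_mono_fmeasurable) auto
  then have "root CARD('n) (vol (msum (A (t + K * h)) (Bl h)) / b) \<le> rho t"
    using b_pos by (simp add: rho_def divide_right_mono)
  with rho_msum[of "t + K * h" h] assms Kh show ?thesis by simp
qed

lemma rho_right_limit:
  assumes "0 \<le> t" shows "(\<lambda>i. rho (t + 1 / real (Suc i))) \<longlonglongrightarrow> rho t"
proof -
  have eq: "A t = (\<Union>i. A (t + 1 / real (Suc i)))"
  proof (intro equalityI subsetI)
    fix x assume "x \<in> A t"
    then obtain i where "1 / real (Suc i) < u x - t"
      using nat_approx_posE[of "u x - t"] by (auto simp: A_def)
    then show "x \<in> (\<Union>i. A (t + 1 / real (Suc i)))" by (auto simp: A_def intro!: exI[of _ i])
  qed (auto simp: A_def intro: less_trans[rotated] elim!: less_trans[rotated])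
  have "(\<lambda>i. emeasure lborel (A (t + 1 / real (Suc i)))) \<longlonglongrightarrow> emeasure lborel (\<Union>i. A (t + 1 / real (Suc i)))"
  proof (rule Lim_emeasure_incseq)
    show "range (\<lambda>i. A (t + 1 / real (Suc i))) \<subseteq> sets lborel" using open_A by auto
    show "incseq (\<lambda>i. A (t + 1 / real (Suc i)))"
      by (intro incseq_SucI A_anti) (simp add: frac_le)
  qed
  then have "(\<lambda>i. vol (A (t + 1 / real (Suc i)))) \<longlonglongrightarrow> vol (A t)"
    using assms unfolding eq[symmetric] by (simp add: emeasure_A tendsto_ennreal_iff)
  then show ?thesis
    unfolding rho_def using b_pos by (intro tendsto_intros) auto
qed

text \<open>The decreasing rearrangement as a function of the radius, continued to negative arguments by its
  value at 0 so that \<open>v (r - h)\<close> makes sense for small \<open>r\<close>.\<close>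

definition v where "v r = Inf {t. 0 \<le> t \<and> rho t \<le> max 0 r}"

lemma A_empty: obtains t where "0 \<le> t" "A t = {}"
proof -
  obtain x0 where x0: "0 < u x0" using u_pos by blast
  obtain z where "\<And>y. y \<in> closure {x. u x \<noteq> 0} \<Longrightarrow> u y \<le> u z"
    using continuous_attains_sup[of "closure {x. u x \<noteq> 0}" u] u_supp continuous_on_subset[OF u_cont] x0
    by (metis (no_types, lifting) closure_subset compact_closure empty_iff less_irrefl mem_Collect_eq subset_UNIV subset_empty)
  then have "u y \<le> u z" for y
    using u_nonneg[of z] closure_subset[of "{x. u x \<noteq> 0}"] by (cases "u y = 0") auto
  then show ?thesis
    using that[of "u z"] u_nonneg by (auto simp: A_def not_less)
qed

lemma v_set_ne: "{t. 0 \<le> t \<and> rho t \<le> max 0 r} \<noteq> {}"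
proof -
  obtain t where "0 \<le> t" "A t = {}" using A_empty .
  then have "rho t = 0" using rho_pos[of t] rho_nonneg[of t] by auto
  then show ?thesis using \<open>0 \<le> t\<close> by (auto intro!: exI[of _ t])
qed

text \<open>The nontrivial direction needs that \<open>rho\<close> is continuous from the right.\<close>

lemma v_le_iff:
  assumes "0 \<le> t" shows "v r \<le> t \<longleftrightarrow> rho t \<le> max 0 r"
proof
  assume "rho t \<le> max 0 r"
  then show "v r \<le> t"
    unfolding v_def using assms by (intro cInf_lower bdd_belowI[of _ 0]) auto
next
  assume le: "v r \<le> t"
  have "rho (t + 1 / real (Suc i)) \<le> max 0 r" for i
  proof -
    have "v r < t + 1 / real (Suc i)" using le by (smt (verit) divide_pos_pos of_nat_0_less_iff zero_less_Suc)
    then obtain t' where "0 \<le> t'" "rho t' \<le> max 0 r" "t' < t + 1 / real (Suc i)"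
      unfolding v_def using v_set_ne by (subst (asm) cInf_less_iff) (auto intro: bdd_belowI[of _ 0])
    then show ?thesis using rho_anti[of t' "t + 1 / real (Suc i)"] by simp
  qed
  then show "rho t \<le> max 0 r"
    using LIMSEQ_le_const2[OF rho_right_limit[OF assms]] by blast
qed

lemma v_nonneg: "0 \<le> v r"
  unfolding v_def using v_set_ne by (intro cInf_greatest) auto

lemma v_anti: "x \<le> y \<Longrightarrow> v y \<le> v x"
  using v_le_iff[OF v_nonneg, of x x] v_le_iff[OF v_nonneg[of x], of y] by simp

lemma v_zero: "rho 0 \<le> r \<Longrightarrow> v r = 0"
  using v_le_iff[of 0 r] v_nonneg[of r] rho_nonneg[of 0] by simp

lemma rho_0_pos: "0 < rho 0"
  using u_pos by (subst rho_pos) (auto simp: A_def)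

lemma v_0_pos: "0 < v 0"
  using v_le_iff[of 0 0] rho_0_pos v_nonneg[of 0] by (simp add: less_le)

lemma v_step:
  assumes "0 \<le> r" "0 < h" shows "v r \<le> v (r + h) + K * h"
proof -
  define t where "t = v (r + h)"
  have t: "0 \<le> t" "rho t \<le> r + h" 
    using v_nonneg v_le_iff[OF v_nonneg[of "r + h"], of "r + h"] assms by (auto simp: t_def)
  have tK: "0 \<le> t + K * h" using t K assms by simp
  have "rho (t + K * h) \<le> r"
  proof (cases "A (t + K * h) = {}")
    case True
    then show ?thesis using rho_pos[OF tK] rho_nonneg[of "t + K * h"] assms by auto
  next
    case False
    then show ?thesis using rho_lip[OF t(1) assms(2)] t(2) by simp
  qed
  then show ?thesis using v_le_iff[OF tK, of r] assms by (simp add: t_def)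
qed

lemma v_cont: "continuous_on UNIV v"
proof -
  have v_max: "v r = v (max 0 r)" for r by (simp add: v_def)
  have step: "\<bar>v x - v y\<bar> \<le> K * \<bar>x - y\<bar>" if "x \<le> y" for x y
  proof (cases "max 0 x = max 0 y")
    case True
    then have "v x = v y" using v_max by metis
    then show ?thesis using K by simp
  next
    case False
    then have lt: "max 0 x < max 0 y" using that by auto
    then have "v x \<le> v y + K * (max 0 y - max 0 x)"
      using v_step[of "max 0 x" "max 0 y - max 0 x"] v_max[of x] v_max[of y] by simp
    moreover have "K * (max 0 y - max 0 x) \<le> K * (y - x)"
      using K that by (intro mult_left_mono) auto
    ultimately show ?thesis using v_anti[OF that] that by simp
  qed
  have "K-lipschitz_on UNIV v"
  proof (rule lipschitz_onI)
    show "dist (v x) (v y) \<le> K * dist x y" for x y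
      using step[of x y] step[of y x] by (cases "x \<le> y") (auto simp: dist_real_def abs_minus_commute)
  qed (use K in simp)
  then show ?thesis by (rule lipschitz_on_continuous_on)
qed

text \<open>On the left stands a ring between balls of radii \<open>rho lo\<close> and \<open>rho hi + h\<close>. On the right, the inner
  set has the volume of the smaller ball, and the outer one is a Minkowski sum, at least as large
  as the bigger ball by Brunn-Minkowski.\<close>

lemma rearrangement_level:
  assumes "0 < h" "0 \<le> lo" "lo \<le> hi"
  shows "emeasure lborel {x. v (F x) \<le> lo \<and> hi < v (F x - h)} \<le> emeasure lborel {x. u x \<le> lo \<and> hi < U h x}"
proof (cases "A hi = {}")
  case True
  then have "rho hi = 0" using rho_pos[of hi] rho_nonneg[of hi] assms by auto
  then have "v r \<le> hi" for r using v_le_iff[of hi r] assms by simp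
  then have "{x. v (F x) \<le> lo \<and> hi < v (F x - h)} = {}" by (auto simp: not_less)
  then show ?thesis by (simp only: emeasure_empty zero_le)
next
  case False
  have hi: "0 \<le> hi" using assms by simp
  have rh: "0 < rho hi" using rho_pos[OF hi] False by simp
  have "v (F x) \<le> lo \<and> hi < v (F x - h) \<longleftrightarrow> x \<in> Bl (rho hi + h) - Bl (rho lo)" for x
    using v_le_iff[OF assms(2), of "F x"] v_le_iff[OF hi, of "F x - h"] F_nonneg[of x] rh assms
    by (auto simp: Bl_def not_le[symmetric])
  then have eq: "{x. v (F x) \<le> lo \<and> hi < v (F x - h)} = Bl (rho hi + h) - Bl (rho lo)" by auto
  let ?W = "msum (A hi) (Bl h)"
  have W: "{x. u x \<le> lo \<and> hi < U h x} = ?W - A lo"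
    unfolding U_superlevel[OF assms(1), symmetric] by (auto simp: A_def)
  have lm: "Bl r \<in> lmeasurable" "?W \<in> lmeasurable" "A lo \<in> lmeasurable" for r
    using lmeasurable_open[OF bounded_Bl open_Bl] lmeasurable_open[OF bounded_A open_A] assms
      lmeasurable_msum[OF open_A bounded_A[OF hi] bounded_Bl] by auto
  have em: "emeasure lborel (S - S') = ennreal (vol (S - S'))" 
    if "S \<in> lmeasurable" "S' \<in> lmeasurable" "open S" "open S'" for S S' :: "(real^'n) set"
  proof -
    have "emeasure lebesgue (S - S') = ennreal (vol (S - S'))"
      by (rule emeasure_eq_measure2) (use that in auto)
    then show ?thesis using that by simp
  qed
  have "vol (Bl (rho hi + h) - Bl (rho lo)) \<le> vol (?W - A lo)"
  proof (cases "rho lo \<le> rho hi + h")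
    case True
    have "vol (Bl (rho hi + h) - Bl (rho lo)) = vol (Bl (rho hi + h)) - vol (Bl (rho lo))"
      using True lm by (intro measurable_measure_Diff) (auto simp: Bl_def)
    also have "\<dots> = b * (rho hi + h) ^ CARD('n) - vol (A lo)"
      using rho_nonneg assms by (simp add: vol_Bl rho_power add_nonneg_nonneg)
    also have "b * (rho hi + h) ^ CARD('n) \<le> vol ?W"
    proof -
      have "(rho hi + h) ^ CARD('n) \<le> root CARD('n) (vol ?W / b) ^ CARD('n)"
        using rho_msum[OF hi False assms(1)] rho_nonneg assms by (intro power_mono) auto
      also have "\<dots> = vol ?W / b" using b_pos by simp
      finally show ?thesis using b_pos by (simp add: field_simps)
    qed
    also have "vol ?W - vol (A lo) \<le> vol (?W - A lo)"
    proof -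
      have "vol ?W \<le> vol ((?W - A lo) \<union> A lo)"
        using lm by (intro measure_mono_fmeasurable) auto
      also have "\<dots> \<le> vol (?W - A lo) + vol (A lo)"
        using lm by (intro measure_Un_le) auto
      finally show ?thesis by simp
    qed
    finally show ?thesis by simp
  next
    case F: False
    then have "Bl (rho hi + h) - Bl (rho lo) = {}" by (auto simp: Bl_def)
    then show ?thesis by (simp only: measure_empty measure_nonneg)
  qed
  then show ?thesis
    unfolding eq W using em[OF lm(1) lm(1) open_Bl open_Bl] em[OF lm(2,3) open_msum[OF open_A] open_A] by (simp add: ennreal_leI)
qed

lemma measurable_v [measurable]: "v \<in> borel_measurable borel"
  using v_cont by (rule borel_measurable_continuous_onI)

text \<open>Write both sides by the square layer cake formula and compare the integrands, level by level, with
  \<open>rearrangement_level\<close>.\<close>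

lemma discrete_polya_szego:
  assumes h: "0 < h"
  shows "(\<integral>\<^sup>+r. ennreal (real CARD('n) * b * r ^ (CARD('n) - 1) * indicator {0<..} r) * ennreal ((v (r - h) - v r)\<^sup>2) \<partial>lborel)
      \<le> (\<integral>\<^sup>+x. ennreal ((U h x - u x)\<^sup>2) \<partial>lborel)"
proof -
  have [measurable]: "U h \<in> borel_measurable borel" using h by measurable
  have "(\<integral>\<^sup>+r. ennreal (real CARD('n) * b * r ^ (CARD('n) - 1) * indicator {0<..} r) * ennreal ((v (r - h) - v r)\<^sup>2) \<partial>lborel)
      = (\<integral>\<^sup>+x. ennreal ((v (F x - h) - v (F x))\<^sup>2) \<partial>lborel)"
    using nn_integral_radial[of "\<lambda>r. ennreal ((v (r - h) - v r)\<^sup>2)" 0] by simp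
  also have "\<dots> = (\<integral>\<^sup>+a. (\<integral>\<^sup>+c. emeasure lborel {x \<in> space lborel. v (F x) \<le> min a c \<and> max a c < v (F x - h)} \<partial>lborel) \<partial>lborel)"
    using h by (intro nn_integral_square_layer_cake sigma_finite_lborel v_anti) auto
  also have "\<dots> \<le> (\<integral>\<^sup>+a. (\<integral>\<^sup>+c. emeasure lborel {x \<in> space lborel. u x \<le> min a c \<and> max a c < U h x} \<partial>lborel) \<partial>lborel)"
  proof (intro nn_integral_mono)
    fix a c :: real
    show "emeasure lborel {x \<in> space lborel. v (F x) \<le> min a c \<and> max a c < v (F x - h)}
        \<le> emeasure lborel {x \<in> space lborel. u x \<le> min a c \<and> max a c < U h x}"
    proof (cases "0 \<le> min a c")
      case True
      then show ?thesis using rearrangement_level[OF h True, of "max a c"] by simp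
    next
      case False
      then have "{x \<in> space lborel. v (F x) \<le> min a c \<and> max a c < v (F x - h)} = {}"
        using v_nonneg order_trans[of 0 "v _" "min a c"] by blast
      then show ?thesis by (simp only: emeasure_empty zero_le)
    qed
  qed
  also have "\<dots> = (\<integral>\<^sup>+x. ennreal ((U h x - u x)\<^sup>2) \<partial>lborel)"
    by (intro nn_integral_square_layer_cake[symmetric] sigma_finite_lborel U_bounds(1)[OF h]) auto
  finally show ?thesis .
qed

text \<open>Among all sets of a given volume the centred ball carries the most mass of a decreasing radial
  weight: exchange the part outside the ball for the missing part inside, on which the weight is
  at least its value on the sphere.\<close>

lemma hardy_littlewood_level:
  assumes "0 \<le> t" and s: "0 \<le> s"
  shows "(\<integral>\<^sup>+x. ennreal (1 / F (x - x0) powr s) * indicator (A t) x \<partial>lborel)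
     \<le> (\<integral>\<^sup>+x. ennreal (1 / F (x - x0) powr s) * indicator {x. F (x - x0) < rho t} x \<partial>lborel)"
proof (cases "A t = {}")
  case True
  then show ?thesis by simp
next
  case False
  let ?R = "rho t"
  have R: "0 < ?R" using rho_pos[OF assms(1)] False by simp
  define B where "B = {x. F (x - x0) < ?R}"
  have [measurable]: "A t \<in> sets borel" "B \<in> sets borel"
    unfolding B_def using open_A open_gauge_ball by auto
  have eq: "emeasure lborel (A t) = emeasure lborel B"
    unfolding B_def using R by (simp add: emeasure_gauge_ball emeasure_A[OF assms(1)] rho_power)
  have fin: "emeasure lborel (A t \<inter> B) \<noteq> \<infinity>"
  proof -
    have "emeasure lborel (A t \<inter> B) \<le> emeasure lborel (A t)" by (intro emeasure_mono) auto
    also have "\<dots> < \<infinity>" by (simp add: emeasure_A[OF assms(1)])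
    finally show ?thesis by simp
  qed
  have diff: "emeasure lborel (A t - B) = emeasure lborel (B - A t)"
  proof -
    have "emeasure lborel (A t - B) = emeasure lborel (A t) - emeasure lborel (A t \<inter> B)"
      using emeasure_Diff[OF fin, of "A t"] by (simp add: Diff_Int)
    moreover have "emeasure lborel (B - A t) = emeasure lborel B - emeasure lborel (A t \<inter> B)"
      using emeasure_Diff[OF fin, of B] by (simp add: Diff_Int)
    ultimately show ?thesis by (simp add: eq)
  qed
  let ?w = "\<lambda>x. ennreal (1 / F (x - x0) powr s)" and ?c = "ennreal (1 / ?R powr s)"
  \<comment> \<open>\<open>A t - B\<close> and \<open>B - A t\<close> have the same volume, and the weight is at most \<open>?c\<close> on the first and at least \<open>?c\<close> on the second.\<close>
  have "(\<integral>\<^sup>+x. ?w x * indicator (A t) x \<partial>lborel)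
      = (\<integral>\<^sup>+x. ?w x * indicator (A t \<inter> B) x + ?w x * indicator (A t - B) x \<partial>lborel)"
    by (intro nn_integral_cong) (auto split: split_indicator)
  also have "\<dots> = (\<integral>\<^sup>+x. ?w x * indicator (A t \<inter> B) x \<partial>lborel) + (\<integral>\<^sup>+x. ?w x * indicator (A t - B) x \<partial>lborel)"
    by (rule nn_integral_add) auto
  also have "(\<integral>\<^sup>+x. ?w x * indicator (A t - B) x \<partial>lborel) \<le> (\<integral>\<^sup>+x. ?c * indicator (A t - B) x \<partial>lborel)"
  proof (intro nn_integral_mono)
    fix x
    have "1 / F (x - x0) powr s \<le> 1 / ?R powr s" if "x \<notin> B"
      using that R s by (intro divide_left_mono powr_mono2 mult_pos_pos) (auto simp: B_def)
    then show "?w x * indicator (A t - B) x \<le> ?c * indicator (A t - B) x"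
      by (auto split: split_indicator intro: ennreal_leI)
  qed
  also have "\<dots> = ?c * emeasure lborel (A t - B)"
    by (rule nn_integral_cmult_indicator) simp
  also have "\<dots> = (\<integral>\<^sup>+x. ?c * indicator (B - A t) x \<partial>lborel)"
    unfolding diff by (rule nn_integral_cmult_indicator[symmetric]) simp
  also have "\<dots> \<le> (\<integral>\<^sup>+x. ?w x * indicator (B - A t) x \<partial>lborel)"
  proof (rule nn_integral_mono_AE)
    have "AE x in lborel. x \<noteq> x0" by (rule AE_lborel_singleton)
    then show "AE x in lborel. ?c * indicator (B - A t) x \<le> ?w x * indicator (B - A t) x"
    proof eventually_elim
      case (elim x)
      have "0 < F (x - x0)" using elim by (intro pos) simp
      then have "1 / ?R powr s \<le> 1 / F (x - x0) powr s" if "x \<in> B"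
        using that R s by (intro divide_left_mono powr_mono2 mult_pos_pos) (auto simp: B_def)
      then show ?case by (auto split: split_indicator intro: ennreal_leI)
    qed
  qed
  also have "(\<integral>\<^sup>+x. ?w x * indicator (A t \<inter> B) x \<partial>lborel) + (\<integral>\<^sup>+x. ?w x * indicator (B - A t) x \<partial>lborel)
      = (\<integral>\<^sup>+x. ?w x * indicator (A t \<inter> B) x + ?w x * indicator (B - A t) x \<partial>lborel)"
    by (rule nn_integral_add[symmetric]) auto
  also have "\<dots> = (\<integral>\<^sup>+x. ?w x * indicator B x \<partial>lborel)"
    by (intro nn_integral_cong) (auto split: split_indicator)
  finally show ?thesis
    by (simp add: B_def add_left_mono)
qed

lemma hardy_littlewood:
  assumes p: "0 < p" and s: "0 \<le> s"
  shows "(\<integral>\<^sup>+x. ennreal (u x powr p / F (x - x0) powr s) \<partial>lborel)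
     \<le> (\<integral>\<^sup>+r. ennreal (real CARD('n) * b * r ^ (CARD('n) - 1) * indicator {0<..} r) * ennreal (v r powr p / r powr s) \<partial>lborel)"
proof -
  let ?w = "\<lambda>x. ennreal (1 / F (x - x0) powr s)"
  have [measurable]: "(\<lambda>x. F (x - x0)) \<in> borel_measurable borel" by measurable
  have lev: "c < y powr p \<longleftrightarrow> c powr (1 / p) < y" if "0 \<le> c" "0 \<le> y" for c y :: real
  proof -
    have "(c powr (1 / p)) powr p = c" using that p by (simp add: powr_powr)
    then show ?thesis
      using that p powr_less_mono2[of p "c powr (1 / p)" y] powr_mono2[of p y "c powr (1 / p)"]
      by (metis less_eq_real_def not_le powr_ge_zero)
  qed
  have "(\<integral>\<^sup>+x. ennreal (u x powr p / F (x - x0) powr s) \<partial>lborel) = (\<integral>\<^sup>+x. ennreal (u x powr p) * ?w x \<partial>lborel)"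
    by (intro nn_integral_cong) (simp add: ennreal_mult'[symmetric])
  also have "\<dots> = (\<integral>\<^sup>+c. (\<integral>\<^sup>+x. ?w x * indicator {x. 0 \<le> c \<and> c < u x powr p} x \<partial>lborel) \<partial>lborel)"
    by (intro nn_integral_weighted_layer_cake sigma_finite_lborel) auto
  also have "\<dots> \<le> (\<integral>\<^sup>+c. (\<integral>\<^sup>+x. ?w x * indicator {x. 0 \<le> c \<and> c < v (F (x - x0)) powr p} x \<partial>lborel) \<partial>lborel)"
  proof (rule nn_integral_mono)
    fix c :: real
    show "(\<integral>\<^sup>+x. ?w x * indicator {x. 0 \<le> c \<and> c < u x powr p} x \<partial>lborel)
        \<le> (\<integral>\<^sup>+x. ?w x * indicator {x. 0 \<le> c \<and> c < v (F (x - x0)) powr p} x \<partial>lborel)"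
    proof (cases "0 \<le> c")
      case True
      define t where "t = c powr (1 / p)"
      have t: "0 \<le> t" by (simp add: t_def)
      have 1: "{x. 0 \<le> c \<and> c < u x powr p} = A t"
        using True lev[OF True u_nonneg] by (auto simp: A_def t_def)
      have 2: "{x. 0 \<le> c \<and> c < v (F (x - x0)) powr p} = {x. F (x - x0) < rho t}"
        using True lev[OF True v_nonneg] v_le_iff[OF t] F_nonneg by (auto simp: t_def[symmetric] not_le[symmetric])
      show ?thesis unfolding 1 2 by (rule hardy_littlewood_level[OF t s])
    qed simp
  qed
  also have "\<dots> = (\<integral>\<^sup>+x. ennreal (v (F (x - x0)) powr p) * ?w x \<partial>lborel)"
    by (intro nn_integral_weighted_layer_cake[symmetric] sigma_finite_lborel) auto
  also have "\<dots> = (\<integral>\<^sup>+x. ennreal (v (F (x - x0)) powr p / F (x - x0) powr s) \<partial>lborel)"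
    by (intro nn_integral_cong) (simp add: ennreal_mult'[symmetric])
  also have "\<dots> = (\<integral>\<^sup>+r. ennreal (real CARD('n) * b * r ^ (CARD('n) - 1) * indicator {0<..} r) * ennreal (v r powr p / r powr s) \<partial>lborel)"
    using nn_integral_radial[of "\<lambda>r. ennreal (v r powr p / r powr s)" x0] by simp
  finally show ?thesis .
qed

end

section \<open>The local Lipschitz constant\<close>

context gauge_norm
begin

definition quot where "quot u x y = \<bar>u y - u x\<bar> / F (y - x)"

lemma local_lip_quot: "local_lip F u x = real_of_ereal (Limsup (at x) (\<lambda>y. ereal (quot u x y)))"
  by (simp add: local_lip_def quot_def)

lemma quot_nonneg: "0 \<le> quot u x y" using F_nonneg by (simp add: quot_def)

lemma Limsup_quot_nonneg: "0 \<le> Limsup (at x) (\<lambda>y. ereal (quot u x y))"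
  by (rule le_Limsup) (auto simp: quot_nonneg)

lemma local_lip_nonneg: "0 \<le> local_lip F u x"
  unfolding local_lip_quot by (rule real_of_ereal_pos[OF Limsup_quot_nonneg])

lemma Limsup_quot_eq:
  assumes "eventually (\<lambda>y. quot u x y \<le> K) (at x)"
  shows "Limsup (at x) (\<lambda>y. ereal (quot u x y)) = ereal (local_lip F u x)" and "local_lip F u x \<le> K"
proof -
  have "Limsup (at x) (\<lambda>y. ereal (quot u x y)) \<le> ereal K"
    by (rule Limsup_bounded) (use assms in simp)
  with Limsup_quot_nonneg[of x u]
  show "Limsup (at x) (\<lambda>y. ereal (quot u x y)) = ereal (local_lip F u x)" "local_lip F u x \<le> K"
    unfolding local_lip_quot
    by (cases "Limsup (at x) (\<lambda>y. ereal (quot u x y))"; simp)+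
qed

text \<open>For fixed radius the supremum of the difference quotients is a supremum of continuous functions of
  \<open>x\<close>, hence lower semicontinuous; the upper limit is the infimum over countably many radii.\<close>

lemma local_lip_measurable:
  assumes u: "continuous_on UNIV u"
  shows "local_lip F u \<in> borel_measurable borel"
proof -
  define g where "g k x = (SUP z\<in>ball 0 (1 / real (Suc k)) - {0}. ereal (\<bar>u (x + z) - u x\<bar> / F z))" for k x
  have g: "g k \<in> borel_measurable borel" for k
  proof (rule borel_measurableI_greater)
    fix c :: ereal
    have "{x \<in> space borel. c < g k x} = (\<Union>z\<in>ball 0 (1 / real (Suc k)) - {0}. {x. c < ereal (\<bar>u (x + z) - u x\<bar> / F z)})"
      by (auto simp: g_def less_SUP_iff)
    moreover have "open {x. c < ereal (\<bar>u (x + z) - u x\<bar> / F z)}" if "z \<noteq> 0" for z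
    proof -
      have "continuous_on UNIV (\<lambda>x. ereal (\<bar>u (x + z) - u x\<bar> / F z))"
        using pos[OF that] by (intro continuous_intros continuous_on_compose2[OF u]) auto
      then show ?thesis by (intro open_Collect_less) auto
    qed
    ultimately have "open {x \<in> space borel. c < g k x}" by auto
    then show "{x \<in> space borel. c < g k x} \<in> sets borel" by simp
  qed
  have "Limsup (at x) (\<lambda>y. ereal (quot u x y)) = (INF k. g k x)" for x
  proof -
    have sup: "(SUP y\<in>ball x e - {x}. ereal (quot u x y)) = (SUP z\<in>ball 0 e - {0}. ereal (\<bar>u (x + z) - u x\<bar> / F z))" for e
    proof -
      have "y \<in> (\<lambda>z. x + z) ` (ball 0 e - {0})" if "y \<in> ball x e - {x}" for y
        using that by (intro image_eqI[of _ _ "y - x"]) (auto simp: dist_norm norm_minus_commute)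
      then have "ball x e - {x} \<subseteq> (\<lambda>z. x + z) ` (ball 0 e - {0})" ..
      moreover have "(\<lambda>z. x + z) ` (ball 0 e - {0}) \<subseteq> ball x e - {x}"
        by (auto simp: dist_norm)
      ultimately have "ball x e - {x} = (\<lambda>z. x + z) ` (ball 0 e - {0})" by (rule equalityI)
      then show ?thesis by (simp add: image_image quot_def)
    qed
    have "Limsup (at x) (\<lambda>y. ereal (quot u x y)) = (INF e\<in>{0<..}. SUP z\<in>ball 0 e - {0}. ereal (\<bar>u (x + z) - u x\<bar> / F z))"
      unfolding Limsup_at sup ..
    also have "\<dots> = (INF k. g k x)"
    proof (rule antisym)
      show "(INF e\<in>{0<..}. SUP z\<in>ball 0 e - {0}. ereal (\<bar>u (x + z) - u x\<bar> / F z)) \<le> (INF k. g k x)"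
        unfolding g_def by (intro INF_greatest INF_lower) auto
      show "(INF k. g k x) \<le> (INF e\<in>{0<..}. SUP z\<in>ball 0 e - {0}. ereal (\<bar>u (x + z) - u x\<bar> / F z))"
      proof (rule INF_greatest)
        fix e :: real assume "e \<in> {0<..}"
        then obtain k where "1 / real (Suc k) < e" using nat_approx_posE[of e] by auto
        then have "g k x \<le> (SUP z\<in>ball 0 e - {0}. ereal (\<bar>u (x + z) - u x\<bar> / F z))"
          unfolding g_def by (intro SUP_subset_mono) auto
        then show "(INF k. g k x) \<le> (SUP z\<in>ball 0 e - {0}. ereal (\<bar>u (x + z) - u x\<bar> / F z))"
          by (rule INF_lower2[rotated]) simp
      qed
    qed
    finally show ?thesis .
  qed
  then have "local_lip F u = (\<lambda>x. real_of_ereal (INF k. g k x))"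
    by (simp add: fun_eq_iff local_lip_quot)
  then show ?thesis using g by simp
qed

end

context lip_profile
begin

lemma quot_le: "quot u x y \<le> K"
  using u_lip[of y x] F_nonneg[of "y - x"] K by (cases "y = x") (auto simp: quot_def divide_le_eq pos)

lemma local_lip_ereal: "Limsup (at x) (\<lambda>y. ereal (quot u x y)) = ereal (local_lip F u x)"
  by (rule Limsup_quot_eq[where K = K]) (simp add: quot_le)

definition incr where "incr i x = (U (1 / real (Suc i)) x - u x) / (1 / real (Suc i))"

text \<open>If \<open>c\<close> exceeds the local Lipschitz constant, then \<open>u y \<le> u x + c F (y - x)\<close> for \<open>y\<close> near \<open>x\<close>, so
  that the supremum of \<open>u\<close> over a small ball of radius \<open>h\<close> is at most \<open>u x + c h\<close>.\<close>

lemma incr_limsup: "limsup (\<lambda>i. ennreal ((incr i x)\<^sup>2)) \<le> ennreal ((local_lip F u x)\<^sup>2)"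
proof -
  have "limsup (\<lambda>i. ennreal ((incr i x)\<^sup>2)) \<le> ennreal ((local_lip F u x + e)\<^sup>2)" if e: "0 < e" for e
  proof (rule Limsup_bounded)
    let ?c = "local_lip F u x + e"
    have c: "0 < ?c" using local_lip_nonneg[of u x] e by simp
    have "Limsup (at x) (\<lambda>y. ereal (quot u x y)) < ereal ?c"
      unfolding local_lip_ereal using e by simp
    then have "eventually (\<lambda>y. ereal (quot u x y) < ereal ?c) (at x)" by (rule Limsup_lessD)
    then obtain d where d: "0 < d" "\<And>y. y \<noteq> x \<Longrightarrow> dist y x < d \<Longrightarrow> quot u x y < ?c"
      by (auto simp: eventually_at)
    obtain a where a: "0 < a" "\<And>x. a * norm x \<le> F x" using F_lower by blast
    obtain i0 where i0: "1 / real (Suc i0) < a * d" using nat_approx_posE[of "a * d"] a d by auto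
    show "eventually (\<lambda>i. ennreal ((incr i x)\<^sup>2) \<le> ennreal (?c\<^sup>2)) sequentially"
    proof (rule eventually_sequentiallyI[of i0])
      fix i assume "i0 \<le> i"
      define h where "h = 1 / real (Suc i)"
      have h: "0 < h" by (simp add: h_def)
      have "h \<le> 1 / real (Suc i0)" using \<open>i0 \<le> i\<close> by (simp add: h_def frac_le)
      then have hd: "h < a * d" using i0 by simp
      have "U h x \<le> u x + ?c * h"
      proof (rule U_le[OF h])
        fix y assume y: "F (y - x) < h"
        show "u y \<le> u x + ?c * h"
        proof (cases "y = x")
          case True then show ?thesis using c h by simp
        next
          case False
          have "a * norm (y - x) < a * d" using a(2)[of "y - x"] y hd by simp
          then have "dist y x < d" using a by (simp add: dist_norm)
          then have "quot u x y < ?c" using d False by blast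
          moreover have "0 < F (y - x)" using False by (simp add: pos)
          ultimately have "\<bar>u y - u x\<bar> < ?c * F (y - x)" by (simp add: quot_def divide_less_eq)
          also have "\<dots> \<le> ?c * h" using y c by (intro mult_left_mono) auto
          finally show ?thesis by simp
        qed
      qed
      then have "incr i x \<le> ?c"
        unfolding incr_def h_def[symmetric] using h by (simp add: divide_le_eq)
      moreover have "0 \<le> incr i x"
        unfolding incr_def h_def[symmetric] using h U_bounds(1)[OF h, of x] by simp
      ultimately show "ennreal ((incr i x)\<^sup>2) \<le> ennreal (?c\<^sup>2)"
        by (intro ennreal_leI power_mono)
    qed
  qed
  note bound = this
  show ?thesis
  proof (rule tendsto_lowerbound)
    have "((\<lambda>e. ennreal ((local_lip F u x + e)\<^sup>2)) \<longlongrightarrow> ennreal ((local_lip F u x + 0)\<^sup>2)) (at_right 0)"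
      by (intro tendsto_intros tendsto_ennrealI)
    then show "((\<lambda>e. ennreal ((local_lip F u x + e)\<^sup>2)) \<longlongrightarrow> ennreal ((local_lip F u x)\<^sup>2)) (at_right 0)"
      by simp
    show "eventually (\<lambda>e. limsup (\<lambda>i. ennreal ((incr i x)\<^sup>2)) \<le> ennreal ((local_lip F u x + e)\<^sup>2)) (at_right 0)"
      using eventually_at_right_less[of "0 :: real"] by eventually_elim (rule bound)
  qed simp
qed

lemma incr_bounds: "0 \<le> incr i x" "incr i x \<le> K"
proof -
  define h where "h = 1 / real (Suc i)"
  have h: "0 < h" by (simp add: h_def)
  show "0 \<le> incr i x" "incr i x \<le> K"
    unfolding incr_def h_def[symmetric] using h U_bounds[OF h, of x] by (simp_all add: divide_le_eq)
qed

lemma incr_integral_limit: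
  assumes E: "(\<integral>\<^sup>+x. ennreal ((local_lip F u x)\<^sup>2) \<partial>lborel) = ennreal E" "0 \<le> E" and e: "0 < e"
  shows "eventually (\<lambda>i. (\<integral>\<^sup>+x. ennreal ((incr i x)\<^sup>2) \<partial>lborel) < ennreal (E + e)) sequentially"
proof -
  have [measurable]: "U (1 / real (Suc i)) \<in> borel_measurable borel" for i by (rule measurable_U) simp
  have [measurable]: "incr i \<in> borel_measurable borel" for i unfolding incr_def[abs_def] by measurable
  let ?W = "msum (A 0) (Bl 1)"
  have W: "open ?W" "bounded ?W" by (auto intro!: open_msum open_A bounded_msum bounded_A bounded_Bl)
  have "limsup (\<lambda>i. \<integral>\<^sup>+x. ennreal ((incr i x)\<^sup>2) \<partial>lborel) \<le> (\<integral>\<^sup>+x. limsup (\<lambda>i. ennreal ((incr i x)\<^sup>2)) \<partial>lborel)"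
  proof (rule nn_integral_limsup[where w = "\<lambda>x. ennreal (K\<^sup>2) * indicator ?W x"])
    show "(\<lambda>x. ennreal (K\<^sup>2) * indicator ?W x) \<in> borel_measurable lborel"
      using W by (intro borel_measurable_times_ennreal borel_measurable_indicator) auto
    show "AE x in lborel. ennreal ((incr i x)\<^sup>2) \<le> ennreal (K\<^sup>2) * indicator ?W x" for i
    proof (rule AE_I2)
      fix x
      show "ennreal ((incr i x)\<^sup>2) \<le> ennreal (K\<^sup>2) * indicator ?W x"
      proof (cases "x \<in> ?W")
        case True
        then show ?thesis using incr_bounds[of i x] by (auto intro!: ennreal_leI power_mono)
      next
        case False
        have "1 / real (Suc i) \<le> 1" by simp
        then have "incr i x = 0"
          using U_supp[of "1 / real (Suc i)" x] False unfolding incr_def by fastforce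
        then show ?thesis by simp
      qed
    qed
    show "(\<integral>\<^sup>+x. ennreal (K\<^sup>2) * indicator ?W x \<partial>lborel) < \<infinity>"
      using W emeasure_lborel_open_bounded[OF W]
      by (simp add: nn_integral_cmult_indicator ennreal_mult_less_top)
  qed measurable
  also have "\<dots> \<le> (\<integral>\<^sup>+x. ennreal ((local_lip F u x)\<^sup>2) \<partial>lborel)"
    by (intro nn_integral_mono incr_limsup)
  also have "\<dots> < ennreal (E + e)"
    unfolding E(1) using E(2) e by (intro ennreal_lessI) auto
  finally show ?thesis by (rule Limsup_lessD)
qed

lemma symmetrized_incr:
  defines "C \<equiv> real CARD('n) * b"
  shows "ennreal C * (\<integral>\<^sup>+r. ennreal (((v (r - 1 / real (Suc i)) - v r) / (1 / real (Suc i)))\<^sup>2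
          * r powr (real CARD('n) - 1) * indicator {0<..} r) \<partial>lborel) \<le> (\<integral>\<^sup>+x. ennreal ((incr i x)\<^sup>2) \<partial>lborel)"
proof -
  define h where "h = 1 / real (Suc i)"
  have h: "0 < h" by (simp add: h_def)
  have C: "0 \<le> C" using b_pos by (simp add: C_def)
  have [measurable]: "U h \<in> borel_measurable borel" using h by measurable
  have "ennreal C * (\<integral>\<^sup>+r. ennreal (((v (r - h) - v r) / h)\<^sup>2 * r powr (real CARD('n) - 1) * indicator {0<..} r) \<partial>lborel)
      = ennreal (1 / h\<^sup>2) * (\<integral>\<^sup>+r. ennreal (C * r ^ (CARD('n) - 1) * indicator {0<..} r) * ennreal ((v (r - h) - v r)\<^sup>2) \<partial>lborel)"
  proof -
    have "ennreal C * ennreal (((v (r - h) - v r) / h)\<^sup>2 * r powr (real CARD('n) - 1) * indicator {0<..} r)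
       = ennreal (1 / h\<^sup>2) * (ennreal (C * r ^ (CARD('n) - 1) * indicator {0<..} r) * ennreal ((v (r - h) - v r)\<^sup>2))" for r
    proof (cases "0 < r")
      case True
      have "1 \<le> CARD('n)" by (simp add: Suc_le_eq)
      then have "r powr (real CARD('n) - 1) = r ^ (CARD('n) - 1)"
        using True by (simp add: powr_realpow[symmetric] of_nat_diff)
      then show ?thesis
        using True C h by (simp add: ennreal_mult'[symmetric] power_divide mult_ac)
    qed simp
    then show ?thesis
      by (subst (1 2) nn_integral_cmult[symmetric]) auto
  qed
  also have "\<dots> \<le> ennreal (1 / h\<^sup>2) * (\<integral>\<^sup>+x. ennreal ((U h x - u x)\<^sup>2) \<partial>lborel)"
    unfolding C_def by (intro mult_left_mono discrete_polya_szego h) simp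
  also have "\<dots> = (\<integral>\<^sup>+x. ennreal ((incr i x)\<^sup>2) \<partial>lborel)"
    unfolding incr_def h_def[symmetric] using h
    by (subst nn_integral_cmult[symmetric]) (auto simp: ennreal_mult'[symmetric] power_divide)
  finally show ?thesis by (simp add: h_def)
qed

text \<open>The inequality with the mass \<open>I\<close> of the rearrangement in between: \<open>I\<close> bounds the weighted norm from
  above by Hardy-Littlewood, and the energy bounds \<open>I\<close> by Polya-Szego and the one-dimensional
  inequality.\<close>

lemma core_inequality:
  fixes s :: real
  assumes n: "3 \<le> CARD('n)" and s: "0 \<le> s" "s < 2"
    and E: "(\<integral>\<^sup>+x. ennreal ((local_lip F u x)\<^sup>2) \<partial>lborel) = ennreal E" "0 \<le> E"
  defines "n \<equiv> real CARD('n)"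
  obtains I where "0 \<le> I"
    "(\<integral>\<^sup>+x. ennreal (u x powr bliss.p n s / F (x - x0) powr s) \<partial>lborel) \<le> ennreal (n * b * I)"
    "(n - 2) * (n - s) * bliss.J n s * (I / bliss.J n s) powr (2 / bliss.p n s) \<le> E / (n * b)"
proof -
  interpret bliss n s by unfold_locales (use n s in \<open>auto simp: n_def\<close>)
  define C where "C = n * b"
  have C: "0 < C" using b_pos param by (simp add: C_def)
  define R where "R = rho 0"
  have R: "0 < R" using rho_0_pos by (simp add: R_def)
  define I where "I = integral {0..R} (\<lambda>t. v t powr p * t powr (n - 1 - s))"
  have cont_m: "continuous_on {0..R} (\<lambda>t. v t powr p * t powr (n - 1 - s))"
    using param v_nonneg
    by (intro continuous_on_mult continuous_on_powr' continuous_intros continuous_on_subset[OF v_cont]) auto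
  have hasI: "((\<lambda>t. v t powr p * t powr (n - 1 - s)) has_integral I) {0..R}"
    unfolding I_def by (intro integrable_integral integrable_continuous_real cont_m)
  have I0: "0 \<le> I"
    by (rule has_integral_nonneg[OF hasI]) simp
  have "(\<integral>\<^sup>+x. ennreal (u x powr p / F (x - x0) powr s) \<partial>lborel)
      \<le> (\<integral>\<^sup>+r. ennreal (real CARD('n) * b * r ^ (CARD('n) - 1) * indicator {0<..} r) * ennreal (v r powr p / r powr s) \<partial>lborel)"
    using param s by (intro hardy_littlewood) auto
  also have "\<dots> = (\<integral>\<^sup>+r. ennreal C * ennreal (indicator {0..R} r * (v r powr p * r powr (n - 1 - s))) \<partial>lborel)"
  proof (rule nn_integral_cong)
    fix r :: real
    show "ennreal (real CARD('n) * b * r ^ (CARD('n) - 1) * indicator {0<..} r) * ennreal (v r powr p / r powr s)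
        = ennreal C * ennreal (indicator {0..R} r * (v r powr p * r powr (n - 1 - s)))"
    proof (cases "0 < r \<and> r \<le> R")
      case True
      have "1 \<le> CARD('n)" by (simp add: Suc_le_eq)
      then have pw: "r ^ (CARD('n) - 1) / r powr s = r powr (n - 1 - s)"
        using True by (simp add: powr_realpow[symmetric] of_nat_diff powr_diff n_def)
      have "real CARD('n) * b * r ^ (CARD('n) - 1) * (v r powr p / r powr s)
          = C * (v r powr p * (r ^ (CARD('n) - 1) / r powr s))"
        by (simp add: C_def n_def)
      then have "real CARD('n) * b * r ^ (CARD('n) - 1) * (v r powr p / r powr s)
          = C * (v r powr p * r powr (n - 1 - s))"
        unfolding pw .
      moreover have "0 \<le> real CARD('n) * b * r ^ (CARD('n) - 1)"
        using True b_pos by simp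
      ultimately have "ennreal (real CARD('n) * b * r ^ (CARD('n) - 1)) * ennreal (v r powr p / r powr s)
          = ennreal C * ennreal (v r powr p * r powr (n - 1 - s))"
        using C by (simp only: ennreal_mult'[symmetric] less_imp_le)
      then show ?thesis using True by simp
    next
      case False
      then consider "r \<le> 0" | "R < r" by linarith
      then show ?thesis
      proof cases
        case 1 then show ?thesis using param by (cases "r = 0") auto
      next
        case 2 then show ?thesis using v_zero[of r] param by (simp add: R_def)
      qed
    qed
  qed
  also have "\<dots> = ennreal C * (\<integral>\<^sup>+r. ennreal (indicator {0..R} r * (v r powr p * r powr (n - 1 - s))) \<partial>lborel)"
    by (rule nn_integral_cmult) auto
  also have "(\<integral>\<^sup>+r. ennreal (indicator {0..R} r * (v r powr p * r powr (n - 1 - s))) \<partial>lborel) = ennreal I"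
    by (rule nn_integral_has_integral_lebesgue[OF _ hasI]) simp
  finally have HL: "(\<integral>\<^sup>+x. ennreal (u x powr p / F (x - x0) powr s) \<partial>lborel) \<le> ennreal (C * I)"
    using C by (simp add: ennreal_mult')
  have "(n - 2) * (n - s) * J * (I / J) powr (2 / p) \<le> E / C"
    unfolding I_def
  proof (rule bliss_inequality)
    show "v x \<le> v y" if "y \<le> x" for x y using v_anti[OF that] .
    show "0 \<le> v x" for x by (rule v_nonneg)
    show "continuous_on UNIV v" by (rule v_cont)
    show "v x = 0" if "R \<le> x" for x using v_zero that by (simp add: R_def)
    show "0 < R" by (rule R)
    show "0 < v 0" by (rule v_0_pos)
    show "0 \<le> E / C" using E C by simp
    fix e :: real assume e: "0 < e"
    have "0 < e * C" using e C by simp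
    from incr_integral_limit[OF E this]
    show "eventually (\<lambda>i. (\<integral>\<^sup>+r. ennreal (((v (r - 1 / real (Suc i)) - v r) / (1 / real (Suc i)))\<^sup>2
          * r powr (n - 1) * indicator {0<..} r) \<partial>lborel) \<le> ennreal (E / C + e)) sequentially"
    proof eventually_elim
      case (elim i)
      let ?X = "\<integral>\<^sup>+r. ennreal (((v (r - 1 / real (Suc i)) - v r) / (1 / real (Suc i)))\<^sup>2
          * r powr (n - 1) * indicator {0<..} r) \<partial>lborel"
      have "ennreal C * ?X \<le> ennreal (E + e * C)"
        using order_trans[OF symmetrized_incr[of i, folded n_def, folded C_def] less_imp_le[OF elim]] .
      then have "ennreal (1 / C) * (ennreal C * ?X) \<le> ennreal (1 / C) * ennreal (E + e * C)"
        by (rule mult_left_mono) simp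
      also have "\<dots> = ennreal (E / C + e)"
        using C E e by (simp add: ennreal_mult'[symmetric] add_divide_distrib del: ennreal_plus)
      also have "ennreal (1 / C) * (ennreal C * ?X) = ?X"
        using C by (simp add: mult.assoc[symmetric] ennreal_mult'[symmetric])
      finally show ?case .
    qed
  qed
  with I0 HL that show ?thesis by (simp add: C_def)
qed

end

section \<open>The sharp inequality for compactly supported Lipschitz functions\<close>

text \<open>The constant is arranged so that the two bounds of \<open>core_inequality\<close> combine to the stated
  inequality; with equality in both bounds it gives equality. Here \<open>M = (n - 2) (n - s)\<close>, and \<open>W\<close> is
  \<open>n\<close> times the volume of the unit ball.\<close>

lemma sharp_constant_algebra:
  fixes M W J I p :: real
  assumes "0 < M" "0 < W" "0 < J" "0 \<le> I" "0 < p"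
  shows "(1 / M) powr (1 / 2) * (1 / (W * J)) powr (1 / 2 - 1 / p) * (W * (M * J * (I / J) powr (2 / p))) powr (1 / 2)
     = (W * I) powr (1 / p)"
proof (cases "I = 0")
  case True
  then show ?thesis using assms by simp
next
  case False
  then have I: "0 < I" using assms by simp
  define m w j i where "m = ln M" and "w = ln W" and "j = ln J" and "i = ln I"
  have e: "M = exp m" "W = exp w" "J = exp j" "I = exp i"
    using assms I by (simp_all add: m_def w_def j_def i_def)
  have 1: "(1 / M) powr (1 / 2) = exp (- m / 2)"
    by (simp add: e powr_def ln_div)
  have 2: "(1 / (W * J)) powr (1 / 2 - 1 / p) = exp ((1 / 2 - 1 / p) * (- (w + j)))"
    by (simp add: e powr_def ln_div ln_mult)
  have 3: "(W * (M * J * (I / J) powr (2 / p))) powr (1 / 2) = exp ((w + m + j + (2 / p) * (i - j)) / 2)"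
    by (simp add: e powr_def ln_div ln_mult exp_add[symmetric] exp_diff[symmetric] algebra_simps)
  have 4: "(W * I) powr (1 / p) = exp ((w + i) / p)"
    by (simp add: e powr_def ln_mult)
  have "- m / 2 + (1 / 2 - 1 / p) * (- (w + j)) + (w + m + j + (2 / p) * (i - j)) / 2 = (w + i) / p"
    using assms(5) by (simp add: field_simps)
  then show ?thesis
    unfolding 1 2 3 4 by (simp only: exp_add[symmetric])
qed

lemma ckn_const_eq:
  fixes n s a p :: real
  assumes n: "3 \<le> n" and s: "0 \<le> s" "s < 2" and ap: "a * p = s"
  shows "ckn_const n a p = (1 / ((n - 2) * (n - s))) powr (1 / 2)
     * (1 / (n * unit_ball_vol n * bliss.J n s)) powr (1 / 2 - 1 / bliss.p n s)"
proof -
  interpret B: bliss n s by unfold_locales (use n s in auto)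
  have e: "2 * n - 2 * a * p = 2 * (n - s)" unfolding ap[symmetric] by (simp add: algebra_simps)
  have g: "(2 * n - 2 * a * p) / (2 - a * p) = 2 * B.nu" "(n - a * p) / (2 - a * p) = B.nu"
    unfolding e ap B.nu_def by simp_all
  have J: "B.J = (Gamma B.nu)\<^sup>2 / (Gamma (2 * B.nu) * (2 - s))"
    unfolding B.J_def Beta_def power2_eq_square mult_2 by (simp only: divide_divide_eq_left)
  have 1: "(2 - a * p) * Gamma ((2 * n - 2 * a * p) / (2 - a * p)) / (n * unit_ball_vol n * (Gamma ((n - a * p) / (2 - a * p)))\<^sup>2)
      = 1 / (n * unit_ball_vol n * B.J)"
    unfolding g J unfolding ap by (simp only: times_divide_eq_right divide_divide_eq_right mult_1 mult.commute mult.left_commute mult.assoc)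
  have 2: "(2 - a * p) / (2 * n - 2 * a * p) = 1 / 2 - 1 / B.p"
  proof -
    have "1 / B.p = (n - 2) / (2 * (n - s))" unfolding B.p_def by simp
    moreover have "(n - s) / (2 * (n - s)) = 1 / 2" using B.param(7) by simp
    moreover have "(2 - s) / (2 * (n - s)) = (n - s) / (2 * (n - s)) - (n - 2) / (2 * (n - s))"
      unfolding diff_divide_distrib[symmetric] by simp
    ultimately show ?thesis unfolding e ap by simp
  qed
  show ?thesis
    unfolding ckn_const_def 1 2 unfolding ap ..
qed

context gauge_norm
begin

text \<open>\<open>cs\<close> is the factor by which the normalised measure differs from Lebesgue measure.\<close>

definition om where "om = unit_ball_vol (real CARD('n))"
definition cs where "cs = om / b"

lemma om_pos: "0 < om" by (simp add: om_def)
lemma cs_pos: "0 < cs" using om_pos b_pos by (simp add: cs_def)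
lemma cs_b: "cs * b = om" using b_pos by (simp add: cs_def)

lemma minkowski_measure_eq: "minkowski_measure F = scale_measure (ennreal cs) lebesgue"
  by (simp add: minkowski_measure_def cs_def om_def b_def Bl_def)

lemma integral_minkowski:
  fixes f :: "real^'n \<Rightarrow> real"
  assumes f: "f \<in> borel_measurable borel" and nonneg: "\<And>x. 0 \<le> f x"
    and I: "(\<integral>\<^sup>+x. ennreal (f x) \<partial>lborel) = ennreal I" "0 \<le> I"
  shows "integrable (minkowski_measure F) f" "(\<integral>x. f x \<partial>minkowski_measure F) = cs * I"
proof -
  have fl: "f \<in> borel_measurable lebesgue"
    using f by (simp add: measurable_completion)
  have m: "f \<in> borel_measurable (minkowski_measure F)"
    using fl unfolding minkowski_measure_eq by (simp add: measurable_def)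
  have nn: "(\<integral>\<^sup>+x. ennreal (f x) \<partial>minkowski_measure F) = ennreal (cs * I)"
    unfolding minkowski_measure_eq using fl I cs_pos
    by (subst nn_integral_scale_measure) (auto simp: nn_integral_completion ennreal_mult')
  have "has_bochner_integral (minkowski_measure F) f (cs * I)"
    by (rule has_bochner_integral_nn_integral[OF m _ _ nn]) (use nonneg cs_pos I in auto)
  then show "integrable (minkowski_measure F) f" "(\<integral>x. f x \<partial>minkowski_measure F) = cs * I"
    by (auto simp: has_bochner_integral_iff)
qed

lemma local_lip_mono:
  assumes "\<And>y. quot w x y \<le> quot u x y" and "eventually (\<lambda>y. quot u x y \<le> K) (at x)"
  shows "local_lip F w x \<le> local_lip F u x"
proof -
  have "eventually (\<lambda>y. quot w x y \<le> K) (at x)"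
    using assms(2) by eventually_elim (use assms(1) order_trans in blast)
  note w = Limsup_quot_eq(1)[OF this] and u = Limsup_quot_eq(1)[OF assms(2)]
  have "Limsup (at x) (\<lambda>y. ereal (quot w x y)) \<le> Limsup (at x) (\<lambda>y. ereal (quot u x y))"
    by (intro Limsup_mono) (simp add: assms(1))
  then show ?thesis unfolding w u by simp
qed

lemma Lip0_bound:
  assumes "u \<in> Lip0"
  obtains K where "0 < K" "\<And>x y. \<bar>u x - u y\<bar> \<le> K * F (x - y)"
proof -
  obtain L where L: "L-lipschitz_on UNIV u" using assms by (auto simp: Lip0_def)
  obtain a where a: "0 < a" "\<And>x. a * norm x \<le> F x" using F_lower by blast
  have L0: "0 \<le> L" using L by (rule lipschitz_on_nonneg)
  have "\<bar>u x - u y\<bar> \<le> (L / a + 1) * F (x - y)" for x y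
  proof -
    have "\<bar>u x - u y\<bar> \<le> L * norm (x - y)"
      using lipschitz_onD[OF L, of x y] by (simp add: dist_norm)
    also have "\<dots> \<le> L * (F (x - y) / a)"
      using a L0 by (intro mult_left_mono) (auto simp: field_simps)
    also have "\<dots> \<le> (L / a + 1) * F (x - y)"
      using F_nonneg[of "x - y"] by (simp add: distrib_right)
    finally show ?thesis .
  qed
  moreover have "0 < L / a + 1" using a L0 by (simp add: add_nonneg_pos)
  ultimately show ?thesis using that by blast
qed

lemma Lip0_cont: "u \<in> Lip0 \<Longrightarrow> continuous_on UNIV u"
  by (auto simp: Lip0_def intro: lipschitz_on_continuous_on)

lemma quot_le_of_bound:
  assumes "0 < K" "\<And>x y. \<bar>u x - u y\<bar> \<le> K * F (x - y)" shows "quot u x y \<le> K"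
  using assms(2)[of y x] F_nonneg[of "y - x"] assms(1) by (cases "y = x") (auto simp: quot_def divide_le_eq pos)

lemma Lip0_energy:
  assumes u: "u \<in> Lip0"
  obtains E where "0 \<le> E" "(\<integral>\<^sup>+x. ennreal ((local_lip F u x)\<^sup>2) \<partial>lborel) = ennreal E"
proof -
  obtain K where K: "0 < K" "\<And>x y. \<bar>u x - u y\<bar> \<le> K * F (x - y)" using Lip0_bound[OF u] by blast
  let ?S = "closure {x. u x \<noteq> 0}"
  have S: "compact ?S" using u by (simp add: Lip0_def)
  have le: "local_lip F u x \<le> K" for x
    by (rule Limsup_quot_eq(2)) (simp add: quot_le_of_bound[OF K])
  have z: "u y = 0" if "y \<notin> ?S" for y
    using that closure_subset[of "{x. u x \<noteq> 0}"] by auto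
  have zero: "local_lip F u x = 0" if x: "x \<notin> ?S" for x
  proof -
    have "open (- ?S)" by (simp add: open_Compl)
    then obtain d where d: "0 < d" "ball x d \<subseteq> - ?S"
      using x open_contains_ball by (metis ComplI)
    have "eventually (\<lambda>y. dist y x < d) (at x)"
      using d(1) by (auto simp: eventually_at)
    then have "eventually (\<lambda>y. quot u x y \<le> 0) (at x)"
    proof eventually_elim
      case (elim y)
      then have "y \<in> - ?S" using d(2) by (auto simp: dist_commute)
      then show ?case using z[of y] z[OF x] by (simp add: quot_def)
    qed
    then have "local_lip F u x \<le> 0" by (rule Limsup_quot_eq(2))
    then show ?thesis using local_lip_nonneg[of u x] by simp
  qed
  have "(\<integral>\<^sup>+x. ennreal ((local_lip F u x)\<^sup>2) \<partial>lborel) \<le> (\<integral>\<^sup>+x. ennreal (K\<^sup>2) * indicator ?S x \<partial>lborel)"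
  proof (rule nn_integral_mono)
    fix x
    show "ennreal ((local_lip F u x)\<^sup>2) \<le> ennreal (K\<^sup>2) * indicator ?S x"
      using le[of x] local_lip_nonneg[of u x] zero[of x]
      by (cases "x \<in> ?S") (auto intro!: ennreal_leI power_mono)
  qed
  also have "\<dots> < top"
    using emeasure_compact_finite[OF S] S
    by (simp add: nn_integral_cmult_indicator ennreal_mult_less_top compact_imp_closed borel_closed)
  finally show ?thesis
    using that[of "enn2real (\<integral>\<^sup>+x. ennreal ((local_lip F u x)\<^sup>2) \<partial>lborel)"] by simp
qed

text \<open>Apply \<open>core_inequality\<close> to \<open>|u|\<close>, whose difference quotients are at most those of \<open>u\<close>.\<close>

lemma Lip0_sharp_inequality:
  fixes a p :: real
  assumes n: "3 \<le> CARD('n)" and s: "0 \<le> a * p" "a * p < 2" and p: "p = bliss.p (real CARD('n)) (a * p)"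
    and u: "u \<in> Lip0"
  shows "ckn_integrable F x0 a p u \<and> ckn_lhs F x0 a p u \<le> ckn_const (real CARD('n)) a p * ckn_rhs F u"
proof -
  define n s where "n = real CARD('n)" and "s = a * p"
  interpret B: bliss n s by unfold_locales (use n s in \<open>auto simp: n_def s_def\<close>)
  have pB: "B.p = p" using p by (simp add: n_def s_def)
  obtain K where K: "0 < K" "\<And>x y. \<bar>u x - u y\<bar> \<le> K * F (x - y)" using Lip0_bound[OF u] by blast
  obtain E where E: "0 \<le> E" "(\<integral>\<^sup>+x. ennreal ((local_lip F u x)\<^sup>2) \<partial>lborel) = ennreal E"
    using Lip0_energy[OF u] .
  have [measurable]: "local_lip F u \<in> borel_measurable borel" "u \<in> borel_measurable borel"
    using local_lip_measurable Lip0_cont[OF u] by (auto intro: borel_measurable_continuous_onI)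
  have ll_m: "(\<lambda>x. (local_lip F u x)\<^sup>2) \<in> borel_measurable borel" by measurable
  note rhs = integral_minkowski[OF ll_m zero_le_power2 E(2,1)]
  have ckn_m: "ckn_integrand F x0 a p u \<in> borel_measurable borel"
    unfolding ckn_integrand_def[abs_def] by measurable
  have "\<exists>I P. 0 \<le> I \<and> 0 \<le> P \<and> (\<integral>\<^sup>+x. ennreal (ckn_integrand F x0 a p u x) \<partial>lborel) = ennreal P
     \<and> P \<le> n * b * I \<and> (n - 2) * (n - s) * B.J * (I / B.J) powr (2 / p) \<le> E / (n * b)"
  proof (cases "\<exists>x. u x \<noteq> 0")
    case False
    then show ?thesis
      using E b_pos B.param by (intro exI[of _ 0]) (auto simp: ckn_integrand_def n_def)
  next
    case True
    define w where "w x = \<bar>u x\<bar>" for x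
    interpret W: lip_profile F w K
    proof
      show "0 \<le> w x" for x by (simp add: w_def)
      show "\<bar>w x - w y\<bar> \<le> K * F (x - y)" for x y
        using K(2)[of x y] abs_triangle_ineq3[of "u x" "u y"] by (simp add: w_def)
      have "bounded (closure {x. u x \<noteq> 0})" using u by (auto simp: Lip0_def compact_imp_bounded)
      then show "bounded {x. w x \<noteq> 0}"
        by (rule bounded_subset) (use closure_subset[of "{x. u x \<noteq> 0}"] in \<open>auto simp: w_def\<close>)
      show "\<exists>x. 0 < w x" using True by (auto simp: w_def)
    qed (rule K)
    have quot: "quot w x y \<le> quot u x y" for x y
      unfolding quot_def w_def using F_nonneg[of "y - x"] abs_triangle_ineq3[of "u y" "u x"]
      by (intro divide_right_mono) auto
    have le: "local_lip F w x \<le> local_lip F u x" for x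
      by (rule local_lip_mono[where K = K]) (auto simp: quot quot_le_of_bound[OF K])
    have "(\<integral>\<^sup>+x. ennreal ((local_lip F w x)\<^sup>2) \<partial>lborel) \<le> ennreal E"
      unfolding E(2)[symmetric] using le local_lip_nonneg[of w]
      by (intro nn_integral_mono ennreal_leI power_mono) auto
    then obtain E' where E': "(\<integral>\<^sup>+x. ennreal ((local_lip F w x)\<^sup>2) \<partial>lborel) = ennreal E'" "0 \<le> E'" "E' \<le> E"
      using E(1) by (cases "\<integral>\<^sup>+x. ennreal ((local_lip F w x)\<^sup>2) \<partial>lborel" rule: ennreal_cases) (auto simp: top_unique)
    obtain I where I: "0 \<le> I"
      "(\<integral>\<^sup>+x. ennreal (w x powr B.p / F (x - x0) powr s) \<partial>lborel) \<le> ennreal (n * b * I)"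
      "(n - 2) * (n - s) * B.J * (I / B.J) powr (2 / B.p) \<le> E' / (n * b)"
      using W.core_inequality[of s E' x0] n s E' unfolding n_def[symmetric] s_def[symmetric] by blast
    have le2: "(\<integral>\<^sup>+x. ennreal (ckn_integrand F x0 a p u x) \<partial>lborel) \<le> ennreal (n * b * I)"
      using I(2) unfolding pB by (simp add: ckn_integrand_def w_def s_def)
    have nbI: "0 \<le> n * b * I" using I(1) b_pos by (simp add: n_def)
    obtain P where P: "(\<integral>\<^sup>+x. ennreal (ckn_integrand F x0 a p u x) \<partial>lborel) = ennreal P" "0 \<le> P" "P \<le> n * b * I"
      using le2 nbI by (cases "\<integral>\<^sup>+x. ennreal (ckn_integrand F x0 a p u x) \<partial>lborel" rule: ennreal_cases) (auto simp: top_unique)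
    have "E' / (n * b) \<le> E / (n * b)"
      using E'(3) b_pos by (intro divide_right_mono) (auto simp: n_def)
    then show ?thesis
      using I P pB by (intro exI[of _ I] exI[of _ P]) auto
  qed
  then obtain I P where I: "0 \<le> I" and P: "0 \<le> P" "(\<integral>\<^sup>+x. ennreal (ckn_integrand F x0 a p u x) \<partial>lborel) = ennreal P" "P \<le> n * b * I"
    and EI: "(n - 2) * (n - s) * B.J * (I / B.J) powr (2 / p) \<le> E / (n * b)" by blast
  have nn: "0 \<le> ckn_integrand F x0 a p u x" for x by (simp add: ckn_integrand_def)
  note lhs = integral_minkowski[OF ckn_m nn P(2,1)]
  have int: "ckn_integrable F x0 a p u"
    unfolding ckn_integrable_def using lhs(1) rhs(1) by simp
  have lhs_eq: "ckn_lhs F x0 a p u = (cs * P) powr (1 / p)"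
    unfolding ckn_lhs_def using lhs(2) by simp
  have rhs_eq: "ckn_rhs F u = (cs * E) powr (1 / 2)"
    unfolding ckn_rhs_def using rhs(2) by simp
  have W: "0 < n * om" using om_pos B.param by simp
  have M: "0 < (n - 2) * (n - s)" using B.param by simp
  have pp: "0 < p" using B.param pB by simp
  have "ckn_lhs F x0 a p u \<le> (n * om * I) powr (1 / p)"
  proof -
    have "cs * P \<le> cs * (n * b * I)" using P(3) cs_pos by simp
    also have "\<dots> = n * om * I" using cs_b by (simp add: mult_ac) 
    finally show ?thesis
      unfolding lhs_eq using P(1) cs_pos pp by (intro powr_mono2) auto
  qed
  also have "\<dots> = ckn_const n a p * (n * om * ((n - 2) * (n - s) * B.J * (I / B.J) powr (2 / p))) powr (1 / 2)"
    unfolding ckn_const_eq[OF B.n B.s s_def[symmetric]] pB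
    using sharp_constant_algebra[OF M W B.J_pos I pp] by (simp add: om_def n_def)
  also have "\<dots> \<le> ckn_const n a p * ckn_rhs F u"
  proof -
    have "n * om * ((n - 2) * (n - s) * B.J * (I / B.J) powr (2 / p)) \<le> n * om * (E / (n * b))"
      using EI W by (intro mult_left_mono) auto
    also have "\<dots> = cs * E" using B.param by (simp add: cs_def)
    finally have "(n * om * ((n - 2) * (n - s) * B.J * (I / B.J) powr (2 / p))) powr (1 / 2) \<le> ckn_rhs F u"
      unfolding rhs_eq using W M B.J_pos by (intro powr_mono2) auto
    moreover have "0 \<le> ckn_const n a p"
      unfolding ckn_const_eq[OF B.n B.s s_def[symmetric]] by simp
    ultimately show ?thesis by (rule mult_left_mono)
  qed
  finally show ?thesis using int by (simp add: n_def)
qed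

end

section \<open>Radial extremals\<close>

text \<open>Substitute \<open>y = l\<close> to the power \<open>1 / d\<close> times the new variable.\<close>

lemma nn_integral_Beta_half_line_scaled:
  fixes a c d l :: real
  assumes "0 < a" "0 < c" "0 < d" "0 < l"
  shows "(\<integral>\<^sup>+y. ennreal (y powr (d * a - 1) * (l + y powr d) powr (- (a + c)) * indicator {0<..} y) \<partial>lborel)
       = ennreal (l powr (- c) * (Beta a c / d))"
proof -
  define \<sigma> where "\<sigma> = l powr (1 / d)"
  have \<sigma>: "0 < \<sigma>" "\<sigma> powr d = l" using assms by (simp_all add: \<sigma>_def powr_powr)
  have "(\<integral>\<^sup>+y. ennreal (y powr (d * a - 1) * (l + y powr d) powr (- (a + c)) * indicator {0<..} y) \<partial>lborel)
      = ennreal \<bar>\<sigma>\<bar> * (\<integral>\<^sup>+y. ennreal ((0 + \<sigma> * y) powr (d * a - 1) * (l + (0 + \<sigma> * y) powr d) powr (- (a + c)) * indicator {0<..} (0 + \<sigma> * y)) \<partial>lborel)"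
    using \<sigma> by (intro nn_integral_real_affine) auto
  also have "\<dots> = (\<integral>\<^sup>+y. ennreal \<sigma> * ennreal ((\<sigma> * y) powr (d * a - 1) * (l + (\<sigma> * y) powr d) powr (- (a + c)) * indicator {0<..} (\<sigma> * y)) \<partial>lborel)"
    using \<sigma> by (subst nn_integral_cmult) auto
  also have "\<dots> = (\<integral>\<^sup>+y. ennreal (l powr (- c)) * ennreal (y powr (d * a - 1) * (1 + y powr d) powr (- (a + c)) * indicator {0<..} y) \<partial>lborel)"
  proof (rule nn_integral_cong)
    fix y :: real
    show "ennreal \<sigma> * ennreal ((\<sigma> * y) powr (d * a - 1) * (l + (\<sigma> * y) powr d) powr (- (a + c)) * indicator {0<..} (\<sigma> * y))
      = ennreal (l powr (- c)) * ennreal (y powr (d * a - 1) * (1 + y powr d) powr (- (a + c)) * indicator {0<..} y)"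
    proof (cases "0 < y")
      case True
      have 1: "l + (\<sigma> * y) powr d = l * (1 + y powr d)"
        using True \<sigma> by (simp add: powr_mult distrib_left)
      have 2: "(l * (1 + y powr d)) powr (- (a + c)) = l powr (- (a + c)) * (1 + y powr d) powr (- (a + c))"
        using assms by (simp add: powr_mult)
      have 3: "\<sigma> * \<sigma> powr (d * a - 1) = l powr a"
      proof -
        have "\<sigma> * \<sigma> powr (d * a - 1) = \<sigma> powr (d * a)" using \<sigma> by (simp add: powr_mult_base)
        also have "\<dots> = (\<sigma> powr d) powr a" by (simp add: powr_powr)
        finally show ?thesis using \<sigma> by simp
      qed
      have 4: "l powr a * l powr (- (a + c)) = l powr (- c)"
        by (simp add: powr_add[symmetric])
      have "\<sigma> * ((\<sigma> * y) powr (d * a - 1) * (l + (\<sigma> * y) powr d) powr (- (a + c)))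
          = (\<sigma> * \<sigma> powr (d * a - 1)) * l powr (- (a + c)) * (y powr (d * a - 1) * (1 + y powr d) powr (- (a + c)))"
        unfolding 1 2 using True \<sigma> by (simp add: powr_mult)
      also have "\<dots> = l powr (- c) * (y powr (d * a - 1) * (1 + y powr d) powr (- (a + c)))"
        unfolding 3 4 ..
      finally have "\<sigma> * ((\<sigma> * y) powr (d * a - 1) * (l + (\<sigma> * y) powr d) powr (- (a + c)))
          = l powr (- c) * (y powr (d * a - 1) * (1 + y powr d) powr (- (a + c)))" .
      then have "ennreal \<sigma> * ennreal ((\<sigma> * y) powr (d * a - 1) * (l + (\<sigma> * y) powr d) powr (- (a + c)))
          = ennreal (l powr (- c)) * ennreal (y powr (d * a - 1) * (1 + y powr d) powr (- (a + c)))"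
        using \<sigma> by (simp only: ennreal_mult'[symmetric] less_imp_le powr_ge_zero)
      then show ?thesis using True \<sigma> by simp
    next
      case False
      then have "\<not> 0 < \<sigma> * y" using \<sigma> by (simp add: zero_less_mult_iff)
      then show ?thesis using False by simp
    qed
  qed
  also have "\<dots> = ennreal (l powr (- c)) * ennreal (Beta a c / d)"
    by (subst nn_integral_cmult) (simp_all only: nn_integral_Beta_half_line[OF assms(1-3)], measurable)
  also have "\<dots> = ennreal (l powr (- c) * (Beta a c / d))"
    by (rule ennreal_mult'[symmetric]) simp
  finally show ?thesis .
qed

lemma derivative_difference_bound:
  fixes h :: "real \<Rightarrow> real"
  assumes "(h has_real_derivative d) (at r)" "0 < e"
  obtains \<delta> where "0 < \<delta>" "\<And>r'. \<bar>r' - r\<bar> < \<delta> \<Longrightarrow> \<bar>h r' - h r\<bar> \<le> (\<bar>d\<bar> + e) * \<bar>r' - r\<bar>"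
proof -
  have "((\<lambda>y. (h y - h r) / (y - r)) \<longlongrightarrow> d) (at r)"
    using assms(1) by (simp add: has_field_derivative_iff)
  then have "((\<lambda>y. \<bar>(h y - h r) / (y - r)\<bar>) \<longlongrightarrow> \<bar>d\<bar>) (at r)" by (rule tendsto_rabs)
  from order_tendstoD(2)[OF this, of "\<bar>d\<bar> + e"] assms(2)
  obtain \<delta> where \<delta>: "0 < \<delta>" "\<And>y. y \<noteq> r \<Longrightarrow> dist y r < \<delta> \<Longrightarrow> \<bar>(h y - h r) / (y - r)\<bar> < \<bar>d\<bar> + e"
    by (auto simp: eventually_at)
  have "\<bar>h r' - h r\<bar> \<le> (\<bar>d\<bar> + e) * \<bar>r' - r\<bar>" if "\<bar>r' - r\<bar> < \<delta>" for r'
  proof (cases "r' = r")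
    case False
    then have "\<bar>h r' - h r\<bar> / \<bar>r' - r\<bar> < \<bar>d\<bar> + e"
      using \<delta>(2)[of r'] that by (simp add: dist_real_def abs_divide)
    then show ?thesis using False by (simp add: divide_less_eq)
  qed simp
  then show ?thesis using that \<delta>(1) by blast
qed

context gauge_norm
begin

lemma radial_quot_bound:
  assumes h: "(h has_real_derivative d) (at (F (x - x0)))" and e: "0 < e"
  shows "eventually (\<lambda>y. quot (\<lambda>x. h (F (x - x0))) x y \<le> \<bar>d\<bar> + e) (at x)"
proof -
  obtain \<delta> where \<delta>: "0 < \<delta>" "\<And>r'. \<bar>r' - F (x - x0)\<bar> < \<delta> \<Longrightarrow> \<bar>h r' - h (F (x - x0))\<bar> \<le> (\<bar>d\<bar> + e) * \<bar>r' - F (x - x0)\<bar>"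
    using derivative_difference_bound[OF h e] by blast
  obtain C where C: "0 < C" "\<And>x. F x \<le> C * norm x" using F_upper by blast
  have "eventually (\<lambda>y. dist y x < \<delta> / C) (at x)"
    using \<delta>(1) C(1) by (auto simp: eventually_at intro!: exI[of _ "\<delta> / C"])
  then show ?thesis
  proof eventually_elim
    case (elim y)
    have tri: "\<bar>F (y - x0) - F (x - x0)\<bar> \<le> F (y - x)"
      using F_triangle_diff[of "y - x0" "x - x0"] by simp
    have "F (y - x) \<le> C * norm (y - x)" by (rule C)
    also have "\<dots> < \<delta>" using elim C(1) by (simp add: dist_norm field_simps)
    finally have "\<bar>h (F (y - x0)) - h (F (x - x0))\<bar> \<le> (\<bar>d\<bar> + e) * \<bar>F (y - x0) - F (x - x0)\<bar>"
      using tri by (intro \<delta>) simp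
    also have "\<dots> \<le> (\<bar>d\<bar> + e) * F (y - x)"
      using tri e by (intro mult_left_mono) auto
    finally show ?case
      using F_nonneg[of "y - x"] e by (cases "y = x") (auto simp: quot_def divide_le_eq pos)
  qed
qed

text \<open>The upper bound is the chain rule together with \<open>|F (y - x0) - F (x - x0)| \<le> F (y - x)\<close>. Equality
  holds along the ray from \<open>x0\<close> through \<open>x\<close>, so the difference quotients do come close to \<open>|d|\<close>.\<close>

lemma local_lip_radial:
  assumes h: "(h has_real_derivative d) (at (F (x - x0)))" and x: "x \<noteq> x0"
  shows "local_lip F (\<lambda>x. h (F (x - x0))) x = \<bar>d\<bar>"
proof (rule antisym)
  let ?u = "\<lambda>x. h (F (x - x0))" and ?r = "F (x - x0)"
  show "local_lip F ?u x \<le> \<bar>d\<bar>"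
    by (rule field_le_epsilon) (rule Limsup_quot_eq(2)[OF radial_quot_bound[OF h]])
  have r: "0 < ?r" using x by (intro pos) simp
  show "\<bar>d\<bar> \<le> local_lip F ?u x"
  proof (rule ccontr)
    assume "\<not> ?thesis"
    then obtain c where c: "local_lip F ?u x < c" "c < \<bar>d\<bar>" using dense by (auto simp: not_le)
    have "Limsup (at x) (\<lambda>y. ereal (quot ?u x y)) < ereal c"
      unfolding Limsup_quot_eq(1)[OF radial_quot_bound[OF h zero_less_one]] using c by simp
    then have ev: "eventually (\<lambda>y. ereal (quot ?u x y) < ereal c) (at x)" by (rule Limsup_lessD)
    \<comment> \<open>Approach \<open>x\<close> from outside along the ray from \<open>x0\<close>, on which \<open>F (y - x)\<close> is the increment of the radius.\<close>
    have lim: "filterlim (\<lambda>t. x + t *\<^sub>R (x - x0)) (at x) (at_right 0)"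
    proof (rule filterlim_atI)
      have "((\<lambda>t. x + t *\<^sub>R (x - x0)) \<longlongrightarrow> x + 0 *\<^sub>R (x - x0)) (at_right 0)"
        by (intro tendsto_intros)
      then show "((\<lambda>t. x + t *\<^sub>R (x - x0)) \<longlongrightarrow> x) (at_right 0)" by simp
      show "eventually (\<lambda>t. x + t *\<^sub>R (x - x0) \<noteq> x) (at_right 0)"
        using eventually_at_right_less[of "0 :: real"] by eventually_elim (use x in auto)
    qed
    have qt: "quot ?u x (x + t *\<^sub>R (x - x0)) = \<bar>(h (?r + t * ?r) - h ?r) / (t * ?r)\<bar>" if "0 < t" for t
    proof -
      have "x + t *\<^sub>R (x - x0) - x0 = (1 + t) *\<^sub>R (x - x0)" by (simp add: algebra_simps)
      then have "F (x + t *\<^sub>R (x - x0) - x0) = ?r + t * ?r"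
        using that by (simp only: hom) (simp add: algebra_simps)
      moreover have "F (x + t *\<^sub>R (x - x0) - x) = t * ?r" using that by (simp add: hom)
      ultimately show ?thesis using that r by (simp add: quot_def abs_divide abs_mult)
    qed
    have "((\<lambda>k. (h (?r + k) - h ?r) / k) \<longlongrightarrow> d) (at 0)" using h by (simp add: DERIV_def)
    moreover have "filterlim (\<lambda>t. t * ?r) (at 0) (at_right 0)"
    proof (rule filterlim_atI)
      have "((\<lambda>t. t * ?r) \<longlongrightarrow> 0 * ?r) (at_right 0)" by (intro tendsto_intros)
      then show "((\<lambda>t. t * ?r) \<longlongrightarrow> 0) (at_right 0)" by simp
      show "eventually (\<lambda>t. t * ?r \<noteq> 0) (at_right 0)"
        using eventually_at_right_less[of "0 :: real"] by eventually_elim (use r in auto)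
    qed
    ultimately have "((\<lambda>t. (h (?r + t * ?r) - h ?r) / (t * ?r)) \<longlongrightarrow> d) (at_right 0)"
      by (rule filterlim_compose)
    then have "((\<lambda>t. \<bar>(h (?r + t * ?r) - h ?r) / (t * ?r)\<bar>) \<longlongrightarrow> \<bar>d\<bar>) (at_right 0)"
      by (rule tendsto_rabs)
    moreover have "eventually (\<lambda>t. \<bar>(h (?r + t * ?r) - h ?r) / (t * ?r)\<bar> \<le> c) (at_right 0)"
      using eventually_compose_filterlim[OF ev lim] eventually_at_right_less[of "0 :: real"]
    proof eventually_elim
      case (elim t)
      have "quot ?u x (x + t *\<^sub>R (x - x0)) < c" using elim(1) by simp
      then show ?case using qt[OF elim(2)] by simp
    qed
    ultimately have "\<bar>d\<bar> \<le> c"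
      by (intro tendsto_upperbound[where F = "at_right 0"]) auto
    then show False using c by simp
  qed
qed

end

text \<open>The exponents of the theorem in the form used by the one-dimensional inequality: \<open>p\<close> is
  determined by the exponent \<open>s = a * p\<close> of the weight.\<close>

locale extremal_setting = gauge_norm F for F :: "real^'n \<Rightarrow> real" +
  fixes a p :: real
  assumes card: "3 \<le> CARD('n)" and s0: "0 \<le> a * p" and s2: "a * p < 2"
    and p_eq: "p = bliss.p (real CARD('n)) (a * p)"
begin

sublocale B: bliss "real CARD('n)" "a * p"
  by unfold_locales (use card s0 s2 in auto)

lemma pB: "B.p = p" using p_eq by simp

definition prof where "prof l r = (l + r powr (2 - a * p)) powr ((2 - real CARD('n)) / (2 - a * p))"
definition prof' where "prof' l r = (2 - real CARD('n)) * (r powr (1 - a * p) * (l + r powr (2 - a * p)) powr (- B.nu))"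

lemma ckn_extremal_eq: "ckn_extremal F x0 a p l = (\<lambda>x. prof l (F (x - x0)))"
  by (simp add: ckn_extremal_def prof_def fun_eq_iff)

lemma exponents:
  "(2 - real CARD('n)) / (2 - a * p) = 1 - B.nu" "(1 - B.nu) * p = - (2 * B.nu)" "B.nu * (2 / p) = B.nu - 1"
proof -
  let ?n = "real CARD('n)" and ?s = "a * p"
  have nu1: "B.nu - 1 = (?n - 2) / (2 - ?s)"
  proof -
    have "(?n - ?s) / (2 - ?s) - (2 - ?s) / (2 - ?s) = (?n - 2) / (2 - ?s)"
      unfolding diff_divide_distrib[symmetric] by simp
    moreover have "(2 - ?s) / (2 - ?s) = 1" using B.param(10) by simp
    ultimately show ?thesis unfolding B.nu_def by simp
  qed
  show e1: "(2 - ?n) / (2 - ?s) = 1 - B.nu"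
    using nu1 by (metis minus_diff_eq minus_divide_left)
  have "B.p = 2 * B.nu * ((2 - ?s) / (?n - 2))"
    unfolding B.p_def B.nu_def using B.param(10) by simp
  then have "(B.nu - 1) * B.p = 2 * B.nu * (((?n - 2) / (2 - ?s)) * ((2 - ?s) / (?n - 2)))"
    unfolding nu1 by (simp only: mult.assoc mult.left_commute mult.commute)
  also have "((?n - 2) / (2 - ?s)) * ((2 - ?s) / (?n - 2)) = 1"
    using B.param(9,10) by simp
  finally have np: "(B.nu - 1) * p = 2 * B.nu"
    unfolding pB by simp
  then show "(1 - B.nu) * p = - (2 * B.nu)" by (simp add: algebra_simps)
  have "p \<noteq> 0" using B.param(5) pB by simp
  moreover have "B.nu * 2 = (B.nu - 1) * p" using np by simp
  ultimately show "B.nu * (2 / p) = B.nu - 1" by (simp add: divide_eq_eq)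
qed

lemma base_pos: "0 < l \<Longrightarrow> 0 < l + r powr (2 - a * p)"
  by (simp add: add_pos_nonneg)

lemma prof_deriv:
  assumes "0 < l" "0 < r" shows "(prof l has_real_derivative prof' l r) (at r)"
proof -
  have d: "((\<lambda>r. l + r powr (2 - a * p)) has_real_derivative (2 - a * p) * r powr (1 - a * p)) (at r)"
    using DERIV_add[OF DERIV_const has_real_derivative_powr[OF assms(2), of "2 - a * p"], of l] by simp
  have "((\<lambda>r. (l + r powr (2 - a * p)) powr (1 - B.nu)) has_real_derivative
      (1 - B.nu) * (l + r powr (2 - a * p)) powr (1 - B.nu - 1) * ((2 - a * p) * r powr (1 - a * p))) (at r)"
    using DERIV_chain[OF has_real_derivative_powr[OF base_pos[OF assms(1)], of "1 - B.nu"] d] by (simp add: o_def)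
  moreover have "(1 - B.nu) * (2 - a * p) = 2 - real CARD('n)"
    using exponents(1) B.param(10) by (simp add: divide_eq_eq)
  then have "(1 - B.nu) * (l + r powr (2 - a * p)) powr (1 - B.nu - 1) * ((2 - a * p) * r powr (1 - a * p)) = prof' l r"
    unfolding prof'_def by (simp add: mult_ac)
  ultimately show ?thesis
    unfolding prof_def[abs_def] exponents(1) by simp
qed

lemma prof_pos: "0 < l \<Longrightarrow> 0 < prof l r"
  using base_pos[of l r] by (simp add: prof_def)

lemma prof_cont: "0 < l \<Longrightarrow> continuous_on {0..} (prof l)"
  unfolding prof_def using base_pos[of l] B.param
  by (intro continuous_on_powr' continuous_on_add continuous_intros) (auto simp: less_imp_le, (metis less_irrefl)+)

lemma prof_antimono: "0 < l \<Longrightarrow> 0 \<le> r \<Longrightarrow> r \<le> r' \<Longrightarrow> prof l r' \<le> prof l r"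
  unfolding prof_def exponents(1) using base_pos[of l r] B.param
  by (intro powr_mono2') (auto intro!: powr_mono2)

lemma measurable_prof [measurable]: "prof l \<in> borel_measurable borel" "prof' l \<in> borel_measurable borel"
  unfolding prof_def[abs_def] prof'_def[abs_def] by measurable

lemma extremal_cont: "0 < l \<Longrightarrow> continuous_on UNIV (ckn_extremal F x0 a p l)"
  unfolding ckn_extremal_eq
  by (rule continuous_on_compose2[OF prof_cont continuous_on_compose2[OF cont]])
     (auto intro!: continuous_intros simp: F_nonneg)

lemma local_lip_extremal:
  "0 < l \<Longrightarrow> x \<noteq> x0 \<Longrightarrow> local_lip F (ckn_extremal F x0 a p l) x = \<bar>prof' l (F (x - x0))\<bar>"
  unfolding ckn_extremal_eq by (intro local_lip_radial prof_deriv pos) auto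

text \<open>The value of the mass \<open>I\<close> of \<open>core_inequality\<close> for the extremal with parameter \<open>l\<close>.\<close>

definition Il where "Il l = l powr (- B.nu) * B.J"

lemma extremal_mass:
  assumes l: "0 < l"
  shows "(\<integral>\<^sup>+x. ennreal (ckn_integrand F x0 a p (ckn_extremal F x0 a p l) x) \<partial>lborel)
     = ennreal (real CARD('n) * b * Il l)"
proof -
  let ?n = "real CARD('n)" and ?s = "a * p"
  have e: "(2 - ?s) * B.nu - 1 = ?n - 1 - ?s" using B.param by (simp add: B.nu_def)
  have "(\<integral>\<^sup>+x. ennreal (ckn_integrand F x0 a p (ckn_extremal F x0 a p l) x) \<partial>lborel)
      = (\<integral>\<^sup>+x. ennreal (prof l (F (x - x0)) powr p / F (x - x0) powr ?s) \<partial>lborel)"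
    using prof_pos[OF l] by (simp add: ckn_integrand_def ckn_extremal_eq abs_of_pos)
  also have "\<dots> = (\<integral>\<^sup>+r. ennreal (?n * b * r ^ (CARD('n) - 1) * indicator {0<..} r) * ennreal (prof l r powr p / r powr ?s) \<partial>lborel)"
    using nn_integral_radial[of "\<lambda>r. ennreal (prof l r powr p / r powr ?s)" x0] by simp
  also have "\<dots> = (\<integral>\<^sup>+r. ennreal (?n * b) * ennreal (r powr ((2 - ?s) * B.nu - 1) * (l + r powr (2 - ?s)) powr (- (B.nu + B.nu)) * indicator {0<..} r) \<partial>lborel)"
  proof (rule nn_integral_cong)
    fix r :: real
    show "ennreal (?n * b * r ^ (CARD('n) - 1) * indicator {0<..} r) * ennreal (prof l r powr p / r powr ?s)
      = ennreal (?n * b) * ennreal (r powr ((2 - ?s) * B.nu - 1) * (l + r powr (2 - ?s)) powr (- (B.nu + B.nu)) * indicator {0<..} r)"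
    proof (cases "0 < r")
      case True
      have "prof l r powr p = (l + r powr (2 - ?s)) powr (- (B.nu + B.nu))"
        unfolding prof_def exponents(1) powr_powr exponents(2) by simp
      note a1 = this
      have a2: "r ^ (CARD('n) - 1) = r powr (?n - 1)"
        using True card by (simp add: powr_realpow[symmetric] of_nat_diff)
      have a3: "r powr (?n - 1) / r powr ?s = r powr (?n - 1 - ?s)" by (simp add: powr_diff)
      have "?n * b * r ^ (CARD('n) - 1) * (prof l r powr p / r powr ?s)
          = ?n * b * ((r ^ (CARD('n) - 1) / r powr ?s) * prof l r powr p)"
        by simp
      also have "\<dots> = ?n * b * (r powr (?n - 1 - ?s) * (l + r powr (2 - ?s)) powr (- (B.nu + B.nu)))"
        unfolding a1 a2 a3 ..
      finally have "ennreal (?n * b * r ^ (CARD('n) - 1)) * ennreal (prof l r powr p / r powr ?s)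
          = ennreal (?n * b) * ennreal (r powr (?n - 1 - ?s) * (l + r powr (2 - ?s)) powr (- (B.nu + B.nu)))"
        using True b_pos by (subst (1 2) ennreal_mult'[symmetric]) simp_all
      then show ?thesis using True unfolding e by simp
    qed simp
  qed
  also have "\<dots> = ennreal (?n * b) * ennreal (l powr (- B.nu) * (Beta B.nu B.nu / (2 - ?s)))"
    by (subst nn_integral_cmult)
       (simp_all only: nn_integral_Beta_half_line_scaled[OF B.param(3) B.param(3) B.param(10) l], measurable)
  also have "\<dots> = ennreal (?n * b * Il l)"
    unfolding Il_def B.J_def[symmetric] using b_pos by (intro ennreal_mult'[symmetric]) simp
  finally show ?thesis .
qed

text \<open>After the substitution the integral is a Beta integral with the parameters \<open>nu + 1\<close> and
  \<open>nu - 1\<close>, whereas the mass above has \<open>nu\<close> and \<open>nu\<close>; \<open>Beta_step\<close> relates the two. The result is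
  written so that it is visibly the case of equality in \<open>core_inequality\<close>.\<close>

lemma extremal_energy:
  assumes l: "0 < l"
  shows "(\<integral>\<^sup>+x. ennreal ((local_lip F (ckn_extremal F x0 a p l) x)\<^sup>2) \<partial>lborel)
     = ennreal (real CARD('n) * b * ((real CARD('n) - 2) * (real CARD('n) - a * p) * B.J * (Il l / B.J) powr (2 / p)))"
proof -
  let ?n = "real CARD('n)" and ?s = "a * p"
  have e: "(2 - ?s) * (B.nu + 1) - 1 = (?n - 1) + (2 * (1 - ?s))"
  proof -
    have "(2 - ?s) * B.nu = ?n - ?s" using B.param(10) by (simp add: B.nu_def)
    then show ?thesis unfolding distrib_left by simp
  qed
  have "(\<integral>\<^sup>+x. ennreal ((local_lip F (ckn_extremal F x0 a p l) x)\<^sup>2) \<partial>lborel)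
      = (\<integral>\<^sup>+x. ennreal ((prof' l (F (x - x0)))\<^sup>2) \<partial>lborel)"
  proof (rule nn_integral_cong_AE)
    have "AE x in lborel. x \<noteq> x0" by (rule AE_lborel_singleton)
    then show "AE x in lborel. ennreal ((local_lip F (ckn_extremal F x0 a p l) x)\<^sup>2) = ennreal ((prof' l (F (x - x0)))\<^sup>2)"
      by eventually_elim (simp add: local_lip_extremal[OF l])
  qed
  also have "\<dots> = (\<integral>\<^sup>+r. ennreal (?n * b * r ^ (CARD('n) - 1) * indicator {0<..} r) * ennreal ((prof' l r)\<^sup>2) \<partial>lborel)"
    using nn_integral_radial[of "\<lambda>r. ennreal ((prof' l r)\<^sup>2)" x0] by simp
  also have "\<dots> = (\<integral>\<^sup>+r. ennreal (?n * b * (?n - 2)\<^sup>2) * ennreal (r powr ((2 - ?s) * (B.nu + 1) - 1) * (l + r powr (2 - ?s)) powr (- (B.nu + 1 + (B.nu - 1))) * indicator {0<..} r) \<partial>lborel)"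
  proof (rule nn_integral_cong)
    fix r :: real
    show "ennreal (?n * b * r ^ (CARD('n) - 1) * indicator {0<..} r) * ennreal ((prof' l r)\<^sup>2)
      = ennreal (?n * b * (?n - 2)\<^sup>2) * ennreal (r powr ((2 - ?s) * (B.nu + 1) - 1) * (l + r powr (2 - ?s)) powr (- (B.nu + 1 + (B.nu - 1))) * indicator {0<..} r)"
    proof (cases "0 < r")
      case True
      have sq: "(x powr y)\<^sup>2 = x powr (2 * y)" for x y :: real
        by (simp add: power2_eq_square powr_add[symmetric])
      have "(prof' l r)\<^sup>2 = (?n - 2)\<^sup>2 * (r powr (2 * (1 - ?s)) * (l + r powr (2 - ?s)) powr (2 * (- B.nu)))"
        unfolding prof'_def power_mult_distrib sq by (simp add: power2_commute)
      moreover have "r ^ (CARD('n) - 1) = r powr (?n - 1)"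
        using True card by (simp add: powr_realpow[symmetric] of_nat_diff)
      ultimately have "?n * b * r ^ (CARD('n) - 1) * (prof' l r)\<^sup>2
          = ?n * b * (?n - 2)\<^sup>2 * ((r powr (?n - 1) * r powr (2 * (1 - ?s))) * (l + r powr (2 - ?s)) powr (2 * (- B.nu)))"
        by (simp only: mult.assoc mult.left_commute mult.commute)
      also have "\<dots> = ?n * b * (?n - 2)\<^sup>2 * (r powr ((2 - ?s) * (B.nu + 1) - 1) * (l + r powr (2 - ?s)) powr (- (B.nu + 1 + (B.nu - 1))))"
        unfolding e powr_add by simp
      finally have "ennreal (?n * b * r ^ (CARD('n) - 1)) * ennreal ((prof' l r)\<^sup>2)
        = ennreal (?n * b * (?n - 2)\<^sup>2) * ennreal (r powr ((2 - ?s) * (B.nu + 1) - 1) * (l + r powr (2 - ?s)) powr (- (B.nu + 1 + (B.nu - 1))))"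
        using True b_pos by (subst (1 2) ennreal_mult'[symmetric]) simp_all
      then show ?thesis using True by simp
    qed simp
  qed
  also have "\<dots> = ennreal (?n * b * (?n - 2)\<^sup>2) * ennreal (l powr (- (B.nu - 1)) * (Beta (B.nu + 1) (B.nu - 1) / (2 - ?s)))"
  proof -
    have "0 < B.nu + 1" "0 < B.nu - 1" using B.param by auto
    note scaled = nn_integral_Beta_half_line_scaled[OF this B.param(10) l]
    show ?thesis
      by (subst nn_integral_cmult) (simp_all only: scaled, measurable)
  qed
  also have "\<dots> = ennreal (?n * b * ((?n - 2) * (?n - ?s) * B.J * (Il l / B.J) powr (2 / p)))"
  proof -
    have "Il l / B.J = l powr (- B.nu)" using B.J_pos by (simp add: Il_def)
    then have f1: "(Il l / B.J) powr (2 / p) = l powr (- (B.nu - 1))"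
      by (simp only: powr_powr minus_mult_left[symmetric] exponents(3))
    have f2: "Beta (B.nu + 1) (B.nu - 1) / (2 - ?s) = (?n - ?s) / (?n - 2) * B.J"
      unfolding B.Beta_step B.J_def by simp
    have f3: "(?n - 2)\<^sup>2 * ((?n - ?s) / (?n - 2) * B.J) = (?n - 2) * (?n - ?s) * B.J"
      using B.param(9) by (simp add: power2_eq_square)
    have "?n * b * (?n - 2)\<^sup>2 * (l powr (- (B.nu - 1)) * (Beta (B.nu + 1) (B.nu - 1) / (2 - ?s)))
        = ?n * b * ((?n - 2)\<^sup>2 * ((?n - ?s) / (?n - 2) * B.J) * l powr (- (B.nu - 1)))"
      unfolding f2 by (simp only: mult.assoc mult.left_commute mult.commute)
    also have "\<dots> = ?n * b * ((?n - 2) * (?n - ?s) * B.J * (Il l / B.J) powr (2 / p))"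
      unfolding f3 f1 ..
    finally show ?thesis using b_pos by (subst ennreal_mult'[symmetric]) simp_all
  qed
  finally show ?thesis .
qed

end

section \<open>Equality and optimality\<close>

context extremal_setting
begin

lemma Il_nonneg: "0 \<le> Il l" using B.J_pos by (simp add: Il_def)

lemma Il_pos: "0 < l \<Longrightarrow> 0 < Il l" using B.J_pos by (simp add: Il_def)

definition El where "El l = real CARD('n) * b * ((real CARD('n) - 2) * (real CARD('n) - a * p) * B.J * (Il l / B.J) powr (2 / p))"

lemma El_nonneg: "0 \<le> El l"
  using B.J_pos b_pos B.param by (simp add: El_def)

lemma extremal_measurable:
  assumes "0 < l"
  shows "ckn_integrand F x0 a p (ckn_extremal F x0 a p l) \<in> borel_measurable borel"
    and "(\<lambda>x. (local_lip F (ckn_extremal F x0 a p l) x)\<^sup>2) \<in> borel_measurable borel"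
proof -
  have [measurable]: "ckn_extremal F x0 a p l \<in> borel_measurable borel"
    "local_lip F (ckn_extremal F x0 a p l) \<in> borel_measurable borel"
    using extremal_cont[OF assms] local_lip_measurable by (auto intro: borel_measurable_continuous_onI)
  show "ckn_integrand F x0 a p (ckn_extremal F x0 a p l) \<in> borel_measurable borel"
    unfolding ckn_integrand_def[abs_def] by measurable
  show "(\<lambda>x. (local_lip F (ckn_extremal F x0 a p l) x)\<^sup>2) \<in> borel_measurable borel"
    by measurable
qed

lemma ckn_integrand_nonneg: "0 \<le> ckn_integrand F x0 a p u x"
  by (simp add: ckn_integrand_def)

lemma
  assumes l: "0 < l"
  shows extremal_integrable: "ckn_integrable F x0 a p (ckn_extremal F x0 a p l)"
    and extremal_lhs: "ckn_lhs F x0 a p (ckn_extremal F x0 a p l) = (real CARD('n) * om * Il l) powr (1 / p)"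
    and extremal_rhs: "ckn_rhs F (ckn_extremal F x0 a p l) = (cs * El l) powr (1 / 2)"
proof -
  have P0: "0 \<le> real CARD('n) * b * Il l" using Il_nonneg b_pos by simp
  note L = integral_minkowski[OF extremal_measurable(1)[OF l, of x0] ckn_integrand_nonneg extremal_mass[OF l] P0]
  note R = integral_minkowski[OF extremal_measurable(2)[OF l, of x0] zero_le_power2 extremal_energy[OF l, folded El_def] El_nonneg]
  show "ckn_integrable F x0 a p (ckn_extremal F x0 a p l)"
    unfolding ckn_integrable_def using L(1) R(1) by simp
  have eq: "cs * (real CARD('n) * b * Il l) = real CARD('n) * om * Il l"
    unfolding cs_b[symmetric] by simp
  show "ckn_lhs F x0 a p (ckn_extremal F x0 a p l) = (real CARD('n) * om * Il l) powr (1 / p)"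
    unfolding ckn_lhs_def L(2) eq ..
  show "ckn_rhs F (ckn_extremal F x0 a p l) = (cs * El l) powr (1 / 2)"
    unfolding ckn_rhs_def R(2) ..
qed

lemma extremal_equality:
  assumes l: "0 < l"
  shows "ckn_lhs F x0 a p (ckn_extremal F x0 a p l)
       = ckn_const (real CARD('n)) a p * ckn_rhs F (ckn_extremal F x0 a p l)"
proof -
  let ?n = "real CARD('n)"
  have W: "0 < ?n * om" using om_pos B.param by simp
  have M: "0 < (?n - 2) * (?n - a * p)" using B.param by simp
  have pp: "0 < p" using B.param(5) pB by simp
  have "cs * El l = ?n * (cs * b) * ((?n - 2) * (?n - a * p) * B.J * (Il l / B.J) powr (2 / p))"
    unfolding El_def by simp
  then have "cs * El l = ?n * om * ((?n - 2) * (?n - a * p) * B.J * (Il l / B.J) powr (2 / p))"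
    unfolding cs_b .
  then show ?thesis
    unfolding extremal_lhs[OF l] extremal_rhs[OF l] ckn_const_eq[OF B.n B.s refl] pB
    using sharp_constant_algebra[OF M W B.J_pos Il_nonneg[of l] pp] by (simp add: om_def)
qed

text \<open>The extremal with parameter 1 is made constant on the ball of radius \<open>1 / (i + 1)\<close>, where for
  \<open>s > 1\<close> it is not Lipschitz, and is lowered to vanish outside the ball of radius \<open>i + 1\<close>.\<close>

definition clamp where "clamp i r = max (1 / real (Suc i)) (min r (real (Suc i)))"

definition approx where
  "approx x0 i x = prof 1 (clamp i (F (x - x0))) - prof 1 (real (Suc i))"

lemma clamp_bounds: "1 / real (Suc i) \<le> clamp i r" "clamp i r \<le> real (Suc i)" "0 < clamp i r"
proof -
  have "1 / real (Suc i) \<le> real (Suc i)" by (simp add: field_simps)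
  then show le: "1 / real (Suc i) \<le> clamp i r" and "clamp i r \<le> real (Suc i)"
    by (auto simp: clamp_def)
  have "0 < 1 / real (Suc i)" by simp
  then show "0 < clamp i r" using le by (rule less_le_trans)
qed

lemma approx_nonneg: "0 \<le> approx x0 i x"
  unfolding approx_def using prof_antimono[of 1 "clamp i (F (x - x0))" "real (Suc i)"] clamp_bounds[of i "F (x - x0)"]
  by simp

lemma clamp_eq: "1 / real (Suc i) \<le> r \<Longrightarrow> r \<le> real (Suc i) \<Longrightarrow> clamp i r = r"
  by (simp add: clamp_def)

text \<open>Truncation does not increase differences, because the profile is monotone and \<open>clamp\<close> maps an
  interval into itself or to a single point.\<close>

lemma prof_clamp_diff:
  assumes "0 \<le> r" "r \<le> r'"
  shows "0 \<le> prof 1 (clamp i r) - prof 1 (clamp i r')"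
    and "prof 1 (clamp i r) - prof 1 (clamp i r') \<le> prof 1 r - prof 1 r'"
proof -
  have le: "clamp i r \<le> clamp i r'" using assms by (auto simp: clamp_def)
  then show "0 \<le> prof 1 (clamp i r) - prof 1 (clamp i r')"
    using prof_antimono[of 1 "clamp i r" "clamp i r'"] clamp_bounds(3)[of i r] by simp
  show "prof 1 (clamp i r) - prof 1 (clamp i r') \<le> prof 1 r - prof 1 r'"
  proof (cases "clamp i r = clamp i r'")
    case True
    then show ?thesis using prof_antimono[of 1 r r'] assms by simp
  next
    case False
    then have "r \<le> clamp i r" "clamp i r' \<le> r'"
      using le assms by (auto simp: clamp_def max_def min_def split: if_splits)
    then have "prof 1 (clamp i r) \<le> prof 1 r" "prof 1 r' \<le> prof 1 (clamp i r')"
      using assms clamp_bounds(3)[of i r'] by (auto intro!: prof_antimono)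
    then show ?thesis by simp
  qed
qed

lemma approx_le: "approx x0 i x \<le> ckn_extremal F x0 a p 1 x"
proof (cases "F (x - x0) \<le> real (Suc i)")
  case True
  have c: "clamp i (real (Suc i)) = real (Suc i)" by (rule clamp_eq) (simp_all add: field_simps)
  show ?thesis
    using prof_clamp_diff(2)[OF F_nonneg True, of i] prof_pos[of 1 "real (Suc i)"]
    unfolding approx_def ckn_extremal_eq c by simp
next
  case False
  then have "clamp i (F (x - x0)) = clamp i (real (Suc i))" by (simp add: clamp_def)
  also have "\<dots> = real (Suc i)" by (rule clamp_eq) (simp_all add: field_simps)
  finally show ?thesis
    unfolding approx_def ckn_extremal_eq using prof_pos[of 1 "F (x - x0)"] by simp
qed

lemma approx_Lip0: "approx x0 i \<in> Lip0"
proof -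
  let ?e = "1 / real (Suc i)" and ?M = "real (Suc i)"
  have e: "0 < ?e" by simp
  have "continuous_on {?e..?M} (prof' 1)"
    unfolding prof'_def
  proof (intro continuous_intros ballI)
    fix z assume "z \<in> {?e..?M}"
    then show z: "z \<noteq> 0" using e by (metis atLeastAtMost_iff not_le)
    show "z \<noteq> 0" by (rule z)
    show "1 + z powr (2 - a * p) \<noteq> 0" using base_pos[of 1 z] by simp
  qed
  then have "bounded (prof' 1 ` {?e..?M})"
    by (intro compact_imp_bounded compact_continuous_image) auto
  then obtain Q where Q: "0 < Q" "\<And>r. r \<in> {?e..?M} \<Longrightarrow> norm (prof' 1 r) \<le> Q"
    unfolding bounded_pos by blast
  obtain C where C: "0 < C" "\<And>x. F x \<le> C * norm x" using F_upper by blast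
  have "(Q * C)-lipschitz_on UNIV (approx x0 i)"
  proof (rule lipschitz_onI)
    fix x y :: "real^'n"
    let ?r = "F (x - x0)" and ?r' = "F (y - x0)"
    have "norm (prof 1 (clamp i ?r) - prof 1 (clamp i ?r')) \<le> Q * norm (clamp i ?r - clamp i ?r')"
    proof (rule field_differentiable_bound[where S = "{?e..?M}" and f' = "prof' 1"])
      show "convex {?e..?M}" by simp
      show "(prof 1 has_field_derivative prof' 1 z) (at z within {?e..?M})" if z: "z \<in> {?e..?M}" for z
      proof -
        have "?e \<le> z" using z by simp
        with e have "0 < z" by (rule less_le_trans)
        then show ?thesis
          using prof_deriv[OF zero_less_one, of z] has_field_derivative_at_within by blast
      qed
      show "norm (prof' 1 z) \<le> Q" if "z \<in> {?e..?M}" for z by (rule Q(2)[OF that])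
      show "clamp i ?r \<in> {?e..?M}" "clamp i ?r' \<in> {?e..?M}"
        using clamp_bounds(1,2)[of i ?r] clamp_bounds(1,2)[of i ?r'] by (simp_all only: atLeastAtMost_iff simp_thms)
    qed
    also have "\<dots> \<le> Q * (C * norm (x - y))"
    proof (intro mult_left_mono)
      have "norm (clamp i ?r - clamp i ?r') \<le> \<bar>?r - ?r'\<bar>"
        by (simp add: clamp_def)
      also have "\<dots> \<le> F (x - y)"
        using F_triangle_diff[of "x - x0" "y - x0"] by simp
      also have "\<dots> \<le> C * norm (x - y)" by (rule C)
      finally show "norm (clamp i ?r - clamp i ?r') \<le> C * norm (x - y)" .
    qed (use Q in simp)
    finally show "dist (approx x0 i x) (approx x0 i y) \<le> Q * C * dist x y"
      using Q(1) by (simp add: approx_def dist_norm mult.assoc)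
  qed (use Q C in simp)
  moreover have "compact (closure {x. approx x0 i x \<noteq> 0})"
  proof -
    have "approx x0 i x = 0" if "?M \<le> F (x - x0)" for x
    proof -
      have "clamp i (F (x - x0)) = clamp i ?M" using that by (simp add: clamp_def)
      also have "\<dots> = ?M" by (rule clamp_eq) (simp_all add: field_simps)
      finally show ?thesis by (simp add: approx_def)
    qed
    then have "{x. approx x0 i x \<noteq> 0} \<subseteq> {x. F (x - x0) < ?M}"
      using not_less by blast
    then show ?thesis
      unfolding compact_closure using bounded_gauge_ball bounded_subset by blast
  qed
  ultimately show ?thesis by (auto simp: Lip0_def)
qed

lemma approx_rhs_le: "ckn_rhs F (approx x0 i) \<le> ckn_rhs F (ckn_extremal F x0 a p 1)"
proof -
  let ?u = "approx x0 i" and ?w = "ckn_extremal F x0 a p 1"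
  obtain E where E: "0 \<le> E" "(\<integral>\<^sup>+x. ennreal ((local_lip F ?u x)\<^sup>2) \<partial>lborel) = ennreal E"
    using Lip0_energy[OF approx_Lip0] .
  have [measurable]: "local_lip F ?u \<in> borel_measurable borel"
    by (rule local_lip_measurable[OF Lip0_cont[OF approx_Lip0]])
  have "(\<lambda>x. (local_lip F ?u x)\<^sup>2) \<in> borel_measurable borel" by measurable
  note R = integral_minkowski[OF this zero_le_power2 E(2,1)]
  have quot: "quot ?u x y \<le> quot ?w x y" for x y
  proof -
    have "\<bar>?u y - ?u x\<bar> \<le> \<bar>?w y - ?w x\<bar>"
    proof (cases "F (x - x0) \<le> F (y - x0)")
      case True
      then show ?thesis
        using prof_clamp_diff[OF F_nonneg True, of i] by (simp add: approx_def ckn_extremal_eq)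
    next
      case False
      then have "F (y - x0) \<le> F (x - x0)" by simp
      from prof_clamp_diff[OF F_nonneg this, of i] show ?thesis by (simp add: approx_def ckn_extremal_eq)
    qed
    then show ?thesis unfolding quot_def using F_nonneg by (rule divide_right_mono)
  qed
  have le: "local_lip F ?u x \<le> local_lip F ?w x" if "x \<noteq> x0" for x
  proof (rule local_lip_mono[OF quot])
    have "0 < F (x - x0)" using that by (intro pos) simp
    then show "eventually (\<lambda>y. quot ?w x y \<le> \<bar>prof' 1 (F (x - x0))\<bar> + 1) (at x)"
      unfolding ckn_extremal_eq by (intro radial_quot_bound prof_deriv) auto
  qed
  have "ennreal E \<le> ennreal (El 1)"
    unfolding E(2)[symmetric] El_def extremal_energy[OF zero_less_one, symmetric, of x0]
  proof (rule nn_integral_mono_AE)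
    have "AE x in lborel. x \<noteq> x0" by (rule AE_lborel_singleton)
    then show "AE x in lborel. ennreal ((local_lip F ?u x)\<^sup>2) \<le> ennreal ((local_lip F ?w x)\<^sup>2)"
      by eventually_elim (intro ennreal_leI power_mono le local_lip_nonneg)
  qed
  then have "E \<le> El 1" using El_nonneg by (simp add: ennreal_le_iff)
  then show ?thesis
    unfolding extremal_rhs[OF zero_less_one] unfolding ckn_rhs_def R(2)
    using cs_pos E(1) by (intro powr_mono2) auto
qed

lemma prof_at_top: "(\<lambda>i. prof 1 (real (Suc i))) \<longlonglongrightarrow> 0"
proof -
  let ?e = "(2 - a * p) * (1 - B.nu)"
  have "?e < 0" using B.param by (intro mult_pos_neg) auto
  then have lim: "(\<lambda>i. real (Suc i) powr ?e) \<longlonglongrightarrow> 0"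
    by (intro tendsto_neg_powr filterlim_compose[OF filterlim_real_sequentially filterlim_Suc])
  have le: "prof 1 (real (Suc i)) \<le> real (Suc i) powr ?e" for i
  proof -
    have "(1 + real (Suc i) powr (2 - a * p)) powr (1 - B.nu) \<le> (real (Suc i) powr (2 - a * p)) powr (1 - B.nu)"
      using B.param by (intro powr_mono2') auto
    then show ?thesis unfolding prof_def exponents(1) by (simp add: powr_powr)
  qed
  show ?thesis
    by (rule tendsto_sandwich[OF _ _ tendsto_const lim]) (use le prof_pos[of 1] in \<open>auto intro!: always_eventually less_imp_le\<close>)
qed

lemma approx_lim:
  assumes "x \<noteq> x0" shows "(\<lambda>i. approx x0 i x) \<longlonglongrightarrow> ckn_extremal F x0 a p 1 x"
proof -
  let ?r = "F (x - x0)"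
  have r: "0 < ?r" using assms by (intro pos) simp
  obtain i0 where i0: "1 / real (Suc i0) < ?r" using nat_approx_posE[OF r] by auto
  obtain i1 :: nat where i1: "?r \<le> real i1" using real_arch_simple by blast
  have ev: "eventually (\<lambda>i. prof 1 ?r - prof 1 (real (Suc i)) = approx x0 i x) sequentially"
  proof (rule eventually_sequentiallyI[of "max i0 i1"])
    fix i assume "max i0 i1 \<le> i"
    then have "1 / real (Suc i) \<le> 1 / real (Suc i0)" "real i1 \<le> real (Suc i)"
      by (auto simp: frac_le)
    then have "clamp i ?r = ?r" using i0 i1 by (intro clamp_eq) auto
    then show "prof 1 ?r - prof 1 (real (Suc i)) = approx x0 i x" by (simp add: approx_def)
  qed
  have "(\<lambda>i. prof 1 ?r - prof 1 (real (Suc i))) \<longlonglongrightarrow> prof 1 ?r - 0"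
    by (intro tendsto_diff tendsto_const prof_at_top)
  then have "(\<lambda>i. approx x0 i x) \<longlonglongrightarrow> prof 1 ?r - 0"
    by (rule Lim_transform_eventually[OF _ ev])
  then show ?thesis by (simp add: ckn_extremal_eq)
qed

lemma approx_lhs_lim: "(\<lambda>i. ckn_lhs F x0 a p (approx x0 i)) \<longlonglongrightarrow> ckn_lhs F x0 a p (ckn_extremal F x0 a p 1)"
proof -
  let ?w = "ckn_extremal F x0 a p 1" and ?P = "real CARD('n) * b * Il 1"
  have pp: "0 < p" using B.param(5) pB by simp
  have P0: "0 \<le> ?P" using Il_nonneg b_pos by simp
  have meas: "ckn_integrand F x0 a p (approx x0 i) \<in> borel_measurable borel" for i
  proof -
    have [measurable]: "approx x0 i \<in> borel_measurable borel"
      using Lip0_cont[OF approx_Lip0] by (rule borel_measurable_continuous_onI)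
    show ?thesis unfolding ckn_integrand_def[abs_def] by measurable
  qed
  have le: "ckn_integrand F x0 a p (approx x0 i) x \<le> ckn_integrand F x0 a p ?w x" for i x
    unfolding ckn_integrand_def using approx_nonneg[of x0 i x] approx_le[of x0 i x] pp
    by (intro divide_right_mono powr_mono2) auto
  have lim: "(\<lambda>i. \<integral>\<^sup>+x. ennreal (ckn_integrand F x0 a p (approx x0 i) x) \<partial>lborel)
      \<longlonglongrightarrow> (\<integral>\<^sup>+x. ennreal (ckn_integrand F x0 a p ?w x) \<partial>lborel)"
  proof (rule nn_integral_dominated_convergence[where w = "\<lambda>x. ennreal (ckn_integrand F x0 a p ?w x)"])
    show "(\<integral>\<^sup>+x. ennreal (ckn_integrand F x0 a p ?w x) \<partial>lborel) < \<infinity>"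
      unfolding extremal_mass[OF zero_less_one] by simp
    show "AE x in lborel. ennreal (ckn_integrand F x0 a p (approx x0 i) x) \<le> ennreal (ckn_integrand F x0 a p ?w x)" for i
      using le by (auto intro!: ennreal_leI)
    have "AE x in lborel. x \<noteq> x0" by (rule AE_lborel_singleton)
    then show "AE x in lborel. (\<lambda>i. ennreal (ckn_integrand F x0 a p (approx x0 i) x)) \<longlonglongrightarrow> ennreal (ckn_integrand F x0 a p ?w x)"
    proof eventually_elim
      case (elim x)
      have "F (x - x0) powr (a * p) \<noteq> 0" using F_eq_zero_iff[of "x - x0"] elim by simp
      moreover have "?w x \<noteq> 0" using prof_pos[of 1 "F (x - x0)"] by (simp add: ckn_extremal_eq)
      ultimately show ?case
        unfolding ckn_integrand_def by (intro tendsto_ennrealI tendsto_intros approx_lim[OF elim]) auto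
    qed
  qed (use meas extremal_measurable(1)[OF zero_less_one] in auto)
  have "\<exists>P. 0 \<le> P \<and> (\<integral>\<^sup>+x. ennreal (ckn_integrand F x0 a p (approx x0 i) x) \<partial>lborel) = ennreal P" for i
  proof -
    have "(\<integral>\<^sup>+x. ennreal (ckn_integrand F x0 a p (approx x0 i) x) \<partial>lborel) \<le> ennreal ?P"
      unfolding extremal_mass[OF zero_less_one, symmetric, of x0] by (intro nn_integral_mono ennreal_leI le)
    then show ?thesis
      by (cases "\<integral>\<^sup>+x. ennreal (ckn_integrand F x0 a p (approx x0 i) x) \<partial>lborel" rule: ennreal_cases) (auto simp: top_unique)
  qed
  then obtain P where P: "\<And>i. 0 \<le> P i" "\<And>i. (\<integral>\<^sup>+x. ennreal (ckn_integrand F x0 a p (approx x0 i) x) \<partial>lborel) = ennreal (P i)"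
    by metis
  have "P \<longlonglongrightarrow> ?P"
    using lim unfolding P(2) extremal_mass[OF zero_less_one] using P(1) P0 by (simp add: tendsto_ennreal_iff)
  moreover have "0 < cs * ?P" using cs_pos b_pos B.param Il_pos[of 1] by simp
  ultimately have "(\<lambda>i. (cs * P i) powr (1 / p)) \<longlonglongrightarrow> (cs * ?P) powr (1 / p)"
    by (intro tendsto_intros) auto
  moreover have "ckn_lhs F x0 a p (approx x0 i) = (cs * P i) powr (1 / p)" for i
    unfolding ckn_lhs_def integral_minkowski(2)[OF meas ckn_integrand_nonneg P(2,1)] ..
  moreover have "ckn_lhs F x0 a p ?w = (cs * ?P) powr (1 / p)"
    unfolding ckn_lhs_def integral_minkowski(2)[OF extremal_measurable(1)[OF zero_less_one] ckn_integrand_nonneg extremal_mass[OF zero_less_one] P0] ..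
  ultimately show ?thesis by simp
qed

lemma sharp_constant_optimal:
  assumes C: "C < ckn_const (real CARD('n)) a p"
  shows "\<exists>u\<in>Lip0. \<not> ckn_lhs F x0 a p u \<le> C * ckn_rhs F u"
proof -
  let ?w = "ckn_extremal F x0 a p 1" and ?K = "ckn_const (real CARD('n)) a p"
  have Wpos: "0 < real CARD('n) * om * Il 1" using om_pos B.param Il_pos[of 1] by simp
  then have lhs_pos: "0 < ckn_lhs F x0 a p ?w"
    unfolding extremal_lhs[OF zero_less_one] using om_pos Il_pos[of 1] by simp
  have rhs0: "0 \<le> ckn_rhs F u" for u by (simp add: ckn_rhs_def)
  have rhs_pos: "0 < ckn_rhs F ?w"
    using lhs_pos rhs0[of ?w] unfolding extremal_equality[OF zero_less_one] by (simp add: less_le)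
  have K0: "0 < ?K"
    using lhs_pos rhs_pos unfolding extremal_equality[OF zero_less_one] by (simp add: zero_less_mult_iff)
  define c where "c = max C 0"
  have c: "0 \<le> c" "c < ?K" "C \<le> c" using C K0 by (auto simp: c_def)
  have "c * ckn_rhs F ?w < ckn_lhs F x0 a p ?w"
    unfolding extremal_equality[OF zero_less_one] using c rhs_pos by simp
  from order_tendstoD(1)[OF approx_lhs_lim this]
  obtain i where i: "c * ckn_rhs F ?w < ckn_lhs F x0 a p (approx x0 i)"
    using eventually_happens'[OF sequentially_bot] by blast
  have "C * ckn_rhs F (approx x0 i) \<le> c * ckn_rhs F (approx x0 i)"
    using c rhs0 by (intro mult_right_mono) auto
  also have "\<dots> \<le> c * ckn_rhs F ?w"
    using c by (intro mult_left_mono approx_rhs_le) auto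
  finally show ?thesis
    using i approx_Lip0 by (intro bexI[of _ "approx x0 i"]) auto
qed

end

theorem proposition3p4:
  fixes F :: "real^'n \<Rightarrow> real" and x0 :: "real^'n" and a p :: real
  assumes "3 \<le> CARD('n)"
    and "minkowski_norm F"
    and "0 \<le> a" and "a < 1"
    and "p = 2 * real CARD('n) / (real CARD('n) - 2 + 2 * a)"
  shows "(\<forall>u\<in>Lip0. ckn_integrable F x0 a p u \<and>
            ckn_lhs F x0 a p u \<le> ckn_const (real CARD('n)) a p * ckn_rhs F u) \<and>
         (\<forall>C < ckn_const (real CARD('n)) a p.
            \<exists>u\<in>Lip0. \<not> ckn_lhs F x0 a p u \<le> C * ckn_rhs F u) \<and>
         (\<forall>l>0. ckn_integrable F x0 a p (ckn_extremal F x0 a p l) \<and>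
            ckn_lhs F x0 a p (ckn_extremal F x0 a p l) =
              ckn_const (real CARD('n)) a p * ckn_rhs F (ckn_extremal F x0 a p l))"
proof -
  define n D where "n = real CARD('n)" and "D = n - 2 + 2 * a"
  have n: "3 \<le> n" using assms(1) by (simp add: n_def)
  have D: "0 < D" "n - 2 \<le> D" using n assms(3) by (simp_all add: D_def)
  have p: "p = 2 * n / D" using assms(5) by (simp add: n_def D_def)
  have pp: "0 < p" using p n D by simp
  have s0: "0 \<le> a * p" using assms(3) pp by simp
  have "2 * D - a * (2 * n) = 2 * (n - 2) * (1 - a)"
    by (simp add: D_def algebra_simps)
  then have "a * (2 * n) < 2 * D"
    using n assms(4) by (smt (verit) mult_pos_pos)
  then have s2: "a * p < 2"
    unfolding p using D by (simp add: divide_less_eq)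
  have np: "n - a * p = n * (n - 2) / D"
  proof -
    have "(n - a * p) * D = n * (n - 2)"
      unfolding p using D(1) by (simp add: left_diff_distrib) (simp add: D_def algebra_simps)
    then show ?thesis using D(1) by (simp add: eq_divide_eq)
  qed
  have peq: "p = bliss.p n (a * p)"
  proof -
    have "bliss n (a * p)" by unfold_locales (use n s0 s2 in auto)
    then have "bliss.p n (a * p) = 2 * (n - a * p) / (n - 2)" by (rule bliss.p_def)
    also have "\<dots> = 2 * n / D" unfolding np using n by simp
    finally show ?thesis using p by simp
  qed
  interpret gauge_norm F by (rule minkowski_norm_imp_gauge_norm[OF assms(2)])
  interpret extremal_setting F a p
    by unfold_locales (use assms(1) s0 s2 peq in \<open>auto simp: n_def\<close>)
  show ?thesis
    using Lip0_sharp_inequality[OF card s0 s2 p_eq] sharp_constant_optimal extremal_integrable extremal_equality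
    by blast
qed

end
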